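(* Let $G$ be a countably infinite amenable group and $\pi:(X,G)\to(Y,G)$ a factor map between $G$-systems. Let $n\ge1$ and let $\pi^n:(X^n,G)\to(Y^n,G)$ be the product factor map, where $G$ acts diagonally on $X^n$ and $Y^n$. Then $$\mathrm{mdim}(X|\pi)=\frac1n\,\mathrm{mdim}(X^n|\pi^n),$$ and, for every sofic approximation sequence $\Sigma$ for $G$, $$\mathrm{mdim}_\Sigma(Y|X)=\frac1n\,\mathrm{mdim}_\Sigma(Y^n|X^n).$$
   Context: For $d\in\mathbb N$ write $[d]=\{1,\dots,d\}$ and $\mathrm{Sym}(d)$ for the permutation group of $[d]$. A sofic approximation sequence for a countable group $G$ is a sequence of maps (not necessarily homomorphisms) $\Sigma=\{\sigma_i:G\to\mathrm{Sym}(d_i)\}_{i\ge1}$ such that $\frac1{d_i}|\{v\in[d_i]:\sigma_i(s)\sigma_i(t)(v)=\sigma_i(st)(v)\}|\to1$ for all $s,t\in G$, $\frac1{d_i}|\{v\in[d_i]:\sigma_i(s)(v)=\sigma_i(t)(v)\}|\to0$ for all distinct $s,t\in G$, and $d_i\to\infty$. A countable group is amenable if it admits a Følner sequence: nonempty finite $F_n\subset G$ with $|F_n\setminus gF_n|/|F_n|\to0$ for every $g\in G$ (amenable groups are sofic). A $G$-system $(X,G)$ is a compact metric space $X$ with a continuous action of $G$ by homeomorphisms. A factor map $\pi:(X,G)\to(Y,G)$ is a continuous surjection with $\pi(gx)=g\pi(x)$. For a finite open cover $\beta$ of a space $K$, $\mathrm{ord}(\beta)=\max_{x\in K}\sum_{U\in\beta}1_U(x)-1$,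 and $D(\beta)$ is the minimum of $\mathrm{ord}(\gamma)$ over finite open covers $\gamma$ of $K$ refining $\beta$; both are $-\infty$ if $K=\emptyset$. A family of sets refines a cover $\alpha$ if each of its members is contained in a member of $\alpha$; the join $\vee$ of two families consists of pairwise intersections. $\mathcal F(G)$ is the collection of nonempty finite subsets of $G$. Conditional mean topological dimension. For a finite open cover $\alpha$ of $X$, $D(\alpha|\pi)$ is the minimum of $\mathrm{ord}(\beta)$ over finite open covers $\beta$ of $X$ such that $\{\pi^{-1}(y)\}_{y\in Y}\vee\beta$ refines $\alpha$; for $F\in\mathcal F(G)$, $\alpha^F=\bigvee_{s\in F}s^{-1}\alpha$. Then $$\mathrm{mdim}(X|\pi)=\sup_\alpha\lim_F\frac{D(\alpha^F|\pi)}{|F|},$$ the supremum over finite open covers of $X$, where the limit is taken as $F$ becomes more and more invariant (equivalently along any Følner sequence; it exists and is independent of the sequence). It is also denoted $\mathrm{mdim}(X|Y)$. Relative sofic mean dimension. For a compatible metric $\rho$ on $X$, $F\in\mathcal F(G)$, $\delta>0$ and $\sigma:G\to\mathrm{Sym}(d)$, $\mathrm{Map}(\rho,F,\delta,\sigma)\subset X^d$ is the set of maps $\xi:[d]\to X$ with $\big(\frac1d\sum_{a\in[d]}\rho(\xi(\sigma(s)(a)),s\,\xi(a))^2\big)^{1/2}\le\delta$ for all $s\in F$. Let $\pi^d:X^d\to Y^d$, $\xi\mapsto\pi\circ\xi$. For a finite open cover $\alpha$ of $Y$, $\alpha^d$ is the cover of $Y^d$ by the sets $U_1\times\cdots\times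 U_d$, $U_j\in\alpha$. Let $$\mathrm{mdim}_\Sigma(Y|X)=\sup_\alpha\inf_{F\in\mathcal F(G)}\inf_{\delta>0}\limsup_{i\to\infty}\frac{D\big(\alpha^{d_i}|_{\pi^{d_i}(\mathrm{Map}(\rho,F,\delta,\sigma_i))}\big)}{d_i},$$ the supremum over finite open covers $\alpha$ of $Y$; the limsup is $-\infty$ if $\mathrm{Map}(\rho,F,\delta,\sigma_i)=\emptyset$ for all large $i$. The value does not depend on the compatible metric $\rho$. $\mathrm{mdim}_\Sigma(Y^n|X^n)$ is the same quantity for $\pi^n$. *)

theory Defs
  imports "HOL-Analysis.Analysis" "HOL-Algebra.Group_Action"
begin

section \<open>Amenable groups and sofic approximations\<close>

definition fin_subsets :: "('g, 'm) monoid_scheme \<Rightarrow> 'g set set" where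
  "fin_subsets G = {F. finite F \<and> F \<noteq> {} \<and> F \<subseteq> carrier G}"

definition boundary_ratio :: "('g, 'm) monoid_scheme \<Rightarrow> 'g \<Rightarrow> 'g set \<Rightarrow> real" where
  "boundary_ratio G g F = real (card (F - (g <#\<^bsub>G\<^esub> F))) / real (card F)"

definition folner_sequence :: "('g, 'm) monoid_scheme \<Rightarrow> (nat \<Rightarrow> 'g set) \<Rightarrow> bool" where
  "folner_sequence G Fs \<longleftrightarrow> (\<forall>k. Fs k \<in> fin_subsets G) \<and>
     (\<forall>g\<in>carrier G. (\<lambda>k. boundary_ratio G g (Fs k)) \<longlonglongrightarrow> 0)"

definition amenable :: "('g, 'm) monoid_scheme \<Rightarrow> bool" where
  "amenable G \<longleftrightarrow> (\<exists>Fs. folner_sequence G Fs)"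

text \<open>The filter of ``\<open>F\<close> becomes more and more invariant'': the coarsest filter on the nonempty
  finite subsets of \<open>G\<close> along which all the ratios tend to \<open>0\<close>. A sequence of such subsets tends to
  this filter iff it is a Folner sequence.\<close>

definition invariance_filter :: "('g, 'm) monoid_scheme \<Rightarrow> 'g set filter" where
  "invariance_filter G =
     (INF g\<in>carrier G. inf (principal (fin_subsets G)) (filtercomap (boundary_ratio G g) (nhds 0)))"

definition sofic_approximation ::
    "('g, 'm) monoid_scheme \<Rightarrow> (nat \<Rightarrow> nat) \<Rightarrow> (nat \<Rightarrow> 'g \<Rightarrow> nat \<Rightarrow> nat) \<Rightarrow> bool" where
  "sofic_approximation G d \<sigma> \<longleftrightarrow>
     (\<forall>i. \<forall>s\<in>carrier G. \<sigma> i s permutes {1..d i}) \<and>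
     (\<forall>s\<in>carrier G. \<forall>t\<in>carrier G.
        (\<lambda>i. real (card {v\<in>{1..d i}. \<sigma> i s (\<sigma> i t v) = \<sigma> i (s \<otimes>\<^bsub>G\<^esub> t) v}) / real (d i))
          \<longlonglongrightarrow> 1) \<and>
     (\<forall>s\<in>carrier G. \<forall>t\<in>carrier G. s \<noteq> t \<longrightarrow>
        (\<lambda>i. real (card {v\<in>{1..d i}. \<sigma> i s v = \<sigma> i t v}) / real (d i)) \<longlonglongrightarrow> 0) \<and>
     filterlim d at_top sequentially"


section \<open>Systems, factor maps and powers\<close>

text \<open>A system is carried by a compact metrizable topology; a metric is only named where it is
  used, through \<open>compatible_metric\<close>.\<close>

definition G_system ::
    "('g, 'm) monoid_scheme \<Rightarrow> 'a topology \<Rightarrow> ('g \<Rightarrow> 'a \<Rightarrow> 'a) \<Rightarrow> bool" where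
  "G_system G X \<phi> \<longleftrightarrow> compact_space X \<and> metrizable_space X \<and>
     group_action G (topspace X) \<phi> \<and> (\<forall>g\<in>carrier G. homeomorphic_map X X (\<phi> g))"

definition compatible_metric :: "'a topology \<Rightarrow> ('a \<Rightarrow> 'a \<Rightarrow> real) \<Rightarrow> bool" where
  "compatible_metric X \<rho> \<longleftrightarrow>
     Metric_space (topspace X) \<rho> \<and> Metric_space.mtopology (topspace X) \<rho> = X"

definition factor_map ::
    "('g, 'm) monoid_scheme \<Rightarrow> 'a topology \<Rightarrow> ('g \<Rightarrow> 'a \<Rightarrow> 'a) \<Rightarrow>
     'b topology \<Rightarrow> ('g \<Rightarrow> 'b \<Rightarrow> 'b) \<Rightarrow> ('a \<Rightarrow> 'b) \<Rightarrow> bool" where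
  "factor_map G X \<phi> Y \<psi> \<pi> \<longleftrightarrow> continuous_map X Y \<pi> \<and> \<pi> ` topspace X = topspace Y \<and>
     (\<forall>g\<in>carrier G. \<forall>x\<in>topspace X. \<pi> (\<phi> g x) = \<psi> g (\<pi> x))"

text \<open>Points of the \<open>n\<close>-th power are functions on \<open>{1..n}\<close> (extended by \<open>undefined\<close>), and the power of
  a map \<open>f\<close> is \<open>compose {1..n} f\<close>. The same encoding serves for \<open>X\<^sup>n\<close> and for \<open>X\<^sup>d\<close>.\<close>

definition power_space :: "nat \<Rightarrow> 'a topology \<Rightarrow> (nat \<Rightarrow> 'a) topology" where
  "power_space n X = product_topology (\<lambda>_. X) {1..n}"

text \<open>The restriction is required by \<open>group_action\<close>, whose bijections are extensional.\<close>

definition diagonal_action ::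
    "nat \<Rightarrow> 'a topology \<Rightarrow> ('g \<Rightarrow> 'a \<Rightarrow> 'a) \<Rightarrow> 'g \<Rightarrow> (nat \<Rightarrow> 'a) \<Rightarrow> (nat \<Rightarrow> 'a)" where
  "diagonal_action n X \<phi> g = restrict (compose {1..n} (\<phi> g)) (topspace (power_space n X))"


section \<open>Covers\<close>

definition finite_open_cover :: "'a topology \<Rightarrow> 'a set set \<Rightarrow> bool" where
  "finite_open_cover K \<beta> \<longleftrightarrow> finite \<beta> \<and> (\<forall>U\<in>\<beta>. openin K U) \<and> \<Union>\<beta> = topspace K"

definition refines_cover :: "'a set set \<Rightarrow> 'a set set \<Rightarrow> bool" where
  "refines_cover \<gamma> \<alpha> \<longleftrightarrow> (\<forall>V\<in>\<gamma>. \<exists>U\<in>\<alpha>. V \<subseteq> U)"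

definition cover_join :: "'a set set \<Rightarrow> 'a set set \<Rightarrow> 'a set set" where
  "cover_join \<A> \<B> = {U \<inter> V | U V. U \<in> \<A> \<and> V \<in> \<B>}"

definition cover_ord :: "'a topology \<Rightarrow> 'a set set \<Rightarrow> ereal" where
  "cover_ord K \<beta> = (if topspace K = {} then -\<infinity>
     else ereal (real (MAX x\<in>topspace K. card {U\<in>\<beta>. x \<in> U}) - 1))"

text \<open>The infima defining \<open>cover_dim\<close> and \<open>cond_dim\<close> range over nonempty subsets of
  \<open>{-\<infinity>, 0, 1, 2, \<dots>}\<close> and are therefore minima.\<close>

definition cover_dim :: "'a topology \<Rightarrow> 'a set set \<Rightarrow> ereal" where
  "cover_dim K \<beta> = (INF \<gamma>\<in>{\<gamma>. finite_open_cover K \<gamma> \<and> refines_cover \<gamma> \<beta>}. cover_ord K \<gamma>)"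


section \<open>Conditional mean topological dimension\<close>

definition fibers :: "'a topology \<Rightarrow> 'b topology \<Rightarrow> ('a \<Rightarrow> 'b) \<Rightarrow> 'a set set" where
  "fibers X Y \<pi> = (\<lambda>y. {x\<in>topspace X. \<pi> x = y}) ` topspace Y"

definition cond_dim ::
    "'a topology \<Rightarrow> 'b topology \<Rightarrow> ('a \<Rightarrow> 'b) \<Rightarrow> 'a set set \<Rightarrow> ereal" where
  "cond_dim X Y \<pi> \<alpha> =
     (INF \<beta>\<in>{\<beta>. finite_open_cover X \<beta> \<and> refines_cover (cover_join (fibers X Y \<pi>) \<beta>) \<alpha>}. cover_ord X \<beta>)"

text \<open>The join of \<open>s\<^sup>-\<^sup>1\<alpha>\<close> over \<open>s \<in> F\<close>: a member is given by a choice of \<open>U s \<in> \<alpha>\<close> for each \<open>s\<close>.\<close>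

definition dyn_join ::
    "'a topology \<Rightarrow> ('g \<Rightarrow> 'a \<Rightarrow> 'a) \<Rightarrow> 'g set \<Rightarrow> 'a set set \<Rightarrow> 'a set set" where
  "dyn_join X \<phi> F \<alpha> = {(\<Inter>s\<in>F. {x\<in>topspace X. \<phi> s x \<in> U s}) | U. U \<in> F \<rightarrow> \<alpha>}"

definition cond_mdim ::
    "('g, 'm) monoid_scheme \<Rightarrow> 'a topology \<Rightarrow> ('g \<Rightarrow> 'a \<Rightarrow> 'a) \<Rightarrow> 'b topology \<Rightarrow> ('a \<Rightarrow> 'b) \<Rightarrow> ereal"
  where
  "cond_mdim G X \<phi> Y \<pi> = (SUP \<alpha>\<in>{\<alpha>. finite_open_cover X \<alpha>}.
     Lim (invariance_filter G)
       (\<lambda>F. cond_dim X Y \<pi> (dyn_join X \<phi> F \<alpha>) / ereal (real (card F))))"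


section \<open>Relative sofic mean dimension\<close>

definition sofic_Map ::
    "'a topology \<Rightarrow> ('g \<Rightarrow> 'a \<Rightarrow> 'a) \<Rightarrow> ('a \<Rightarrow> 'a \<Rightarrow> real) \<Rightarrow> 'g set \<Rightarrow> real \<Rightarrow> nat \<Rightarrow>
     ('g \<Rightarrow> nat \<Rightarrow> nat) \<Rightarrow> (nat \<Rightarrow> 'a) set" where
  "sofic_Map X \<phi> \<rho> F \<delta> d \<sigma> = {\<xi>\<in>topspace (power_space d X). \<forall>s\<in>F.
     sqrt ((\<Sum>a\<in>{1..d}. (\<rho> (\<xi> (\<sigma> s a)) (\<phi> s (\<xi> a)))\<^sup>2) / real d) \<le> \<delta>}"

definition power_cover :: "nat \<Rightarrow> 'b set set \<Rightarrow> (nat \<Rightarrow> 'b) set set" where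
  "power_cover d \<alpha> = {PiE {1..d} U | U. U \<in> {1..d} \<rightarrow> \<alpha>}"

text \<open>\<open>cover_dim\<close> of a cover of \<open>K\<close> restricted to a subset \<open>S\<close> with its subspace topology.\<close>

definition cover_dim_on :: "'a topology \<Rightarrow> 'a set \<Rightarrow> 'a set set \<Rightarrow> ereal" where
  "cover_dim_on K S \<beta> = cover_dim (subtopology K S) ((\<lambda>U. U \<inter> S) ` \<beta>)"

definition sofic_mdim ::
    "('g, 'm) monoid_scheme \<Rightarrow> (nat \<Rightarrow> nat) \<Rightarrow> (nat \<Rightarrow> 'g \<Rightarrow> nat \<Rightarrow> nat) \<Rightarrow>
     'a topology \<Rightarrow> ('g \<Rightarrow> 'a \<Rightarrow> 'a) \<Rightarrow> ('a \<Rightarrow> 'a \<Rightarrow> real) \<Rightarrow> 'b topology \<Rightarrow> ('a \<Rightarrow> 'b) \<Rightarrow> ereal" where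
  "sofic_mdim G d \<sigma> X \<phi> \<rho> Y \<pi> = (SUP \<alpha>\<in>{\<alpha>. finite_open_cover Y \<alpha>}.
     INF F\<in>fin_subsets G. INF \<delta>\<in>{0<..}.
       limsup (\<lambda>i. cover_dim_on (power_space (d i) Y)
                     (compose {1..d i} \<pi> ` sofic_Map X \<phi> \<rho> F \<delta> (d i) (\<sigma> i))
                     (power_cover (d i) \<alpha>) / ereal (real (d i))))"

end

theory Submission
  imports Defs
begin

text \<open>
  Write \<open>h F\<close> for the conditional dimension of \<open>\<alpha>\<^sup>F\<close>, so that the mean dimension is the
  supremum over \<open>\<alpha>\<close> of \<open>lim h F / |F|\<close>. Given pairwise disjoint translates \<open>F g\<^sub>1, \<dots>, F g\<^sub>n\<close> (which
  exist as \<open>G\<close> is infinite), the map \<open>x \<mapsto> (g\<^sub>1 x, \<dots>, g\<^sub>n x)\<close> pulls the \<open>F\<close>-join of the power cover on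
  \<open>X\<^sup>n\<close> back to \<open>\<alpha>\<^sup>E\<close>, where the union \<open>E\<close> of the translates has \<open>n |F|\<close> elements and is as left
  invariant as \<open>F\<close>. Hence the mean dimension of \<open>X\<^sup>n\<close> is at least \<open>n\<close> times that of \<open>X\<close>; no theorem on
  the dimension of products is needed. The converse inequality is the subadditivity of dimension under joins.

  For the sofic quantity, quasi-tilings of the sofic models by nearly invariant finite sets show that it
  equals the mean dimension of \<open>Y\<close>. From below, a point \<open>y\<close> is sent to the microstate
  \<open>\<sigma>(f) c \<mapsto> f g\<^sub>c y\<close>, where \<open>c\<close> runs through the centres of the tiles and the translates of the tiles
  by the \<open>g\<^sub>c\<close> are disjoint; these microstates lift to \<open>X\<close> because orbits do. From above, a microstate is
  determined by its values at the centres up to few coordinates.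
\<close>

section \<open>A common refinement with additive multiplicity\<close>

text \<open>The dimension of a product may fall short of the sum of the dimensions, so equality
  cannot be expected for a fixed \<open>F\<close>; it appears in the limit. What the limit offers is
  asymmetric: its lower bound holds for every sufficiently invariant set, in particular for a union
  of disjoint translates, while its upper bound is only asked of some arbitrarily invariant sets.
  Translating from the right leaves the left boundaries \<open>F - tF\<close> alone, which is why
  such unions stay invariant.

  The definition takes a \<open>Lim\<close> along a filter, which says something only once the limit
  exists; hence the Ornstein-Weiss lemma. It shares one quasi-tiling theorem with the sofic
  comparison. That theorem is stated for arbitrary maps \<open>\<sigma>\<close> on a finite set:
  left multiplication on an invariant set in one case, a sofic map in the other.

  The sofic half finally reduces to the first half: the mean dimension of \<open>Y\<close> is the
  conditional one over a point, so the power formula for systems over a base can be applied to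
  \<open>Y\<close> itself.\<close>

lemma open_support_function:
  assumes "metrizable_space K" and "openin K U"
  obtains f where "continuous_map K euclideanreal f"
    and "\<And>x. x \<in> topspace K \<Longrightarrow> 0 \<le> f x \<and> (0 < f x \<longleftrightarrow> x \<in> U)"
proof -
  obtain M d where Md: "Metric_space M d" and K: "K = Metric_space.mtopology M d"
    using assms(1) by (auto simp: metrizable_space_def)
  interpret Metric_space M d by fact
  have top: "topspace K = M" by (simp add: K)
  have UM: "U \<subseteq> M" using assms(2) openin_subset top by metis
  \<comment> \<open>The distance to the complement of \<open>U\<close>, which is 1-Lipschitz by
    \<open>lip\<close>. For \<open>U = M\<close> there is no complement to measure, and the constant
    1 is used.\<close>
  define f where "f x = (if U = M then 1 else INF y\<in>M - U. d x y)" for x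
  have bdd: "bdd_below (d x ` A)" for x A
    by (rule bdd_belowI[of _ 0]) auto
  have lip: "f x \<le> f z + d x z" if "x \<in> M" "z \<in> M" for x z
  proof (cases "U = M")
    case False
    then have ne: "M - U \<noteq> {}" using UM by auto
    have "f x - d x z \<le> (INF y\<in>M - U. d z y)"
    proof (rule cINF_greatest[OF ne])
      fix y assume y: "y \<in> M - U"
      have "f x \<le> d x y" using False y bdd by (auto simp: f_def intro!: cINF_lower)
      also have "\<dots> \<le> d x z + d z y" using that y by (intro triangle) auto
      finally show "f x - d x z \<le> d z y" by simp
    qed
    then show ?thesis using False by (simp add: f_def)
  qed (simp add: f_def)
  have op: "openin K {x \<in> topspace K. f x > a}" for a
    unfolding K openin_mtopology
  proof (intro conjI allI impI)
    fix x assume x: "x \<in> {x \<in> topspace mtopology. a < f x}"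
    have "mball x (f x - a) \<subseteq> {x \<in> topspace mtopology. a < f x}"
      using lip[of x] x by (force simp: in_mball)
    with x show "\<exists>r>0. mball x r \<subseteq> {x \<in> topspace mtopology. a < f x}"
      by (intro exI[of _ "f x - a"]) auto
  qed auto
  have op': "openin K {x \<in> topspace K. f x < a}" for a
    unfolding K openin_mtopology
  proof (intro conjI allI impI)
    fix x assume x: "x \<in> {x \<in> topspace mtopology. f x < a}"
    have "mball x (a - f x) \<subseteq> {x \<in> topspace mtopology. f x < a}"
      using lip[of _ x] x by (force simp: in_mball commute)
    with x show "\<exists>r>0. mball x r \<subseteq> {x \<in> topspace mtopology. f x < a}"
      by (intro exI[of _ "a - f x"]) auto
  qed auto
  have "0 \<le> f x \<and> (0 < f x \<longleftrightarrow> x \<in> U)" if x: "x \<in> M" for x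
  proof (cases "U = M")
    case False
    then have ne: "M - U \<noteq> {}" using UM by auto
    have ge: "0 \<le> f x" using False ne by (auto simp: f_def intro!: cINF_greatest)
    show ?thesis
    proof (cases "x \<in> U")
      case True
      then obtain r where r: "r > 0" "mball x r \<subseteq> U"
        using assms(2) unfolding K openin_mtopology by blast
      have "r \<le> (INF y\<in>M - U. d x y)"
        by (rule cINF_greatest[OF ne]) (use r x in \<open>force simp: in_mball subset_iff not_less\<close>)
      then have "r \<le> f x" using False by (simp add: f_def)
      with r True show ?thesis by auto
    next
      case False': False
      have "(INF y\<in>M - U. d x y) \<le> d x x" using False' x bdd by (intro cINF_lower) auto
      then have "f x \<le> 0" using False x by (simp add: f_def)
      with ge False' show ?thesis by simp
    qed
  qed (use x in \<open>simp add: f_def\<close>)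
  moreover have "continuous_map K euclideanreal f"
    unfolding continuous_map_upper_lower_semicontinuous_lt using op op' by auto
  ultimately show ?thesis using that top by auto
qed

text \<open>Members of a chain of finite sets have distinct cardinalities, and here these lie in
  \<open>{a..card P}\<close>.\<close>

lemma card_chain_between:
  assumes "finite P" and "\<And>S. S \<in> \<C> \<Longrightarrow> S \<subseteq> P \<and> a \<le> card S"
    and "\<And>S T. S \<in> \<C> \<Longrightarrow> T \<in> \<C> \<Longrightarrow> S \<subseteq> T \<or> T \<subseteq> S" and "a \<le> card P"
  shows "card \<C> + a \<le> 1 + card P"
proof -
  have fin: "finite S" if "S \<in> \<C>" for S using assms(1,2) that finite_subset by blast
  have "inj_on card \<C>"
    by (rule inj_onI) (metis assms(3) card_subset_eq fin)
  then have "card \<C> = card (card ` \<C>)" by (simp add: card_image)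
  also have "\<dots> \<le> card {a..card P}"
    using assms(1,2) by (intro card_mono) (auto simp: card_mono)
  finally show ?thesis using assms(4) by simp
qed

text \<open>With a function \<open>f\<^sub>U\<close> supported on each member \<open>U\<close>, the sets \<open>V S\<close>, where all \<open>f\<^sub>U\<close> with \<open>U \<in> S\<close>
  exceed \<open>0\<close> and all the other \<open>f\<^sub>U\<close>, that contain a given point form a chain in \<open>S\<close>. Hence the
  multiplicities minus one add up, where intersecting the covers would multiply the multiplicities.\<close>

lemma cover_common_refinement:
  assumes "metrizable_space K" and "finite J" and \<gamma>: "\<And>j. j \<in> J \<Longrightarrow> finite_open_cover K (\<gamma> j)"
  obtains \<delta> where "finite_open_cover K \<delta>"
    and "\<And>W. W \<in> \<delta> \<Longrightarrow> \<exists>U\<in>Pi J \<gamma>. \<forall>j\<in>J. W \<subseteq> U j"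
    and "\<And>x. x \<in> topspace K \<Longrightarrow>
           card {W\<in>\<delta>. x \<in> W} + card J \<le> 1 + (\<Sum>j\<in>J. card {U\<in>\<gamma> j. x \<in> U})"
proof -
  \<comment> \<open>The pairs keep equal sets from different covers apart, so that the
    multiplicities add up over \<open>J\<close>.\<close>
  define I where "I = Sigma J \<gamma>"
  have finI: "finite I" using assms by (auto simp: I_def finite_open_cover_def)
  have "\<exists>f. continuous_map K euclideanreal f \<and>
      (\<forall>x\<in>topspace K. 0 \<le> f x \<and> (0 < f x \<longleftrightarrow> x \<in> snd p))" if "p \<in> I" for p
  proof -
    have "openin K (snd p)" using \<gamma> that by (auto simp: I_def finite_open_cover_def)
    then show ?thesis by (metis open_support_function[OF assms(1)])
  qed
  then obtain f where f: "\<And>p. p \<in> I \<Longrightarrow> continuous_map K euclideanreal (f p)"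
    "\<And>p x. p \<in> I \<Longrightarrow> x \<in> topspace K \<Longrightarrow> 0 \<le> f p x \<and> (0 < f p x \<longleftrightarrow> x \<in> snd p)"
    by metis
  \<comment> \<open>Asking that \<open>S\<close> have a member from every cover does two things:
    \<open>V S\<close> lies in a member of each of them, and \<open>card S\<close> is at least
    \<open>card J\<close>, the lower end in \<open>card_chain_between\<close>.\<close>
  define Adm where "Adm = {S. S \<subseteq> I \<and> J \<subseteq> fst ` S}"
  define V where "V S = {x \<in> topspace K. (\<forall>p\<in>S. 0 < f p x) \<and> (\<forall>p\<in>S. \<forall>q\<in>I - S. f q x < f p x)}" for S
  define P where "P x = {p\<in>I. x \<in> snd p}" for x
  have finAdm: "finite Adm" unfolding Adm_def using finI by simp
  have opV: "openin K (V S)" if "S \<in> Adm" for S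
  proof -
    have S: "S \<subseteq> I" "finite S" using that finI finite_subset by (auto simp: Adm_def)
    have pos: "openin K {x \<in> topspace K. g x \<in> {0<..}}" if "continuous_map K euclideanreal g" for g
      by (rule openin_continuous_map_preimage[OF that]) auto
    have "V S = topspace K \<inter> (\<Inter>p\<in>S. {x \<in> topspace K. f p x \<in> {0<..}}) \<inter>
       (\<Inter>(p,q)\<in>S \<times> (I - S). {x \<in> topspace K. f p x - f q x \<in> {0<..}})"
      by (auto simp: V_def)
    moreover have "openin K (topspace K \<inter> (\<Inter>p\<in>S. {x \<in> topspace K. f p x \<in> {0<..}}) \<inter>
       (\<Inter>(p,q)\<in>S \<times> (I - S). {x \<in> topspace K. f p x - f q x \<in> {0<..}}))"
    proof (cases "S = {}")
      case False
      show ?thesis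
      proof (cases "S \<times> (I - S) = {}")
        case True
        show ?thesis unfolding True using S f False
          by (auto intro!: openin_Int openin_Inter pos simp del: greaterThan_iff)
      next
        case F2: False
        show ?thesis using S f False F2 finI
          by (auto intro!: openin_Int openin_Inter pos continuous_map_diff simp del: greaterThan_iff Times_empty)
      qed
    qed simp
    ultimately show ?thesis by simp
  qed
  \<comment> \<open>\<open>P x\<close> collects every tagged member containing \<open>x\<close>. It
    is admissible because each cover has one, and it is the top of the chain at \<open>x\<close>,
    since positivity puts every admissible \<open>S\<close> with \<open>x \<in> V S\<close> inside
    it.\<close>
  have PAdm: "P x \<in> Adm" and VP: "x \<in> V (P x)" if x: "x \<in> topspace K" for x
  proof -
    have "j \<in> fst ` P x" if j: "j \<in> J" for j
    proof -
      obtain U where "U \<in> \<gamma> j" "x \<in> U" using \<gamma>[OF j] x by (auto simp: finite_open_cover_def)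
      then have "(j,U) \<in> P x" using j by (auto simp: P_def I_def)
      then show ?thesis by force
    qed
    then show "P x \<in> Adm" by (auto simp: Adm_def P_def)
    have "f q x < f p x" if "p \<in> P x" "q \<in> I - P x" for p q
      using that f(2)[of p x] f(2)[of q x] x by (fastforce simp: P_def)
    then show "x \<in> V (P x)"
      using x f(2)[OF _ x] by (auto simp: V_def P_def)
  qed
  define \<delta> where "\<delta> = V ` Adm"
  show ?thesis
  proof
    show "finite_open_cover K \<delta>"
      unfolding finite_open_cover_def
    proof (intro conjI ballI)
      show "\<Union>\<delta> = topspace K"
      proof
        show "\<Union>\<delta> \<subseteq> topspace K" by (auto simp: \<delta>_def V_def)
        show "topspace K \<subseteq> \<Union>\<delta>" using PAdm VP by (force simp: \<delta>_def)
      qed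
    qed (use finAdm opV in \<open>auto simp: \<delta>_def\<close>)
  next
    fix W assume "W \<in> \<delta>"
    then obtain S where S: "S \<in> Adm" "W = V S" by (auto simp: \<delta>_def)
    have "\<exists>U. (j,U) \<in> S" if "j \<in> J" for j using S that by (force simp: Adm_def)
    then obtain U where U: "\<And>j. j \<in> J \<Longrightarrow> (j, U j) \<in> S" by metis
    have "V S \<subseteq> U j" if "j \<in> J" for j
    proof
      fix x assume "x \<in> V S"
      then have "0 < f (j, U j) x" "x \<in> topspace K" using U[OF that] by (auto simp: V_def)
      moreover have "(j, U j) \<in> I" using U[OF that] S by (auto simp: Adm_def)
      ultimately show "x \<in> U j" using f(2) by fastforce
    qed
    moreover have "U \<in> Pi J \<gamma>" using U S by (auto simp: Adm_def I_def)
    ultimately show "\<exists>U\<in>Pi J \<gamma>. \<forall>j\<in>J. W \<subseteq> U j" using S by blast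
  next
    fix x assume x: "x \<in> topspace K"
    let ?C = "{S\<in>Adm. x \<in> V S}"
    have finP: "finite (P x)" using finI by (simp add: P_def)
    have cardS: "card J \<le> card S" if "S \<in> Adm" for S
    proof -
      have "finite S" using that finI finite_subset by (auto simp: Adm_def)
      then show ?thesis using that unfolding Adm_def
        by (metis (mono_tags, lifting) card_image_le card_mono finite_imageI le_trans mem_Collect_eq)
    qed
    have "card {W\<in>\<delta>. x \<in> W} \<le> card ?C"
    proof -
      have "{W\<in>\<delta>. x \<in> W} \<subseteq> V ` ?C" by (auto simp: \<delta>_def)
      then show ?thesis using finAdm by (intro surj_card_le) auto
    qed
    moreover have "card ?C + card J \<le> 1 + card (P x)"
    proof (rule card_chain_between[OF finP])
      show "S \<subseteq> P x \<and> card J \<le> card S" if "S \<in> ?C" for S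
        using that cardS x f(2) by (force simp: Adm_def V_def P_def)
      show "S \<subseteq> T \<or> T \<subseteq> S" if "S \<in> ?C" "T \<in> ?C" for S T
      proof (rule ccontr)
        assume "\<not> ?thesis"
        then obtain p q where "p \<in> S" "p \<notin> T" "q \<in> T" "q \<notin> S" by auto
        then have "f q x < f p x" "f p x < f q x" using that by (auto simp: V_def Adm_def)
        then show False by simp
      qed
      show "card J \<le> card (P x)" by (rule cardS[OF PAdm[OF x]])
    qed
    moreover have "card (P x) = (\<Sum>j\<in>J. card {U\<in>\<gamma> j. x \<in> U})"
    proof -
      have "P x = Sigma J (\<lambda>j. {U\<in>\<gamma> j. x \<in> U})" by (auto simp: P_def I_def)
      then show ?thesis using assms(2) \<gamma> by (simp add: card_SigmaI finite_open_cover_def)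
    qed
    ultimately show "card {W\<in>\<delta>. x \<in> W} + card J \<le> 1 + (\<Sum>j\<in>J. card {U\<in>\<gamma> j. x \<in> U})"
      by simp
  qed
qed

section \<open>Conditional dimension of covers\<close>

lemma cover_ord_le:
  assumes "finite_open_cover K \<beta>" and "topspace K \<noteq> {}"
    and "\<And>x. x \<in> topspace K \<Longrightarrow> card {U\<in>\<beta>. x \<in> U} \<le> k + 1"
  shows "cover_ord K \<beta> \<le> ereal (real k)"
proof -
  have "finite ((\<lambda>x. card {U\<in>\<beta>. x \<in> U}) ` topspace K)"
    using assms(3) by (intro finite_subset[OF _ finite_atMost[of "k + 1"]]) auto
  then have "(MAX x\<in>topspace K. card {U\<in>\<beta>. x \<in> U}) \<le> k + 1"
    using assms(2,3) by (subst Max_le_iff) auto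
  then show ?thesis using assms(2) by (simp add: cover_ord_def)
qed

lemma cover_ord_nat:
  assumes "finite_open_cover K \<beta>" and "topspace K \<noteq> {}"
  obtains k where "cover_ord K \<beta> = ereal (real k)"
    and "\<And>x. x \<in> topspace K \<Longrightarrow> card {U\<in>\<beta>. x \<in> U} \<le> k + 1"
proof -
  let ?c = "\<lambda>x. card {U\<in>\<beta>. x \<in> U}"
  have fb: "finite \<beta>" using assms by (simp add: finite_open_cover_def)
  have fin: "finite (?c ` topspace K)"
  proof (rule finite_subset[OF _ finite_atMost[of "card \<beta>"]], rule image_subsetI)
    show "card {U\<in>\<beta>. x \<in> U} \<in> {..card \<beta>}" for x using card_mono[OF fb, of "{U\<in>\<beta>. x \<in> U}"] by auto
  qed
  have le: "?c x \<le> Max (?c ` topspace K)" if "x \<in> topspace K" for x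
    using fin that by (intro Max_ge) auto
  obtain x U where x: "x \<in> topspace K" "U \<in> \<beta>" "x \<in> U"
    using assms(1,2) unfolding finite_open_cover_def by blast
  then have "0 < ?c x" using fb by (auto simp: card_gt_0_iff)
  then have pos: "1 \<le> Max (?c ` topspace K)" using le[OF x(1)] by linarith
  show ?thesis
    by (rule that[of "Max (?c ` topspace K) - 1"]) (use assms le pos in \<open>auto simp: cover_ord_def\<close>)
qed

text \<open>On a nonempty space orders are natural numbers, so well-ordering turns the infimum into
  a minimum. The counting arguments below need an actual cover realizing it.\<close>

lemma INF_cover_ord_attained:
  assumes "topspace K \<noteq> {}" and "B \<noteq> {}" and B: "\<And>\<beta>. \<beta> \<in> B \<Longrightarrow> finite_open_cover K \<beta>"
  obtains \<beta> k where "\<beta> \<in> B" and "(INF \<beta>\<in>B. cover_ord K \<beta>) = ereal (real k)"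
    and "\<And>x. x \<in> topspace K \<Longrightarrow> card {U\<in>\<beta>. x \<in> U} \<le> k + 1"
proof -
  define Q where "Q k \<longleftrightarrow> (\<exists>\<beta>\<in>B. cover_ord K \<beta> = ereal (real k))" for k
  define k where "k = (LEAST k. Q k)"
  have ex: "\<exists>k. cover_ord K \<beta> = ereal (real k)" if "\<beta> \<in> B" for \<beta>
    by (rule cover_ord_nat[OF B[OF that] assms(1)]) blast
  have "\<exists>k. Q k" using assms(2) ex by (auto simp: Q_def)
  then have "Q k" unfolding k_def by (rule LeastI_ex)
  then obtain \<beta> where \<beta>: "\<beta> \<in> B" "cover_ord K \<beta> = ereal (real k)" by (auto simp: Q_def)
  have "(INF \<beta>\<in>B. cover_ord K \<beta>) = ereal (real k)"
  proof (rule antisym)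
    show "(INF \<beta>\<in>B. cover_ord K \<beta>) \<le> ereal (real k)" using \<beta> by (metis INF_lower)
    show "ereal (real k) \<le> (INF \<beta>\<in>B. cover_ord K \<beta>)"
    proof (rule INF_greatest)
      fix \<gamma> assume g: "\<gamma> \<in> B"
      then obtain m where m: "cover_ord K \<gamma> = ereal (real m)" using ex by blast
      then have "k \<le> m" unfolding k_def using g by (intro Least_le) (auto simp: Q_def)
      then show "ereal (real k) \<le> cover_ord K \<gamma>" using m by simp
    qed
  qed
  moreover have "card {U\<in>\<beta>. x \<in> U} \<le> k + 1" if x: "x \<in> topspace K" for x
  proof -
    obtain m where m: "cover_ord K \<beta> = ereal (real m)" "card {U\<in>\<beta>. x \<in> U} \<le> m + 1"
      by (rule cover_ord_nat[OF B[OF \<beta>(1)] assms(1)]) (use x in blast)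
    with \<beta>(2) show ?thesis by simp
  qed
  ultimately show ?thesis using that \<beta> by blast
qed

lemma refines_cover_fibers_iff:
  "refines_cover (cover_join (fibers X Y \<pi>) \<beta>) \<alpha> \<longleftrightarrow>
     (\<forall>V\<in>\<beta>. \<forall>y\<in>topspace Y. \<exists>U\<in>\<alpha>. {x\<in>topspace X. \<pi> x = y} \<inter> V \<subseteq> U)"
  unfolding refines_cover_def cover_join_def fibers_def by blast

lemma cond_dim_le:
  assumes "finite_open_cover X \<beta>" and "topspace X \<noteq> {}"
    and "\<And>V y. V \<in> \<beta> \<Longrightarrow> y \<in> topspace Y \<Longrightarrow> \<exists>U\<in>\<alpha>. {x\<in>topspace X. \<pi> x = y} \<inter> V \<subseteq> U"
    and "\<And>x. x \<in> topspace X \<Longrightarrow> card {U\<in>\<beta>. x \<in> U} \<le> k + 1"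
  shows "cond_dim X Y \<pi> \<alpha> \<le> ereal (real k)"
proof -
  have "cond_dim X Y \<pi> \<alpha> \<le> cover_ord X \<beta>"
    unfolding cond_dim_def using assms(1,3) by (intro INF_lower) (auto simp: refines_cover_fibers_iff)
  also have "\<dots> \<le> ereal (real k)" by (rule cover_ord_le) (use assms in auto)
  finally show ?thesis .
qed

lemma cond_dim_attained:
  assumes "finite_open_cover X \<alpha>" and "topspace X \<noteq> {}"
  obtains \<beta> k where "finite_open_cover X \<beta>" and "cond_dim X Y \<pi> \<alpha> = ereal (real k)"
    and "\<And>V y. V \<in> \<beta> \<Longrightarrow> y \<in> topspace Y \<Longrightarrow> \<exists>U\<in>\<alpha>. {x\<in>topspace X. \<pi> x = y} \<inter> V \<subseteq> U"
    and "\<And>x. x \<in> topspace X \<Longrightarrow> card {U\<in>\<beta>. x \<in> U} \<le> k + 1"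
proof -
  let ?B = "{\<beta>. finite_open_cover X \<beta> \<and> refines_cover (cover_join (fibers X Y \<pi>) \<beta>) \<alpha>}"
  have "?B \<noteq> {}" using assms(1) by (auto simp: refines_cover_fibers_iff intro!: exI[of _ \<alpha>])
  then show ?thesis
    by (rule INF_cover_ord_attained[OF assms(2), of ?B])
      (use that in \<open>auto simp: cond_dim_def refines_cover_fibers_iff\<close>)
qed

text \<open>Distinct members may have the same image under \<open>h\<close>, which only lowers the
  count.\<close>

lemma card_preimage_family_le:
  assumes "finite \<beta>" and "\<And>U. U \<in> \<beta> \<Longrightarrow> x \<in> h U \<Longrightarrow> z \<in> U"
  shows "card {V\<in>h ` \<beta>. x \<in> V} \<le> card {U\<in>\<beta>. z \<in> U}"
proof -
  have "{V\<in>h ` \<beta>. x \<in> V} \<subseteq> h ` {U\<in>\<beta>. z \<in> U}" using assms(2) by auto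
  then show ?thesis using assms(1) by (intro surj_card_le) auto
qed

lemma continuous_map_in: "continuous_map X Y f \<Longrightarrow> x \<in> topspace X \<Longrightarrow> f x \<in> topspace Y"
  by (auto simp: continuous_map_def)

lemma finite_open_cover_preimage:
  assumes "continuous_map X X' \<theta>" and "finite_open_cover X' \<beta>"
  shows "finite_open_cover X ((\<lambda>U. {x\<in>topspace X. \<theta> x \<in> U}) ` \<beta>)"
proof -
  have "\<exists>U\<in>\<beta>. \<theta> x \<in> U" if "x \<in> topspace X" for x
    using assms(2) continuous_map_in[OF assms(1) that] unfolding finite_open_cover_def by blast
  then have "\<Union>((\<lambda>U. {x\<in>topspace X. \<theta> x \<in> U}) ` \<beta>) = topspace X" by blast
  then show ?thesis
    using assms(2) openin_continuous_map_preimage[OF assms(1)] by (simp add: finite_open_cover_def)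
qed

text \<open>Optimal covers for the \<open>\<alpha> j\<close> are pulled back along the
  \<open>\<theta> j\<close> and merged by \<open>cover_common_refinement\<close>, where orders add.
  All comparisons of dimension go through this estimate: with group elements or coordinate
  projections as \<open>\<theta> j\<close> it is subadditivity, and with a one-element
  \<open>J\<close> it is monotonicity under pulling back along a single map.\<close>

lemma cond_dim_le_sum:
  assumes "metrizable_space X" and ne: "topspace X \<noteq> {}" and "finite J"
    and \<theta>: "\<And>j. j \<in> J \<Longrightarrow> continuous_map X X' (\<theta> j)"
    and fib: "\<And>j x x'. j \<in> J \<Longrightarrow> x \<in> topspace X \<Longrightarrow> x' \<in> topspace X \<Longrightarrow> \<pi> x = \<pi> x' \<Longrightarrow>
               \<pi>' (\<theta> j x) = \<pi>' (\<theta> j x')"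
    and im: "\<pi>' ` topspace X' \<subseteq> topspace Y'"
    and \<alpha>: "\<And>j. j \<in> J \<Longrightarrow> finite_open_cover X' (\<alpha> j)"
    and ref: "\<And>U. U \<in> Pi J \<alpha> \<Longrightarrow> \<exists>W\<in>\<beta>. {x\<in>topspace X. \<forall>j\<in>J. \<theta> j x \<in> U j} \<subseteq> W"
  shows "cond_dim X Y \<pi> \<beta> \<le> (\<Sum>j\<in>J. cond_dim X' Y' \<pi>' (\<alpha> j))"
proof -
  have \<theta>X: "\<theta> j x \<in> topspace X'" if "j \<in> J" "x \<in> topspace X" for j x
    using continuous_map_in[OF \<theta>] that by blast
  define Q where "Q j \<gamma> k \<longleftrightarrow> finite_open_cover X' \<gamma> \<and> cond_dim X' Y' \<pi>' (\<alpha> j) = ereal (real k) \<and>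
      (\<forall>V\<in>\<gamma>. \<forall>y\<in>topspace Y'. \<exists>U\<in>\<alpha> j. {x\<in>topspace X'. \<pi>' x = y} \<inter> V \<subseteq> U) \<and>
      (\<forall>x\<in>topspace X'. card {U\<in>\<gamma>. x \<in> U} \<le> k + 1)" for j \<gamma> k
  have "\<exists>\<gamma> k. Q j \<gamma> k" if j: "j \<in> J" for j
  proof -
    have "topspace X' \<noteq> {}" using \<theta>X[OF j] ne by blast
    then show ?thesis unfolding Q_def by (rule cond_dim_attained[OF \<alpha>[OF j], of Y' \<pi>']) blast
  qed
  then obtain \<gamma> k where "\<And>j. j \<in> J \<Longrightarrow> Q j (\<gamma> j) (k j)" by metis
  then have \<gamma>: "\<And>j. j \<in> J \<Longrightarrow> finite_open_cover X' (\<gamma> j)"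
    and k: "\<And>j. j \<in> J \<Longrightarrow> cond_dim X' Y' \<pi>' (\<alpha> j) = ereal (real (k j))"
    and \<gamma>ref: "\<And>j V y. j \<in> J \<Longrightarrow> V \<in> \<gamma> j \<Longrightarrow> y \<in> topspace Y' \<Longrightarrow>
        \<exists>U\<in>\<alpha> j. {x\<in>topspace X'. \<pi>' x = y} \<inter> V \<subseteq> U"
    and card\<gamma>: "\<And>j x. j \<in> J \<Longrightarrow> x \<in> topspace X' \<Longrightarrow> card {U\<in>\<gamma> j. x \<in> U} \<le> k j + 1"
    unfolding Q_def by blast+
  define pre where "pre j U = {x\<in>topspace X. \<theta> j x \<in> U}" for j U
  have cov: "finite_open_cover X (pre j ` \<gamma> j)" if "j \<in> J" for j
    using finite_open_cover_preimage[OF \<theta>[OF that] \<gamma>[OF that]] by (simp add: pre_def)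
  obtain \<delta> where \<delta>: "finite_open_cover X \<delta>"
    and \<delta>ref: "\<And>W. W \<in> \<delta> \<Longrightarrow> \<exists>U\<in>Pi J (\<lambda>j. pre j ` \<gamma> j). \<forall>j\<in>J. W \<subseteq> U j"
    and card\<delta>: "\<And>x. x \<in> topspace X \<Longrightarrow>
      card {W\<in>\<delta>. x \<in> W} + card J \<le> 1 + (\<Sum>j\<in>J. card {U\<in>pre j ` \<gamma> j. x \<in> U})"
    by (rule cover_common_refinement[OF assms(1,3) cov]) blast+
  have "cond_dim X Y \<pi> \<beta> \<le> ereal (real (\<Sum>j\<in>J. k j))"
  proof (rule cond_dim_le[OF \<delta> ne])
    fix x assume x: "x \<in> topspace X"
    have "(\<Sum>j\<in>J. card {U\<in>pre j ` \<gamma> j. x \<in> U}) \<le> (\<Sum>j\<in>J. k j + 1)"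
    proof (rule sum_mono)
      fix j assume j: "j \<in> J"
      have "card {U\<in>pre j ` \<gamma> j. x \<in> U} \<le> card {U\<in>\<gamma> j. \<theta> j x \<in> U}"
        using \<gamma>[OF j] by (intro card_preimage_family_le) (auto simp: pre_def finite_open_cover_def)
      with card\<gamma>[OF j \<theta>X[OF j x]] show "card {U\<in>pre j ` \<gamma> j. x \<in> U} \<le> k j + 1" by linarith
    qed
    also have "\<dots> = (\<Sum>j\<in>J. k j) + card J" by (simp only: sum.distrib) simp
    finally show "card {U\<in>\<delta>. x \<in> U} \<le> (\<Sum>j\<in>J. k j) + 1"
      using card\<delta>[OF x] by linarith
  next
    fix W y assume W: "W \<in> \<delta>" and y: "y \<in> topspace Y"
    obtain U where U: "U \<in> Pi J (\<lambda>j. pre j ` \<gamma> j)" "\<And>j. j \<in> J \<Longrightarrow> W \<subseteq> U j"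
      using \<delta>ref[OF W] by blast
    then have "\<exists>V. V \<in> \<gamma> j \<and> W \<subseteq> pre j V" if "j \<in> J" for j using that by (fastforce simp: Pi_iff)
    then obtain V where V: "\<And>j. j \<in> J \<Longrightarrow> V j \<in> \<gamma> j \<and> W \<subseteq> pre j (V j)" by metis
    \<comment> \<open>No map from \<open>Y\<close> to \<open>Y'\<close> is given, so the fiber of
      \<open>\<pi>'\<close> that receives the fiber over \<open>y\<close> under
      \<open>\<theta> j\<close> is named by a point \<open>x0\<close> of the latter. If
      \<open>W\<close> misses that fiber, any point will do.\<close>
    have "\<exists>x0\<in>topspace X. {x\<in>topspace X. \<pi> x = y} \<inter> W \<noteq> {} \<longrightarrow> \<pi> x0 = y"
      using ne by (cases "{x\<in>topspace X. \<pi> x = y} \<inter> W = {}") auto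
    then obtain x0 where x0: "x0 \<in> topspace X"
      and x0y: "{x\<in>topspace X. \<pi> x = y} \<inter> W \<noteq> {} \<Longrightarrow> \<pi> x0 = y"
      by blast
    have "\<exists>U\<in>\<alpha> j. {x\<in>topspace X'. \<pi>' x = \<pi>' (\<theta> j x0)} \<inter> V j \<subseteq> U" if j: "j \<in> J" for j
      using \<gamma>ref[OF j] V[OF j] im \<theta>X[OF j x0] by blast
    then obtain A where A: "\<And>j. j \<in> J \<Longrightarrow> A j \<in> \<alpha> j \<and>
        {x\<in>topspace X'. \<pi>' x = \<pi>' (\<theta> j x0)} \<inter> V j \<subseteq> A j"
      by metis
    then obtain B where B: "B \<in> \<beta>" "{x\<in>topspace X. \<forall>j\<in>J. \<theta> j x \<in> A j} \<subseteq> B"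
      using ref[of A] by auto
    have "{x\<in>topspace X. \<pi> x = y} \<inter> W \<subseteq> B"
    proof
      fix x assume x: "x \<in> {x\<in>topspace X. \<pi> x = y} \<inter> W"
      then have "\<pi> x0 = \<pi> x" using x0y by auto
      then have "\<theta> j x \<in> A j" if "j \<in> J" for j
        using A[OF that] V[OF that] x fib[OF that, of x x0] x0 \<theta>X[OF that, of x]
        by (auto simp: pre_def subset_iff)
      then show "x \<in> B" using B x by auto
    qed
    then show "\<exists>U\<in>\<beta>. {x\<in>topspace X. \<pi> x = y} \<inter> W \<subseteq> U" using B by blast
  qed
  also have "ereal (real (\<Sum>j\<in>J. k j)) = (\<Sum>j\<in>J. cond_dim X' Y' \<pi>' (\<alpha> j))"
    using k by (simp add: sum_ereal)
  finally show ?thesis .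
qed

text \<open>The only fiber is the whole space. Through this identity the estimates for conditional
  dimension also serve for the absolute dimension of \<open>Y\<close> and of microstate
  spaces.\<close>

lemma cond_dim_singleton:
  assumes "topspace Z = {z}" and "\<And>x. x \<in> topspace Y \<Longrightarrow> p x = z"
  shows "cond_dim Y Z p \<alpha> = cover_dim Y \<alpha>"
proof -
  have "refines_cover (cover_join (fibers Y Z p) \<beta>) \<alpha> \<longleftrightarrow> refines_cover \<beta> \<alpha>"
    if "finite_open_cover Y \<beta>" for \<beta>
  proof -
    have "{x\<in>topspace Y. p x = z} \<inter> V = V" if "V \<in> \<beta>" for V
      using that \<open>finite_open_cover Y \<beta>\<close> assms(2) by (auto simp: finite_open_cover_def)
    then show ?thesis unfolding refines_cover_fibers_iff assms(1) by (auto simp: refines_cover_def)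
  qed
  then show ?thesis unfolding cond_dim_def cover_dim_def by (intro INF_cong) auto
qed

lemma finite_open_cover_topspace: "finite_open_cover X {topspace X}"
  by (simp add: finite_open_cover_def)

lemma cond_dim_empty:
  assumes "topspace X = {}"
  shows "cond_dim X Y \<pi> \<alpha> = -\<infinity>"
proof -
  have "finite_open_cover X {}" using assms by (simp add: finite_open_cover_def)
  then have "cond_dim X Y \<pi> \<alpha> \<le> cover_ord X {}"
    unfolding cond_dim_def by (intro INF_lower) (auto simp: refines_cover_fibers_iff)
  then show ?thesis using assms by (simp add: cover_ord_def)
qed

text \<open>Conditional dimension sees the base only through the partition of \<open>X\<close> into
  fibers, so equivariance is stated as compatibility of the action with that partition. The absolute
  case is then the one whose base is a point.\<close>

locale fibred_system = group G for G :: "('g, 'm) monoid_scheme" (structure) +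
  fixes X :: "'a topology" and \<phi> :: "'g \<Rightarrow> 'a \<Rightarrow> 'a" and Y :: "'b topology" and \<pi> :: "'a \<Rightarrow> 'b"
  assumes compact: "compact_space X" and metrizable: "metrizable_space X"
    and continuous_action: "\<And>g. g \<in> carrier G \<Longrightarrow> continuous_map X X (\<phi> g)"
    and action_mult: "\<And>g h x. g \<in> carrier G \<Longrightarrow> h \<in> carrier G \<Longrightarrow> x \<in> topspace X \<Longrightarrow>
                        \<phi> (g \<otimes> h) x = \<phi> g (\<phi> h x)"
    and fiber_equivariant: "\<And>g x x'. g \<in> carrier G \<Longrightarrow> x \<in> topspace X \<Longrightarrow> x' \<in> topspace X \<Longrightarrow>
                        \<pi> x = \<pi> x' \<Longrightarrow> \<pi> (\<phi> g x) = \<pi> (\<phi> g x')"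
    and image_subset: "\<pi> ` topspace X \<subseteq> topspace Y"
begin

lemma action_closed: "g \<in> carrier G \<Longrightarrow> x \<in> topspace X \<Longrightarrow> \<phi> g x \<in> topspace X"
  using continuous_map_in[OF continuous_action] by blast

lemma finite_open_cover_dyn_join:
  assumes "F \<in> fin_subsets G" and "finite_open_cover X \<alpha>"
  shows "finite_open_cover X (dyn_join X \<phi> F \<alpha>)"
proof -
  let ?B = "\<lambda>U. \<Inter>s\<in>F. {x\<in>topspace X. \<phi> s x \<in> U s}"
  have F: "finite F" "F \<noteq> {}" "F \<subseteq> carrier G" using assms by (auto simp: fin_subsets_def)
  have \<alpha>: "finite \<alpha>" "\<And>U. U \<in> \<alpha> \<Longrightarrow> openin X U" "\<Union>\<alpha> = topspace X"
    using assms by (auto simp: finite_open_cover_def)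
  have "dyn_join X \<phi> F \<alpha> \<subseteq> ?B ` (PiE F (\<lambda>_. \<alpha>))"
  proof
    fix W assume "W \<in> dyn_join X \<phi> F \<alpha>"
    then obtain U where U: "U \<in> F \<rightarrow> \<alpha>" "W = ?B U" by (auto simp: dyn_join_def)
    then have "W = ?B (restrict U F)" by auto
    moreover have "restrict U F \<in> PiE F (\<lambda>_. \<alpha>)" using U by auto
    ultimately show "W \<in> ?B ` (PiE F (\<lambda>_. \<alpha>))" by blast
  qed
  then have "finite (dyn_join X \<phi> F \<alpha>)"
    using F \<alpha> by (meson finite_PiE finite_imageI finite_subset)
  moreover have "openin X W" if W: "W \<in> dyn_join X \<phi> F \<alpha>" for W
  proof -
    obtain U where U: "U \<in> F \<rightarrow> \<alpha>" "W = ?B U" using W unfolding dyn_join_def by blast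
    show ?thesis unfolding U(2)
    proof (rule openin_Inter)
      fix K assume "K \<in> (\<lambda>s. {x\<in>topspace X. \<phi> s x \<in> U s}) ` F"
      then show "openin X K" using F U \<alpha>(2)
        by (auto intro!: openin_continuous_map_preimage[OF continuous_action])
    qed (use F in auto)
  qed
  moreover have "\<Union>(dyn_join X \<phi> F \<alpha>) = topspace X"
  proof
    show "\<Union>(dyn_join X \<phi> F \<alpha>) \<subseteq> topspace X" using F by (auto simp: dyn_join_def)
    show "topspace X \<subseteq> \<Union>(dyn_join X \<phi> F \<alpha>)"
    proof
      fix x assume x: "x \<in> topspace X"
      then have "\<exists>U\<in>\<alpha>. \<phi> s x \<in> U" if "s \<in> F" for s
        using action_closed[of s x] F that \<alpha>(3) by (metis UnionE subsetD)
      then obtain U where "\<And>s. s \<in> F \<Longrightarrow> U s \<in> \<alpha> \<and> \<phi> s x \<in> U s" by metis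
      then have "x \<in> ?B U" "?B U \<in> dyn_join X \<phi> F \<alpha>" using x by (auto simp: dyn_join_def)
      then show "x \<in> \<Union>(dyn_join X \<phi> F \<alpha>)" by blast
    qed
  qed
  ultimately show ?thesis by (auto simp: finite_open_cover_def)
qed

text \<open>\<open>dyn_join\<close> over the empty set is \<open>{UNIV}\<close>, which is not an open cover; its dimension is set to \<open>0\<close>.\<close>

definition dyn_dim :: "'a set set \<Rightarrow> 'g set \<Rightarrow> real" where
  "dyn_dim \<alpha> F = (if F = {} then 0 else real_of_ereal (cond_dim X Y \<pi> (dyn_join X \<phi> F \<alpha>)))"

lemma dyn_dim_nonneg_eq:
  assumes "topspace X \<noteq> {}" and "F \<in> fin_subsets G" and "finite_open_cover X \<alpha>"
  shows "cond_dim X Y \<pi> (dyn_join X \<phi> F \<alpha>) = ereal (dyn_dim \<alpha> F)" and "0 \<le> dyn_dim \<alpha> F"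
proof -
  obtain k where "cond_dim X Y \<pi> (dyn_join X \<phi> F \<alpha>) = ereal (real k)"
    by (rule cond_dim_attained[OF finite_open_cover_dyn_join[OF assms(2,3)] assms(1), of Y \<pi>])
  then show "cond_dim X Y \<pi> (dyn_join X \<phi> F \<alpha>) = ereal (dyn_dim \<alpha> F)" "0 \<le> dyn_dim \<alpha> F"
    using assms(2) by (auto simp: dyn_dim_def fin_subsets_def)
qed

text \<open>Since \<open>\<phi> (f \<otimes> c)\<close> is \<open>\<phi> f\<close> after
  \<open>\<phi> c\<close>, the join over the right translate of \<open>E\<close> by \<open>c\<close>
  is the pullback under \<open>\<phi> c\<close> of the join over \<open>E\<close>. With
  \<open>B\<close> an arbitrary subset of overlapping translates, the one inequality contains
  monotonicity, right invariance and subadditivity, as \<open>ornstein_weiss\<close> wants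
  them.\<close>

lemma dyn_dim_le_sum:
  assumes "topspace X \<noteq> {}" and \<alpha>: "finite_open_cover X \<alpha>" and "finite J"
    and J: "J \<subseteq> carrier G \<times> fin_subsets G"
    and B: "B \<subseteq> (\<Union>(c,E)\<in>J. (\<lambda>f. f \<otimes> c) ` E)"
  shows "dyn_dim \<alpha> B \<le> (\<Sum>(c,E)\<in>J. dyn_dim \<alpha> E)"
proof (cases "B = {}")
  case True
  have "0 \<le> (\<Sum>(c,E)\<in>J. dyn_dim \<alpha> E)"
    using J dyn_dim_nonneg_eq(2)[OF assms(1) _ \<alpha>] by (intro sum_nonneg) auto
  then show ?thesis using True by (simp add: dyn_dim_def)
next
  case False
  have E: "finite (snd p)" "snd p \<subseteq> carrier G" "fst p \<in> carrier G" "snd p \<in> fin_subsets G"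
    if "p \<in> J" for p using subsetD[OF J that] by (auto simp: fin_subsets_def)
  have "(\<Union>(c,E)\<in>J. (\<lambda>f. f \<otimes> c) ` E) \<subseteq> carrier G" using E by (force simp: subset_iff)
  moreover have "finite (\<Union>(c,E)\<in>J. (\<lambda>f. f \<otimes> c) ` E)" using E \<open>finite J\<close> by (force simp: split_beta)
  ultimately have Bf: "B \<in> fin_subsets G" using False B
    by (auto simp: fin_subsets_def intro: finite_subset)
  have "cond_dim X Y \<pi> (dyn_join X \<phi> B \<alpha>) \<le> (\<Sum>p\<in>J. cond_dim X Y \<pi> (dyn_join X \<phi> (snd p) \<alpha>))"
  proof (rule cond_dim_le_sum[OF metrizable assms(1,3), where \<theta> = "\<lambda>p. \<phi> (fst p)"])
    fix U assume U: "U \<in> Pi J (\<lambda>p. dyn_join X \<phi> (snd p) \<alpha>)"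
    define Q where "Q p A \<longleftrightarrow> A \<in> snd p \<rightarrow> \<alpha> \<and> U p = (\<Inter>s\<in>snd p. {x\<in>topspace X. \<phi> s x \<in> A s})" for p A
    have "\<exists>A. Q p A" if "p \<in> J" for p
    proof -
      have "U p \<in> dyn_join X \<phi> (snd p) \<alpha>" using U that by blast
      then show ?thesis by (simp add: dyn_join_def Q_def conj_commute)
    qed
    then obtain A where "\<And>p. p \<in> J \<Longrightarrow> Q p (A p)" by metis
    then have A: "\<And>p. p \<in> J \<Longrightarrow> A p \<in> snd p \<rightarrow> \<alpha> \<and>
        U p = (\<Inter>s\<in>snd p. {x\<in>topspace X. \<phi> s x \<in> A p s})" unfolding Q_def by blast
    have "\<exists>p f. p \<in> J \<and> f \<in> snd p \<and> b = f \<otimes> fst p" if "b \<in> B" for b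
      using that B by force
    then obtain p f where pf: "\<And>b. b \<in> B \<Longrightarrow> p b \<in> J \<and> f b \<in> snd (p b) \<and> b = f b \<otimes> fst (p b)"
      by metis
    let ?W = "\<Inter>b\<in>B. {x\<in>topspace X. \<phi> b x \<in> A (p b) (f b)}"
    have "?W \<in> dyn_join X \<phi> B \<alpha>"
    proof -
      have "A (p b) (f b) \<in> \<alpha>" if "b \<in> B" for b using A[of "p b"] pf[OF that] by blast
      then show ?thesis
        unfolding dyn_join_def by (intro CollectI exI[of _ "\<lambda>b. A (p b) (f b)"]) auto
    qed
    moreover have "x \<in> ?W" if x: "x \<in> topspace X" "\<And>j. j \<in> J \<Longrightarrow> \<phi> (fst j) x \<in> U j" for x
    proof -
      have "\<phi> b x \<in> A (p b) (f b)" if b: "b \<in> B" for b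
      proof -
        have "\<phi> (f b) (\<phi> (fst (p b)) x) \<in> A (p b) (f b)" using x(2) A pf[OF b] by fastforce
        moreover have "\<phi> b x = \<phi> (f b) (\<phi> (fst (p b)) x)"
          using pf[OF b] x(1) action_mult E by (metis subset_iff)
        ultimately show ?thesis by simp
      qed
      then show ?thesis using x by auto
    qed
    ultimately show "\<exists>W\<in>dyn_join X \<phi> B \<alpha>. {x\<in>topspace X. \<forall>j\<in>J. \<phi> (fst j) x \<in> U j} \<subseteq> W"
      by blast
  next
    show "continuous_map X X (\<phi> (fst p))" if "p \<in> J" for p
      using continuous_action E(3)[OF that] .
    show "\<pi> (\<phi> (fst p) x) = \<pi> (\<phi> (fst p) x')"
      if "p \<in> J" "x \<in> topspace X" "x' \<in> topspace X" "\<pi> x = \<pi> x'" for p x x'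
      using fiber_equivariant[OF E(3)[OF that(1)] that(2-4)] .
    show "finite_open_cover X (dyn_join X \<phi> (snd p) \<alpha>)" if "p \<in> J" for p
      using finite_open_cover_dyn_join[OF E(4)[OF that] \<alpha>] .
  qed (rule image_subset)
  also have "\<dots> = (\<Sum>p\<in>J. ereal (dyn_dim \<alpha> (snd p)))"
    using E dyn_dim_nonneg_eq(1)[OF assms(1) _ \<alpha>] by (intro sum.cong) auto
  finally show ?thesis
    using dyn_dim_nonneg_eq(1)[OF assms(1) Bf \<alpha>] by (simp add: sum_ereal split_beta)
qed

end

section \<open>Quasi-tilings\<close>

text \<open>A tile is a pair of its centre and its shape.\<close>

definition tile_image :: "('g \<Rightarrow> 'v \<Rightarrow> 'v) \<Rightarrow> 'v \<times> 'g set \<Rightarrow> 'v set" where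
  "tile_image \<sigma> p = (\<lambda>f. \<sigma> f (fst p)) ` snd p"

definition covered :: "('g \<Rightarrow> 'v \<Rightarrow> 'v) \<Rightarrow> ('v \<times> 'g set) set \<Rightarrow> 'v set" where
  "covered \<sigma> P = (\<Union>p\<in>P. tile_image \<sigma> p)"

lemma sum_card_swap:
  assumes "finite A" "finite B"
  shows "(\<Sum>a\<in>A. card {b\<in>B. R a b}) = (\<Sum>b\<in>B. card {a\<in>A. R a b})"
proof -
  have "card {b\<in>B. R a b} = (\<Sum>b\<in>B. if R a b then 1 else 0)" for a
    using assms by (simp add: sum.If_cases Int_def)
  moreover have "card {a\<in>A. R a b} = (\<Sum>a\<in>A. if R a b then 1 else 0)" for b
    using assms by (simp add: sum.If_cases Int_def)
  ultimately show ?thesis by (simp add: sum.swap[of _ A])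
qed

text \<open>Pays for tiles that keep only a proportion \<open>1 - \<epsilon>\<close> of their
  shapes. For positive \<open>a\<close> the value \<open>\<zeta> / (a + \<zeta>)\<close> gives
  equality, and the cap 1/2 is what the quasi-tilings ask for.\<close>

lemma divide_one_minus_le:
  fixes a \<zeta> :: real
  assumes "0 \<le> a" "0 < \<zeta>"
  obtains \<epsilon> where "0 < \<epsilon>" "\<epsilon> \<le> 1/2" "a / (1 - \<epsilon>) \<le> a + \<zeta>"
proof -
  define \<epsilon> where "\<epsilon> = min (1/2) (\<zeta> / (a + \<zeta>))"
  have \<epsilon>: "0 < \<epsilon>" "\<epsilon> \<le> 1/2" "\<epsilon> \<le> \<zeta> / (a + \<zeta>)" using assms by (simp_all only: \<epsilon>_def min.cobounded1 min.cobounded2) simp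
  then have "\<epsilon> * (a + \<zeta>) \<le> \<zeta>" using assms by (simp add: pos_le_divide_eq)
  then have "a \<le> (a + \<zeta>) * (1 - \<epsilon>)" by (simp add: algebra_simps)
  then have "a / (1 - \<epsilon>) \<le> a + \<zeta>" using \<epsilon> by (simp add: pos_divide_le_eq)
  then show ?thesis using that \<epsilon> by blast
qed

context group
begin

text \<open>The points at which \<open>\<sigma>\<close> looks, as far as \<open>T\<close> can see,
  like a free action that stays in \<open>V\<close>. Staying in \<open>V\<close> is the condition at
  stake for left multiplication on an invariant set, and for the points left over once some tiles
  have been removed.\<close>

definition good_points :: "('a \<Rightarrow> 'v \<Rightarrow> 'v) \<Rightarrow> 'a set \<Rightarrow> 'v set \<Rightarrow> 'v set" where
  "good_points \<sigma> T V = {v\<in>V. (\<forall>t\<in>T. \<sigma> t v \<in> V) \<and> (\<forall>s\<in>T. \<forall>t\<in>T. \<sigma> s (\<sigma> t v) = \<sigma> (s \<otimes> t) v) \<and>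
     (\<forall>s\<in>T. \<forall>t\<in>T. s \<noteq> t \<longrightarrow> \<sigma> s v \<noteq> \<sigma> t v) \<and> \<sigma> \<one> v = v}"

text \<open>The tiles are honestly disjoint at the price of trimming their shapes. \<open>K\<close>
  lists the elements that must multiply correctly with the points of a tile; the lower bound for
  microstates uses it to make them equivariant inside tiles, and the other applications take it
  empty.\<close>

definition tiling ::
    "('a \<Rightarrow> 'v \<Rightarrow> 'v) \<Rightarrow> 'a set \<Rightarrow> 'a set set \<Rightarrow> real \<Rightarrow> 'v set \<Rightarrow> ('v \<times> 'a set) set \<Rightarrow> bool" where
  "tiling \<sigma> K \<F> \<epsilon> V P \<longleftrightarrow> finite P \<and>
     (\<forall>p\<in>P. fst p \<in> V \<and> snd p \<noteq> {} \<and>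
        (\<exists>F\<in>\<F>. snd p \<subseteq> F \<and> (1 - \<epsilon>) * real (card F) \<le> real (card (snd p))) \<and>
        inj_on (\<lambda>f. \<sigma> f (fst p)) (snd p) \<and> tile_image \<sigma> p \<subseteq> V \<and>
        (\<forall>s\<in>K. \<forall>f\<in>snd p. \<sigma> s (\<sigma> f (fst p)) = \<sigma> (s \<otimes> f) (fst p))) \<and>
     (\<forall>p\<in>P. \<forall>q\<in>P. p \<noteq> q \<longrightarrow> tile_image \<sigma> p \<inter> tile_image \<sigma> q = {})"

lemma tiling_covered_subset: "tiling \<sigma> K \<F> \<epsilon> V P \<Longrightarrow> covered \<sigma> P \<subseteq> V"
  by (auto simp: tiling_def covered_def)

lemma card_covered:
  assumes "tiling \<sigma> K \<F> \<epsilon> V P" and "\<And>F. F \<in> \<F> \<Longrightarrow> finite F"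
  shows "card (covered \<sigma> P) = (\<Sum>p\<in>P. card (snd p))"
proof -
  have fin: "finite (snd p)" if "p \<in> P" for p
    using assms that by (meson finite_subset tiling_def)
  have "card (covered \<sigma> P) = (\<Sum>p\<in>P. card (tile_image \<sigma> p))"
    unfolding covered_def using assms fin
    by (intro card_UN_disjoint) (auto simp: tiling_def tile_image_def)
  also have "\<dots> = (\<Sum>p\<in>P. card (snd p))"
    using assms by (intro sum.cong) (auto simp: tiling_def tile_image_def card_image)
  finally show ?thesis .
qed

text \<open>The tiles are trimmed copies of \<open>F\<close>, and trimming spoils their invariance. Therefore the maximal
  family is taken among those covering the full copy of \<open>F\<close> at each centre: then the boundary of the
  covered set is controlled by that of \<open>F\<close>, and what is left over can be tiled again.\<close>

lemma greedy_tiling: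
  fixes \<sigma> :: "'a \<Rightarrow> 'v \<Rightarrow> 'v"
  assumes F: "F \<in> fin_subsets G" and T: "finite T" "T \<subseteq> carrier G" and K: "K \<subseteq> carrier G"
    and \<epsilon>: "0 < \<epsilon>" "\<epsilon> < 1" and V: "finite V"
  defines "T' \<equiv> F \<union> m_inv G ` F \<union> T \<union> m_inv G ` T \<union> K"
  obtains P where "tiling \<sigma> K {F} \<epsilon> V P"
    and "\<epsilon> * real (card (good_points \<sigma> T' V)) \<le> real (card (covered \<sigma> P))"
    and "real (card P) * ((1 - \<epsilon>) * real (card F)) \<le> real (card (covered \<sigma> P))"
    and "card ((V - covered \<sigma> P) - good_points \<sigma> T (V - covered \<sigma> P))
           \<le> card (V - good_points \<sigma> T' V) + card P * (\<Sum>t\<in>T. card (F - (t <# F)))"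
proof -
  have finF: "finite F" "F \<noteq> {}" "F \<subseteq> carrier G" using F by (auto simp: fin_subsets_def)
  define V0 where "V0 = good_points \<sigma> T' V"
  have V0: "V0 \<subseteq> V" and finV0: "finite V0"
    using V by (auto simp: V0_def good_points_def)
  have in_V: "\<sigma> t c \<in> V" if "c \<in> V0" "t \<in> T'" for c t
    using that by (auto simp: V0_def good_points_def)
  have mult: "\<sigma> s (\<sigma> t c) = \<sigma> (s \<otimes> t) c" if "c \<in> V0" "s \<in> T'" "t \<in> T'" for c s t
    using that by (auto simp: V0_def good_points_def)
  have free: "s = t" if "c \<in> V0" "s \<in> T'" "t \<in> T'" "\<sigma> s c = \<sigma> t c" for c s t
    using that by (auto simp: V0_def good_points_def)
  have unit: "\<sigma> \<one> c = c" if "c \<in> V0" for c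
    using that by (auto simp: V0_def good_points_def)
  have FT: "f \<in> T'" "inv f \<in> T'" if "f \<in> F" for f using that by (auto simp: T'_def)
  have TT: "t \<in> T'" "inv t \<in> T'" if "t \<in> T" for t using that by (auto simp: T'_def)
  \<comment> \<open>This is the purpose of the inverses in \<open>T'\<close>: at good points
    \<open>\<sigma> (inv t)\<close> undoes \<open>\<sigma> t\<close>, so \<open>\<sigma> f\<close>
    is injective on \<open>V0\<close> for \<open>f \<in> F\<close>.\<close>
  have cancel: "\<sigma> (inv t) (\<sigma> t c) = c" if "c \<in> V0" "t \<in> F \<union> T" for c t
    using that mult[of c "inv t" t] FT[of t] TT[of t] finF T unit[of c] by auto
  define \<Phi> where "\<Phi> = {P. P \<subseteq> V0 \<times> Pow F \<and> tiling \<sigma> K {F} \<epsilon> V P \<and>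
      (\<forall>p\<in>P. tile_image \<sigma> (fst p, F) \<subseteq> covered \<sigma> P)}"
  have "\<Phi> \<subseteq> Pow (V0 \<times> Pow F)" by (auto simp: \<Phi>_def)
  then have "finite \<Phi>" using finV0 finF by (meson finite_Pow_iff finite_SigmaI finite_subset)
  moreover have "{} \<in> \<Phi>" by (simp add: \<Phi>_def tiling_def)
  ultimately obtain P where P: "P \<in> \<Phi>" and Pmax: "\<And>P'. P' \<in> \<Phi> \<Longrightarrow> P \<subseteq> P' \<Longrightarrow> P = P'"
    using finite_has_maximal[of \<Phi>] by auto
  define A where "A = covered \<sigma> P"
  have tilP: "tiling \<sigma> K {F} \<epsilon> V P" and PV0: "P \<subseteq> V0 \<times> Pow F"
    and full: "\<And>p. p \<in> P \<Longrightarrow> tile_image \<sigma> (fst p, F) \<subseteq> A"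
    using P by (auto simp: \<Phi>_def A_def)
  have AV: "A \<subseteq> V" using tilP tiling_covered_subset A_def by blast
  have finA: "finite A" using AV V finite_subset by blast
  \<comment> \<open>Otherwise the \<open>f\<close> with \<open>\<sigma> f c\<close> uncovered form a
    shape large enough for a tile at \<open>c\<close>. Adding it covers the whole copy of
    \<open>F\<close> at \<open>c\<close>, so the enlarged family is still in \<open>\<Phi>\<close>,
    against maximality.\<close>
  have many: "\<epsilon> * real (card F) \<le> real (card {f\<in>F. \<sigma> f c \<in> A})" if c: "c \<in> V0" for c
  proof (rule ccontr)
    assume neg: "\<not> ?thesis"
    define E where "E = {f\<in>F. \<sigma> f c \<notin> A}"
    have "card F = card {f\<in>F. \<sigma> f c \<in> A} + card E"
      unfolding E_def using finF(1) by (subst card_Un_disjoint[symmetric]) (auto intro: arg_cong[where f = card])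
    then have cardE: "(1 - \<epsilon>) * real (card F) < real (card E)"
      using neg by (simp add: algebra_simps)
    moreover have "0 \<le> (1 - \<epsilon>) * real (card F)" using \<epsilon> by simp
    ultimately have "E \<noteq> {}" by auto
    then have notin: "tile_image \<sigma> (c,E) \<noteq> {}" and disj: "tile_image \<sigma> (c,E) \<inter> A = {}"
      by (auto simp: tile_image_def E_def)
    then have "(c,E) \<notin> P" by (auto simp: A_def covered_def)
    have cov: "covered \<sigma> (insert (c,E) P) = A \<union> tile_image \<sigma> (c,E)"
      by (auto simp: A_def covered_def)
    have "tiling \<sigma> K {F} \<epsilon> V (insert (c,E) P)"
    proof -
      have "inj_on (\<lambda>f. \<sigma> f c) E"
        using free[OF c FT(1) FT(1)] by (auto simp: inj_on_def E_def)
      moreover have "tile_image \<sigma> (c,E) \<subseteq> V"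
        using in_V[OF c FT(1)] by (auto simp: tile_image_def E_def)
      moreover have "\<sigma> s (\<sigma> f c) = \<sigma> (s \<otimes> f) c" if "s \<in> K" "f \<in> E" for s f
        using that by (intro mult[OF c _ FT(1)]) (auto simp: T'_def E_def)
      moreover have "tile_image \<sigma> (c,E) \<inter> tile_image \<sigma> p = {}" if "p \<in> P" for p
        using disj that by (auto simp: A_def covered_def)
      moreover have "E \<subseteq> F" by (auto simp: E_def)
      ultimately show ?thesis
        using tilP \<open>E \<noteq> {}\<close> cardE c V0 unfolding tiling_def by (simp add: Int_commute subset_iff)
    qed
    moreover have "tile_image \<sigma> (fst p, F) \<subseteq> covered \<sigma> (insert (c,E) P)" if "p \<in> insert (c,E) P" for p
    proof (cases "p = (c,E)")
      case True
      then show ?thesis unfolding cov by (auto simp: tile_image_def E_def)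
    next
      case False
      then show ?thesis unfolding cov using full that by blast
    qed
    moreover have "insert (c,E) P \<subseteq> V0 \<times> Pow F" using c PV0 by (auto simp: E_def)
    ultimately have "insert (c,E) P \<in> \<Phi>" unfolding \<Phi>_def by blast
    then show False using Pmax[of "insert (c,E) P"] \<open>(c,E) \<notin> P\<close> by blast
  qed
  \<comment> \<open>Double counting of the pairs of \<open>c \<in> V0\<close> and
    \<open>f \<in> F\<close> with \<open>\<sigma> f c \<in> A\<close>: each \<open>c\<close> has at
    least \<open>\<epsilon> * card F\<close> partners by \<open>many\<close>, and each
    \<open>f\<close> at most \<open>card A\<close> by injectivity.\<close>
  have "\<epsilon> * real (card V0) \<le> real (card A)"
  proof -
    have "real (card V0) * (\<epsilon> * real (card F)) = (\<Sum>c\<in>V0. \<epsilon> * real (card F))" by simp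
    also have "\<dots> \<le> (\<Sum>c\<in>V0. real (card {f\<in>F. \<sigma> f c \<in> A}))"
      by (rule sum_mono[OF many])
    also have "\<dots> = real (\<Sum>f\<in>F. card {c\<in>V0. \<sigma> f c \<in> A})"
      using sum_card_swap[OF finV0 finF(1), of "\<lambda>c f. \<sigma> f c \<in> A"] by (simp flip: of_nat_sum)
    also have "\<dots> \<le> real (\<Sum>f\<in>F. card A)"
    proof (intro of_nat_mono sum_mono)
      fix f assume f: "f \<in> F"
      have "inj_on (\<sigma> f) V0" by (rule inj_onI) (metis cancel f UnI1)
      then show "card {c\<in>V0. \<sigma> f c \<in> A} \<le> card A"
        by (intro card_inj_on_le[OF _ _ finA, of "\<sigma> f"]) (auto intro: inj_on_subset)
    qed
    also have "\<dots> = real (card A) * real (card F)" by simp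
    finally have "(\<epsilon> * real (card V0)) * real (card F) \<le> real (card A) * real (card F)"
      by (simp add: algebra_simps)
    moreover have "0 < real (card F)" using finF by (simp add: card_gt_0_iff)
    ultimately show ?thesis by (simp only: mult_le_cancel_right_pos)
  qed
  moreover have "real (card P) * ((1 - \<epsilon>) * real (card F)) \<le> real (card A)"
  proof -
    have "real (card P) * ((1 - \<epsilon>) * real (card F)) = (\<Sum>p\<in>P. (1 - \<epsilon>) * real (card F))" by simp
    also have "\<dots> \<le> (\<Sum>p\<in>P. real (card (snd p)))"
      using tilP by (intro sum_mono) (auto simp: tiling_def)
    also have "\<dots> = real (card A)" unfolding A_def using card_covered[OF tilP] finF by simp
    finally show ?thesis .
  qed
  moreover have "card ((V - A) - good_points \<sigma> T (V - A))
           \<le> card (V - V0) + card P * (\<Sum>t\<in>T. card (F - (t <# F)))"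
  proof -
    \<comment> \<open>A point \<open>v\<close> of \<open>V0 - A\<close> can fail to be good only if
      some \<open>\<sigma> t v\<close> is in a tile, say equal to \<open>\<sigma> f c\<close>. If
      \<open>f = t \<otimes> f'\<close> with \<open>f' \<in> F\<close>, then
      \<open>v = \<sigma> f' c\<close> lies in the full copy of \<open>F\<close> at \<open>c\<close>
      and is covered. Hence \<open>f\<close> is in \<open>F - (t <# F)\<close>, which leaves few
      such \<open>v\<close> for each tile.\<close>
    define B where "B t p = (\<lambda>f. \<sigma> (inv t \<otimes> f) (fst p)) ` (F - (t <# F))" for t and p :: "'v \<times> 'a set"
    have finP: "finite P" using tilP by (simp add: tiling_def)
    have finB: "finite (B t p)" "card (B t p) \<le> card (F - (t <# F))" for t p
      using finF by (auto simp: B_def intro: card_image_le)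
    have "(V - A) - good_points \<sigma> T (V - A) \<subseteq> (V - V0) \<union> (\<Union>t\<in>T. \<Union>p\<in>P. B t p)"
    proof
      fix v assume v: "v \<in> (V - A) - good_points \<sigma> T (V - A)"
      show "v \<in> (V - V0) \<union> (\<Union>t\<in>T. \<Union>p\<in>P. B t p)"
      proof (cases "v \<in> V0")
        case True
        have "\<exists>t\<in>T. \<sigma> t v \<notin> V - A"
          using v True mult free unit TT by (fastforce simp: good_points_def)
        then obtain t where t: "t \<in> T" "\<sigma> t v \<in> A" using in_V[OF True TT(1)] by blast
        then obtain p f where pf: "p \<in> P" "f \<in> snd p" "\<sigma> t v = \<sigma> f (fst p)"
          by (auto simp: A_def covered_def tile_image_def)
        have p: "fst p \<in> V0" "f \<in> F" using subsetD[OF PV0 pf(1)] pf(2) by (auto simp: mem_Times_iff)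
        have "v = \<sigma> (inv t) (\<sigma> f (fst p))" using cancel[OF True, of t] t pf(3) by simp
        also have "\<dots> = \<sigma> (inv t \<otimes> f) (fst p)" using mult[OF p(1) TT(2)[OF t(1)] FT(1)[OF p(2)]] .
        finally have veq: "v = \<sigma> (inv t \<otimes> f) (fst p)" .
        have "f \<notin> t <# F"
        proof
          assume "f \<in> t <# F"
          then obtain f' where f': "f' \<in> F" "f = t \<otimes> f'" by (auto simp: l_coset_def)
          have "f' \<in> carrier G" "t \<in> carrier G" using f' finF t T by auto
          then have "inv t \<otimes> f = f'" using f'(2) by (simp add: m_assoc[symmetric])
          then have "v \<in> tile_image \<sigma> (fst p, F)" using veq f' by (auto simp: tile_image_def)
          then show False using full[OF pf(1)] v by blast
        qed
        then have "v \<in> B t p" using veq p by (auto simp: B_def)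
        then show ?thesis using t pf by blast
      qed (use v in blast)
    qed
    then have "card ((V - A) - good_points \<sigma> T (V - A)) \<le> card ((V - V0) \<union> (\<Union>t\<in>T. \<Union>p\<in>P. B t p))"
      using V T finP finB by (intro card_mono) auto
    also have "\<dots> \<le> card (V - V0) + card (\<Union>t\<in>T. \<Union>p\<in>P. B t p)" by (rule card_Un_le)
    also have "card (\<Union>t\<in>T. \<Union>p\<in>P. B t p) \<le> (\<Sum>t\<in>T. card (\<Union>p\<in>P. B t p))"
      by (rule card_UN_le[OF T(1)])
    also have "\<dots> \<le> (\<Sum>t\<in>T. \<Sum>p\<in>P. card (B t p))"
      by (intro sum_mono card_UN_le finP)
    also have "\<dots> \<le> (\<Sum>t\<in>T. \<Sum>p\<in>P. card (F - (t <# F)))"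
      by (intro sum_mono finB)
    also have "\<dots> = card P * (\<Sum>t\<in>T. card (F - (t <# F)))" by (simp add: sum_distrib_left)
    finally show ?thesis by simp
  qed
  ultimately show ?thesis using that tilP unfolding A_def V0_def by blast
qed

lemma tiling_Un:
  assumes P: "tiling \<sigma> K \<F> \<epsilon> V P" and P': "tiling \<sigma> K \<F>' \<epsilon> (V - covered \<sigma> P) P'"
  shows "tiling \<sigma> K (\<F> \<union> \<F>') \<epsilon> V (P \<union> P')"
proof -
  have "tile_image \<sigma> p \<inter> tile_image \<sigma> q = {}" if "p \<in> P" "q \<in> P'" for p q
    using that tiling_covered_subset[OF P'] by (fastforce simp: covered_def)
  then have disj: "tile_image \<sigma> p \<inter> tile_image \<sigma> q = {}" if "p \<in> P \<union> P'" "q \<in> P \<union> P'" "p \<noteq> q" for p q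
    using that P P' unfolding tiling_def by (metis Int_commute UnE)
  have ex: "\<exists>F\<in>\<F> \<union> \<F>'. snd p \<subseteq> F \<and> (1 - \<epsilon>) * real (card F) \<le> real (card (snd p))"
    if "p \<in> P \<union> P'" for p
    using that
  proof
    assume "p \<in> P"
    then have "\<exists>F\<in>\<F>. snd p \<subseteq> F \<and> (1 - \<epsilon>) * real (card F) \<le> real (card (snd p))"
      using P by (simp add: tiling_def)
    then show ?thesis by blast
  next
    assume "p \<in> P'"
    then have "\<exists>F\<in>\<F>'. snd p \<subseteq> F \<and> (1 - \<epsilon>) * real (card F) \<le> real (card (snd p))"
      using P' by (simp add: tiling_def)
    then show ?thesis by blast
  qed
  have fin: "finite (P \<union> P')" using P P' by (simp add: tiling_def)
  have "fst p \<in> V \<and> snd p \<noteq> {} \<and> inj_on (\<lambda>f. \<sigma> f (fst p)) (snd p) \<and> tile_image \<sigma> p \<subseteq> V \<and>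
    (\<forall>s\<in>K. \<forall>f\<in>snd p. \<sigma> s (\<sigma> f (fst p)) = \<sigma> (s \<otimes> f) (fst p))" if "p \<in> P \<union> P'" for p
    using that
  proof
    assume "p \<in> P"
    then show ?thesis using P by (simp add: tiling_def)
  next
    assume "p \<in> P'"
    then show ?thesis using P' by (simp add: tiling_def subset_Diff_insert) blast
  qed
  with ex fin disj show ?thesis unfolding tiling_def by simp
qed

text \<open>That \<open>Q\<close> holds frequently along \<open>invariance_filter G\<close>, in the
  elementary form from which the induction below draws its next shape.\<close>

definition frequently_invariant :: "('a set \<Rightarrow> bool) \<Rightarrow> bool" where
  "frequently_invariant Q \<longleftrightarrow> (\<forall>T b. finite T \<longrightarrow> T \<subseteq> carrier G \<longrightarrow> 0 < b \<longrightarrow>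
      (\<exists>F\<in>fin_subsets G. Q F \<and> (\<forall>t\<in>T. boundary_ratio G t F \<le> b)))"

text \<open>The shapes are chosen in the reverse order of their use. The induction hypothesis
  supplies \<open>T\<close> and \<open>\<delta>\<close> for tiling a remainder; the new shape
  \<open>F\<close> is taken so invariant under \<open>T\<close> that a greedy round with
  \<open>F\<close>, carried out first, leaves a remainder to which the hypothesis applies. Each
  round covers at least a proportion \<open>\<epsilon>/2\<close>.\<close>

lemma quasi_tiling_power:
  fixes K :: "'a set"
  assumes freq: "frequently_invariant Q"
    and K: "finite K" "K \<subseteq> carrier G" and \<epsilon>: "0 < \<epsilon>" "\<epsilon> \<le> 1/2"
  shows "\<exists>\<F> T \<delta>. finite \<F> \<and> \<F> \<subseteq> fin_subsets G \<and> (\<forall>F\<in>\<F>. Q F) \<and> finite T \<and> T \<subseteq> carrier G \<and> 0 < \<delta> \<and>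
    (\<forall>(V::'v set) \<sigma>. finite V \<longrightarrow> real (card (V - good_points \<sigma> T V)) \<le> \<delta> * real (card V) \<longrightarrow>
      (\<exists>P. tiling \<sigma> K \<F> \<epsilon> V P \<and> real (card (V - covered \<sigma> P)) \<le> (1 - \<epsilon>/2) ^ k * real (card V)))"
proof (induction k)
  case 0
  have "tiling \<sigma> K {} \<epsilon> V {}" "covered \<sigma> {} = {}" for \<sigma> :: "'a \<Rightarrow> 'v \<Rightarrow> 'v" and V
    by (auto simp: tiling_def covered_def)
  then show ?case
    by (intro exI[of _ "{}"] exI[of _ 1]) (auto intro!: exI[of _ "{}"])
next
  case (Suc k)
  then obtain \<F> T \<delta> where *: "finite \<F> \<and> \<F> \<subseteq> fin_subsets G \<and> (\<forall>F\<in>\<F>. Q F) \<and> finite T \<and> T \<subseteq> carrier G \<and> 0 < \<delta> \<and>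
    (\<forall>(V::'v set) \<sigma>. finite V \<longrightarrow> real (card (V - good_points \<sigma> T V)) \<le> \<delta> * real (card V) \<longrightarrow>
      (\<exists>P. tiling \<sigma> K \<F> \<epsilon> V P \<and> real (card (V - covered \<sigma> P)) \<le> (1 - \<epsilon>/2) ^ k * real (card V)))"
    by (elim exE)
  then have \<F>: "finite \<F>" "\<F> \<subseteq> fin_subsets G" "\<And>F. F \<in> \<F> \<Longrightarrow> Q F"
    and T: "finite T" "T \<subseteq> carrier G" and \<delta>: "0 < \<delta>" by simp_all
  from * have IH: "\<exists>P. tiling \<sigma> K \<F> \<epsilon> V P \<and> real (card (V - covered \<sigma> P)) \<le> (1 - \<epsilon>/2) ^ k * real (card V)"
    if "finite V" "real (card (V - good_points \<sigma> T V)) \<le> \<delta> * real (card V)" for V :: "'v set" and \<sigma>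
    using that by (elim conjE) simp
  define \<eta> where "\<eta> = (1 - \<epsilon>/2) ^ Suc k"
  have \<eta>: "0 < \<eta>" using \<epsilon> by (simp add: \<eta>_def)
  \<comment> \<open>A round creates at most
    \<open>card P * (\<Sum>t\<in>T. card (F - (t <# F)))\<close> new bad points. As
    \<open>card P * card F \<le> 2 * card V\<close>, this \<open>b\<close> keeps them at most
    \<open>\<delta> * \<eta> / 2 * card V\<close>; the other half of the allowance goes to
    \<open>\<delta>'\<close>.\<close>
  define b where "b = \<delta> * \<eta> / (4 * (real (card T) + 1))"
  have b: "0 < b" using \<delta> \<eta> by (simp add: b_def add_nonneg_pos)
  obtain F where F: "F \<in> fin_subsets G" "Q F" "\<And>t. t \<in> T \<Longrightarrow> boundary_ratio G t F \<le> b"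
    using freq T b unfolding frequently_invariant_def by metis
  have finF: "finite F" "F \<noteq> {}" "F \<subseteq> carrier G" using F by (auto simp: fin_subsets_def)
  define T' where "T' = F \<union> m_inv G ` F \<union> T \<union> m_inv G ` T \<union> K"
  \<comment> \<open>The cap 1/2 leaves at least half of the points good, so that a round covers a
    proportion \<open>\<epsilon>/2\<close> of \<open>V\<close>. If more than
    \<open>\<eta> * card V\<close> points remain, the bad ones among them number at most
    \<open>\<delta> * \<eta> * card V\<close>, hence at most the proportion \<open>\<delta>\<close>
    of the remainder. If fewer remain, there is nothing left to do.\<close>
  define \<delta>' where "\<delta>' = min (1/2) (\<delta> * \<eta> / 2)"
  have \<delta>': "0 < \<delta>'" "\<delta>' \<le> 1/2" "\<delta>' \<le> \<delta> * \<eta> / 2" using \<delta> \<eta> by (auto simp: \<delta>'_def)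
  have main: "\<exists>P. tiling \<sigma> K (insert F \<F>) \<epsilon> V P \<and> real (card (V - covered \<sigma> P)) \<le> \<eta> * real (card V)"
    if V: "finite V" and good: "real (card (V - good_points \<sigma> T' V)) \<le> \<delta>' * real (card V)"
    for V :: "'v set" and \<sigma>
  proof -
    have \<epsilon>1: "\<epsilon> < 1" using \<epsilon> by simp
    obtain P where tilP: "tiling \<sigma> K {F} \<epsilon> V P"
      and P1: "\<epsilon> * real (card (good_points \<sigma> T' V)) \<le> real (card (covered \<sigma> P))"
      and P2: "real (card P) * ((1 - \<epsilon>) * real (card F)) \<le> real (card (covered \<sigma> P))"
      and P3: "card ((V - covered \<sigma> P) - good_points \<sigma> T (V - covered \<sigma> P))
           \<le> card (V - good_points \<sigma> T' V) + card P * (\<Sum>t\<in>T. card (F - (t <# F)))"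
      using greedy_tiling[OF F(1) T K(2) \<epsilon>(1) \<epsilon>1 V, of \<sigma>] unfolding T'_def by blast
    define V' where "V' = V - covered \<sigma> P"
    have cov: "covered \<sigma> P \<subseteq> V" by (rule tiling_covered_subset[OF tilP])
    have finV': "finite V'" using V by (simp add: V'_def)
    have cardV': "real (card V') = real (card V) - real (card (covered \<sigma> P))"
      unfolding V'_def using cov V by (simp add: card_Diff_subset finite_subset card_mono of_nat_diff)
    have "real (card (good_points \<sigma> T' V)) = real (card V) - real (card (V - good_points \<sigma> T' V))"
    proof -
      have "good_points \<sigma> T' V \<subseteq> V" by (auto simp: good_points_def)
      then show ?thesis using V by (simp add: card_Diff_subset finite_subset card_mono of_nat_diff)
    qed
    moreover have "\<delta>' * real (card V) \<le> 1/2 * real (card V)"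
      using \<delta>' by (intro mult_right_mono) auto
    ultimately have "1/2 * real (card V) \<le> real (card (good_points \<sigma> T' V))" using good by linarith
    then have "\<epsilon> * (1/2 * real (card V)) \<le> \<epsilon> * real (card (good_points \<sigma> T' V))"
      using \<epsilon> by (intro mult_left_mono) auto
    then have small: "real (card V') \<le> (1 - \<epsilon>/2) * real (card V)"
      using P1 cardV' by (simp add: algebra_simps)
    show ?thesis
    proof (cases "real (card V') \<le> \<eta> * real (card V)")
      case True
      have "tiling \<sigma> K \<F> \<epsilon> (V - covered \<sigma> P) {}" by (simp add: tiling_def)
      from tiling_Un[OF tilP this] have "tiling \<sigma> K (insert F \<F>) \<epsilon> V P" by simp
      then show ?thesis using True unfolding V'_def by blast
    next
      case False
      have "real (card P) * real (card F) \<le> 2 * real (card V)"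
      proof -
        have "real (card P) * (1/2 * real (card F)) \<le> real (card P) * ((1 - \<epsilon>) * real (card F))"
          using \<epsilon> by (intro mult_left_mono mult_right_mono) auto
        also have "\<dots> \<le> real (card V)" using P2 cov V card_mono by (meson of_nat_mono order_trans)
        finally show ?thesis by simp
      qed
      moreover have "real (\<Sum>t\<in>T. card (F - (t <# F))) \<le> real (card T) * (b * real (card F))"
      proof -
        have "real (card (F - (t <# F))) \<le> b * real (card F)" if "t \<in> T" for t
          using F(3)[OF that] finF by (simp add: boundary_ratio_def divide_le_eq card_gt_0_iff)
        then have "(\<Sum>t\<in>T. real (card (F - (t <# F)))) \<le> (\<Sum>t\<in>T. b * real (card F))"
          by (rule sum_mono)
        then show ?thesis by simp
      qed
      ultimately have "real (card P * (\<Sum>t\<in>T. card (F - (t <# F)))) \<le>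
          (real (card T) * b) * (2 * real (card V))"
      proof -
        have "real (card P * (\<Sum>t\<in>T. card (F - (t <# F)))) \<le> real (card P) * (real (card T) * (b * real (card F)))"
          using \<open>real (\<Sum>t\<in>T. card (F - (t <# F))) \<le> real (card T) * (b * real (card F))\<close>
          by (simp add: mult_left_mono)
        also have "\<dots> = (real (card T) * b) * (real (card P) * real (card F))" by simp
        also have "\<dots> \<le> (real (card T) * b) * (2 * real (card V))"
          using \<open>real (card P) * real (card F) \<le> 2 * real (card V)\<close> b by (intro mult_left_mono) auto
        finally show ?thesis .
      qed
      also have "\<dots> \<le> (\<delta> * \<eta> / 4) * (2 * real (card V))"
      proof (rule mult_right_mono)
        have "real (card T) * b = (\<delta> * \<eta> / 4) * (real (card T) / (real (card T) + 1))"
          by (simp add: b_def)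
        also have "\<dots> \<le> (\<delta> * \<eta> / 4) * 1"
          using \<delta> \<eta> by (intro mult_left_mono) auto
        finally show "real (card T) * b \<le> \<delta> * \<eta> / 4" by simp
      qed simp
      finally have S: "real (card P * (\<Sum>t\<in>T. card (F - (t <# F)))) \<le> \<delta> * \<eta> / 2 * real (card V)"
        by simp
      have "real (card (V' - good_points \<sigma> T V')) \<le>
          real (card (V - good_points \<sigma> T' V)) + real (card P * (\<Sum>t\<in>T. card (F - (t <# F))))"
        using P3 unfolding V'_def by (simp only: of_nat_le_iff flip: of_nat_add)
      also have "\<dots> \<le> \<delta>' * real (card V) + \<delta> * \<eta> / 2 * real (card V)"
        by (rule add_mono[OF good S])
      also have "\<dots> \<le> \<delta> * \<eta> / 2 * real (card V) + \<delta> * \<eta> / 2 * real (card V)"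
        using \<delta>' by (intro add_right_mono mult_right_mono) auto
      also have "\<dots> = \<delta> * (\<eta> * real (card V))" by (simp add: algebra_simps)
      also have "\<dots> \<le> \<delta> * real (card V')" using False \<delta> by (intro mult_left_mono) auto
      finally obtain P' where P': "tiling \<sigma> K \<F> \<epsilon> V' P'"
        "real (card (V' - covered \<sigma> P')) \<le> (1 - \<epsilon>/2) ^ k * real (card V')"
        using IH[OF finV'] by blast
      have "V - covered \<sigma> (P \<union> P') = V' - covered \<sigma> P'" by (auto simp: V'_def covered_def)
      moreover have "(1 - \<epsilon>/2) ^ k * real (card V') \<le> (1 - \<epsilon>/2) ^ k * ((1 - \<epsilon>/2) * real (card V))"
        using small \<epsilon> by (intro mult_left_mono) auto
      ultimately have "real (card (V - covered \<sigma> (P \<union> P'))) \<le> \<eta> * real (card V)"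
        using P'(2) by (simp add: \<eta>_def algebra_simps)
      moreover have "tiling \<sigma> K (insert F \<F>) \<epsilon> V (P \<union> P')"
        using tiling_Un[OF tilP P'(1)[unfolded V'_def]] by simp
      ultimately show ?thesis by blast
    qed
  qed
  have T': "finite T'" "T' \<subseteq> carrier G" using finF T K by (auto simp: T'_def)
  show ?case
    by (rule exI[of _ "insert F \<F>"], rule exI[of _ T'], rule exI[of _ \<delta>'])
      (use \<F> F T' \<delta>'(1) main in \<open>auto simp flip: \<eta>_def simp del: power_Suc\<close>)
qed

text \<open>\<open>\<F>\<close>, \<open>T\<close> and \<open>\<delta>\<close> are fixed before
  \<open>V\<close> and \<open>\<sigma>\<close>. This uniformity allows one choice to serve all
  sufficiently invariant sets and all late maps of a sofic approximation.\<close>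

theorem quasi_tiling:
  fixes K :: "'a set"
  assumes freq: "frequently_invariant Q"
    and K: "finite K" "K \<subseteq> carrier G" and \<epsilon>: "0 < \<epsilon>" "\<epsilon> \<le> 1/2" and \<eta>: "0 < \<eta>"
  obtains \<F> T \<delta> where "finite \<F>" "\<F> \<subseteq> fin_subsets G" "\<And>F. F \<in> \<F> \<Longrightarrow> Q F"
    "finite T" "T \<subseteq> carrier G" "0 < \<delta>"
    "\<And>(V::'v set) \<sigma>. finite V \<Longrightarrow> real (card (V - good_points \<sigma> T V)) \<le> \<delta> * real (card V) \<Longrightarrow>
      \<exists>P. tiling \<sigma> K \<F> \<epsilon> V P \<and> real (card (V - covered \<sigma> P)) \<le> \<eta> * real (card V)"
proof -
  obtain k where k: "(1 - \<epsilon>/2) ^ k < \<eta>"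
    using real_arch_pow_inv[OF \<eta>, of "1 - \<epsilon>/2"] \<epsilon> by auto
  obtain \<F> T \<delta> where *: "finite \<F> \<and> \<F> \<subseteq> fin_subsets G \<and> (\<forall>F\<in>\<F>. Q F) \<and> finite T \<and> T \<subseteq> carrier G \<and> 0 < \<delta> \<and>
    (\<forall>(V::'v set) \<sigma>. finite V \<longrightarrow> real (card (V - good_points \<sigma> T V)) \<le> \<delta> * real (card V) \<longrightarrow>
      (\<exists>P. tiling \<sigma> K \<F> \<epsilon> V P \<and> real (card (V - covered \<sigma> P)) \<le> (1 - \<epsilon>/2) ^ k * real (card V)))"
    using quasi_tiling_power[OF freq K \<epsilon>, where k = k and ?'v = 'v] by (elim exE)
  from * have **: "\<exists>P. tiling \<sigma> K \<F> \<epsilon> V P \<and> real (card (V - covered \<sigma> P)) \<le> (1 - \<epsilon>/2) ^ k * real (card V)"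
    if "finite V" "real (card (V - good_points \<sigma> T V)) \<le> \<delta> * real (card V)" for V :: "'v set" and \<sigma>
    using that by (elim conjE) simp
  have "\<exists>P. tiling \<sigma> K \<F> \<epsilon> V P \<and> real (card (V - covered \<sigma> P)) \<le> \<eta> * real (card V)"
    if "finite V" "real (card (V - good_points \<sigma> T V)) \<le> \<delta> * real (card V)" for V :: "'v set" and \<sigma>
  proof -
    have "(1 - \<epsilon>/2) ^ k * real (card V) \<le> \<eta> * real (card V)" using k by (intro mult_right_mono) auto
    then show ?thesis using **[OF that] by (meson order_trans)
  qed
  with * show ?thesis by (intro that[of \<F> T \<delta>]) auto
qed

end

section \<open>The Ornstein--Weiss lemma\<close>

context group
begin

lemma boundary_ratio_nonneg: "0 \<le> boundary_ratio G t F"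
  by (simp add: boundary_ratio_def)

lemma boundary_ratio_le_iff:
  assumes "F \<in> fin_subsets G"
  shows "boundary_ratio G t F \<le> b \<longleftrightarrow> real (card (F - (t <# F))) \<le> b * real (card F)"
  using assms by (simp add: boundary_ratio_def divide_le_eq card_gt_0_iff fin_subsets_def)

lemma eventually_invariance_filterI:
  assumes "finite T" "T \<subseteq> carrier G" "0 < b"
    and P: "\<And>F. F \<in> fin_subsets G \<Longrightarrow> (\<And>t. t \<in> T \<Longrightarrow> boundary_ratio G t F \<le> b) \<Longrightarrow> P F"
  shows "eventually P (invariance_filter G)"
proof -
  let ?N = "\<lambda>t. inf (principal (fin_subsets G)) (filtercomap (boundary_ratio G t) (nhds 0))"
  have ev: "eventually (\<lambda>F. F \<in> fin_subsets G \<and> boundary_ratio G t F \<le> b) (invariance_filter G)"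
    if "t \<in> carrier G" for t
  proof -
    have "eventually (\<lambda>r. r < b) (nhds (0::real))"
      using \<open>0 < b\<close> by (rule eventually_nhds_in_open[of "{..<b}", simplified])
    then have "eventually (\<lambda>F. boundary_ratio G t F \<le> b) (filtercomap (boundary_ratio G t) (nhds 0))"
      by (auto simp: eventually_filtercomap intro!: exI[of _ "\<lambda>r. r < b"])
    then have "eventually (\<lambda>F. F \<in> fin_subsets G \<and> boundary_ratio G t F \<le> b) (?N t)"
      unfolding eventually_inf_principal inf_commute[of "principal _"]
      by (rule eventually_mono) simp
    then show ?thesis unfolding invariance_filter_def by (rule eventually_INF1[OF that])
  qed
  have "eventually (\<lambda>F. F \<in> fin_subsets G) (invariance_filter G)"
    using ev[OF one_closed] by (rule eventually_mono) simp
  moreover have "eventually (\<lambda>F. \<forall>t\<in>T. boundary_ratio G t F \<le> b) (invariance_filter G)"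
  proof (intro eventually_ball_finite ballI assms(1))
    fix t assume "t \<in> T"
    then have "t \<in> carrier G" using assms(2) by blast
    from ev[OF this] show "eventually (\<lambda>F. boundary_ratio G t F \<le> b) (invariance_filter G)"
      by (rule eventually_mono) simp
  qed
  ultimately show ?thesis by eventually_elim (use P in blast)
qed

text \<open>An eventual statement along an infimum of filters involves only finitely many of them,
  and the least of their bounds serves for all.\<close>

lemma eventually_invariance_filterE:
  assumes "eventually P (invariance_filter G)"
  obtains T b where "finite T" "T \<subseteq> carrier G" "0 < b"
    and "\<And>F. F \<in> fin_subsets G \<Longrightarrow> (\<And>t. t \<in> T \<Longrightarrow> boundary_ratio G t F \<le> b) \<Longrightarrow> P F"
proof -
  let ?N = "\<lambda>t. inf (principal (fin_subsets G)) (filtercomap (boundary_ratio G t) (nhds 0))"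
  obtain T where T: "T \<subseteq> carrier G" "finite T" and "eventually P (INF t\<in>T. ?N t)"
    using eventually_INF[THEN iffD1, OF assms[unfolded invariance_filter_def]] by blast
  then obtain Q where *: "(\<forall>t\<in>T. eventually (Q t) (?N t)) \<and> (\<forall>F. (\<forall>t\<in>T. Q t F) \<longrightarrow> P F)"
    unfolding eventually_INF_finite[OF T(2)] by (elim exE)
  have Q: "eventually (Q t) (?N t)" if "t \<in> T" for t
    using bspec[OF conjunct1[OF *] that] .
  have QP: "P F" if "\<And>t. t \<in> T \<Longrightarrow> Q t F" for F
    using mp[OF spec[OF conjunct2[OF *], of F]] that by blast
  have "\<exists>b>0. \<forall>F\<in>fin_subsets G. boundary_ratio G t F \<le> b \<longrightarrow> Q t F" if "t \<in> T" for t
  proof -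
    have "eventually (\<lambda>F. F \<in> fin_subsets G \<longrightarrow> Q t F) (filtercomap (boundary_ratio G t) (nhds 0))"
      using Q[OF that] by (simp add: eventually_inf_principal inf_commute[of "principal _"])
    then obtain R where R: "eventually R (nhds 0)"
      and RQ: "\<And>F. R (boundary_ratio G t F) \<Longrightarrow> F \<in> fin_subsets G \<Longrightarrow> Q t F"
      unfolding eventually_filtercomap by blast
    obtain b where b: "0 < b" "\<And>x. dist x 0 < b \<Longrightarrow> R x"
      using R unfolding eventually_nhds_metric by blast
    have "Q t F" if "F \<in> fin_subsets G" "boundary_ratio G t F \<le> b/2" for F
      using that b boundary_ratio_nonneg[of t F] by (intro RQ) (auto simp: dist_real_def)
    then show ?thesis using b(1) by (intro exI[of _ "b/2"]) auto
  qed
  then obtain b where b: "\<And>t. t \<in> T \<Longrightarrow> 0 < b t"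
    and bQ: "\<And>t F. t \<in> T \<Longrightarrow> F \<in> fin_subsets G \<Longrightarrow> boundary_ratio G t F \<le> b t \<Longrightarrow> Q t F"
    by metis
  define b0 where "b0 = Min (insert 1 (b ` T))"
  have b0: "0 < b0" "\<And>t. t \<in> T \<Longrightarrow> b0 \<le> b t" using T(2) b by (auto simp: b0_def)
  show ?thesis
  proof (rule that[OF T(2,1) b0(1)])
    fix F assume F: "F \<in> fin_subsets G" "\<And>t. t \<in> T \<Longrightarrow> boundary_ratio G t F \<le> b0"
    show "P F" using bQ[OF _ F(1)] F(2) b0(2) by (intro QP) (meson order_trans)
  qed
qed

text \<open>A Folner sequence enters every set of the filter. Amenability acts in what follows only
  through this statement, which makes limits along the filter unique.\<close>

lemma invariance_filter_neq_bot:
  assumes "amenable G"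
  shows "invariance_filter G \<noteq> bot"
proof
  assume "invariance_filter G = bot"
  then have "eventually (\<lambda>_. False) (invariance_filter G)" by simp
  then obtain T b where T: "finite T" "T \<subseteq> carrier G" "0 < b"
    and no: "\<And>F. F \<in> fin_subsets G \<Longrightarrow> (\<And>t. t \<in> T \<Longrightarrow> boundary_ratio G t F \<le> b) \<Longrightarrow> False"
    by (rule eventually_invariance_filterE[of "\<lambda>_. False"]) blast
  obtain Fs where Fs: "\<And>k. Fs k \<in> fin_subsets G"
    "\<And>t. t \<in> carrier G \<Longrightarrow> (\<lambda>k. boundary_ratio G t (Fs k)) \<longlonglongrightarrow> 0"
    using assms by (auto simp: amenable_def folner_sequence_def)
  have "eventually (\<lambda>k. \<forall>t\<in>T. boundary_ratio G t (Fs k) < b) sequentially"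
    using T Fs(2) by (intro eventually_ball_finite ballI order_tendstoD(2)[where y = 0]) auto
  then obtain k where "\<forall>t\<in>T. boundary_ratio G t (Fs k) < b"
    using eventually_happens'[OF sequentially_bot] by blast
  then show False using no[OF Fs(1)[of k]] by fastforce
qed

lemma not_frequently_invariant:
  assumes "\<not> frequently_invariant Q"
  shows "eventually (\<lambda>F. F \<in> fin_subsets G \<and> \<not> Q F) (invariance_filter G)"
proof -
  obtain T b where T: "finite T" "T \<subseteq> carrier G" "0 < b"
    and no: "\<not> (\<exists>F\<in>fin_subsets G. Q F \<and> (\<forall>t\<in>T. boundary_ratio G t F \<le> b))"
    using assms unfolding frequently_invariant_def by blast
  show ?thesis
    by (rule eventually_invariance_filterI[OF T]) (use no in blast)
qed

lemma frequently_invariantI: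
  assumes "invariance_filter G \<noteq> bot" and "eventually Q (invariance_filter G)"
  shows "frequently_invariant Q"
proof (rule ccontr)
  assume "\<not> ?thesis"
  from eventually_conj[OF not_frequently_invariant[OF this] assms(2)]
  have "eventually (\<lambda>_. False) (invariance_filter G)" by (rule eventually_mono) auto
  then show False using assms(1) by (simp add: trivial_limit_def)
qed

text \<open>Left multiplication is a free action, so \<open>v \<in> V\<close> is bad only if some
  \<open>t \<otimes> v\<close> leaves \<open>V\<close>, that is, if \<open>v\<close> is outside
  \<open>inv t <# V\<close>.\<close>

lemma card_diff_good_points_mult:
  assumes "V \<in> fin_subsets G" and T: "finite T" "T \<subseteq> carrier G"
  shows "card (V - good_points (\<otimes>) T V) \<le> (\<Sum>t\<in>T. card (V - (inv t <# V)))"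
proof -
  have V: "finite V" "V \<subseteq> carrier G" using assms by (auto simp: fin_subsets_def)
  have "V - good_points (\<otimes>) T V \<subseteq> (\<Union>t\<in>T. V - (inv t <# V))"
  proof
    fix v assume v: "v \<in> V - good_points (\<otimes>) T V"
    then have vc: "v \<in> carrier G" using V by auto
    have "\<exists>t\<in>T. t \<otimes> v \<notin> V"
      using v T vc by (force simp: good_points_def m_assoc subset_iff)
    then obtain t where t: "t \<in> T" "t \<otimes> v \<notin> V" by blast
    have "v \<notin> inv t <# V"
    proof
      assume "v \<in> inv t <# V"
      then obtain w where w: "w \<in> V" "v = inv t \<otimes> w" by (auto simp: l_coset_def)
      then have "t \<otimes> v = w" using t T V by (auto simp: m_assoc[symmetric] subset_iff)
      then show False using w t by simp
    qed
    then show "v \<in> (\<Union>t\<in>T. V - (inv t <# V))" using t v by blast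
  qed
  then have "card (V - good_points (\<otimes>) T V) \<le> card (\<Union>t\<in>T. V - (inv t <# V))"
    using V T by (intro card_mono) auto
  also have "\<dots> \<le> (\<Sum>t\<in>T. card (V - (inv t <# V)))" by (rule card_UN_le[OF T(1)])
  finally show ?thesis .
qed

text \<open>The limit is the infimum of the \<open>a\<close> for which
  \<open>h F \<le> a * card F\<close> holds for arbitrarily invariant \<open>F\<close>. Below the
  infimum, failure of this condition is already the eventual lower bound. Above it, an invariant
  \<open>V\<close> is quasi-tiled by sets with \<open>h F \<le> a * card F\<close>: a trimmed tile
  costs no more than its shape by monotonicity, and each uncovered point costs
  \<open>h {\<one>}\<close>.\<close>

lemma ornstein_weiss:
  fixes h :: "'a set \<Rightarrow> real"
  assumes nb: "invariance_filter G \<noteq> bot"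
    and nonneg: "\<And>F. F \<in> fin_subsets G \<Longrightarrow> 0 \<le> h F"
    and sub: "\<And>J B. finite J \<Longrightarrow> J \<subseteq> carrier G \<times> fin_subsets G \<Longrightarrow>
                B \<subseteq> (\<Union>(c,E)\<in>J. (\<lambda>f. f \<otimes> c) ` E) \<Longrightarrow> h B \<le> (\<Sum>(c,E)\<in>J. h E)"
  obtains L where "0 \<le> L" "((\<lambda>F. h F / real (card F)) \<longlongrightarrow> L) (invariance_filter G)"
proof -
  define C where "C = h {\<one>}"
  have one: "{\<one>} \<in> fin_subsets G" by (simp add: fin_subsets_def)
  have C: "0 \<le> C" unfolding C_def by (rule nonneg[OF one])
  have mono: "h E \<le> h F" if "E \<subseteq> F" "F \<in> fin_subsets G" for E F
  proof -
    have "(\<lambda>f. f \<otimes> \<one>) ` F = F" using that by (force simp: fin_subsets_def)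
    then show ?thesis using sub[of "{(\<one>,F)}" E] that by simp
  qed
  have hC: "h F \<le> C * real (card F)" if F: "F \<in> fin_subsets G" for F
  proof -
    have "h F \<le> (\<Sum>(c,E)\<in>F \<times> {{\<one>}}. h E)"
      using F one by (intro sub) (auto simp: fin_subsets_def subset_iff)
    also have "\<dots> = real (card F) * C" by (simp add: C_def flip: sum.cartesian_product)
    finally show ?thesis by (simp add: mult.commute)
  qed
  have upper: "eventually (\<lambda>V. h V \<le> (a + \<zeta>) * real (card V)) (invariance_filter G)"
    if a: "0 \<le> a" "frequently_invariant (\<lambda>F. h F \<le> a * real (card F))" and \<zeta>: "0 < \<zeta>" for a \<zeta>
  proof -
    obtain \<epsilon> where \<epsilon>: "0 < \<epsilon>" "\<epsilon> \<le> 1/2" and \<epsilon>\<zeta>: "a / (1 - \<epsilon>) \<le> a + \<zeta>/2"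
      using divide_one_minus_le[OF a(1), of "\<zeta>/2"] \<zeta> by auto
    \<comment> \<open>The uncovered points cost at most \<open>C * \<eta> * card V\<close>, which
      this choice bounds by \<open>\<zeta>/2 * card V\<close>; the \<open>+ 1\<close> guards against
      \<open>C = 0\<close>.\<close>
    define \<eta> where "\<eta> = \<zeta> / (2 * (C + 1))"
    have \<eta>: "0 < \<eta>" using \<zeta> C by (simp add: \<eta>_def)
    have K: "finite {}" "{} \<subseteq> carrier G" by auto
    obtain \<F> T \<delta> where \<F>: "finite \<F>" "\<F> \<subseteq> fin_subsets G"
      "\<And>F. F \<in> \<F> \<Longrightarrow> h F \<le> a * real (card F)"
      and T: "finite T" "T \<subseteq> carrier G" and \<delta>: "0 < \<delta>"
      and til: "\<And>(V::'a set) \<sigma>. finite V \<Longrightarrow> real (card (V - good_points \<sigma> T V)) \<le> \<delta> * real (card V) \<Longrightarrow>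
        \<exists>P. tiling \<sigma> {} \<F> \<epsilon> V P \<and> real (card (V - covered \<sigma> P)) \<le> \<eta> * real (card V)"
      by (rule quasi_tiling[OF a(2) K \<epsilon> \<eta>, where ?'v = 'a]) blast
    have inT: "finite (m_inv G ` T)" "m_inv G ` T \<subseteq> carrier G" using T by auto
    have b: "0 < \<delta> / (real (card T) + 1)" using \<delta> by (simp add: add_nonneg_pos)
    show ?thesis
    proof (rule eventually_invariance_filterI[OF inT b])
      fix V assume V: "V \<in> fin_subsets G"
        and inv: "\<And>t. t \<in> m_inv G ` T \<Longrightarrow> boundary_ratio G t V \<le> \<delta> / (real (card T) + 1)"
      have finV: "finite V" "V \<subseteq> carrier G" using V by (auto simp: fin_subsets_def)
      have "real (card (V - good_points (\<otimes>) T V)) \<le> (\<Sum>t\<in>T. real (card (V - (inv t <# V))))"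
        using card_diff_good_points_mult[OF V T] by (simp flip: of_nat_sum)
      also have "\<dots> \<le> (\<Sum>t\<in>T. \<delta> / (real (card T) + 1) * real (card V))"
        using inv boundary_ratio_le_iff[OF V] by (intro sum_mono) blast
      also have "\<dots> = (real (card T) / (real (card T) + 1)) * (\<delta> * real (card V))" by simp
      also have "\<dots> \<le> 1 * (\<delta> * real (card V))" using \<delta> by (intro mult_right_mono) auto
      finally obtain P where P: "tiling (\<otimes>) {} \<F> \<epsilon> V P"
        and unc: "real (card (V - covered (\<otimes>) P)) \<le> \<eta> * real (card V)"
        using til[OF finV(1), of "(\<otimes>)"] by auto
      define U where "U = V - covered (\<otimes>) P"
      have finU: "finite U" using finV by (simp add: U_def)
      have finP: "finite P" using P by (simp add: tiling_def)
      have Pp: "fst p \<in> carrier G" "snd p \<in> fin_subsets G"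
        "\<exists>F\<in>\<F>. snd p \<subseteq> F \<and> (1 - \<epsilon>) * real (card F) \<le> real (card (snd p))" if p: "p \<in> P" for p
      proof -
        have *: "fst p \<in> V" "snd p \<noteq> {}"
          "\<exists>F\<in>\<F>. snd p \<subseteq> F \<and> (1 - \<epsilon>) * real (card F) \<le> real (card (snd p))"
          using P p by (auto simp: tiling_def)
        then show "fst p \<in> carrier G"
          "\<exists>F\<in>\<F>. snd p \<subseteq> F \<and> (1 - \<epsilon>) * real (card F) \<le> real (card (snd p))"
          using finV by auto
        from * obtain F where "F \<in> fin_subsets G" "snd p \<subseteq> F" using \<F>(2) by blast
        then show "snd p \<in> fin_subsets G" using *(2) by (auto simp: fin_subsets_def intro: finite_subset)
      qed
      have hp: "h (snd p) \<le> (a / (1 - \<epsilon>)) * real (card (snd p))" if p: "p \<in> P" for p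
      proof -
        obtain F where F: "F \<in> \<F>" "snd p \<subseteq> F" "(1 - \<epsilon>) * real (card F) \<le> real (card (snd p))"
          using Pp(3)[OF p] by blast
        have "h (snd p) \<le> a * real (card F)" using mono[OF F(2)] \<F> F(1) by force
        also have "\<dots> \<le> a * (real (card (snd p)) / (1 - \<epsilon>))"
          using F(3) a(1) \<epsilon> by (intro mult_left_mono) (auto simp: pos_le_divide_eq mult.commute)
        finally show ?thesis by simp
      qed
      \<comment> \<open>Each uncovered point \<open>v\<close> becomes a tile of its own, with shape
        \<open>{\<one>}\<close> and centre \<open>v\<close>.\<close>
      have "h V \<le> (\<Sum>(c,E)\<in>P \<union> U \<times> {{\<one>}}. h E)"
      proof (rule sub)
        show "finite (P \<union> U \<times> {{\<one>}})" using finP finU by simp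
        show "P \<union> U \<times> {{\<one>}} \<subseteq> carrier G \<times> fin_subsets G"
          using Pp one finV by (auto simp: U_def)
        show "V \<subseteq> (\<Union>(c,E)\<in>P \<union> U \<times> {{\<one>}}. (\<lambda>f. f \<otimes> c) ` E)"
        proof
          fix v assume v: "v \<in> V"
          show "v \<in> (\<Union>(c,E)\<in>P \<union> U \<times> {{\<one>}}. (\<lambda>f. f \<otimes> c) ` E)"
          proof (cases "v \<in> U")
            case True
            moreover have "v = \<one> \<otimes> v" using v finV by auto
            ultimately show ?thesis by (intro UN_I[of "(v,{\<one>})"]) auto
          next
            case False
            then obtain p where "p \<in> P" "v \<in> tile_image (\<otimes>) p" using v by (auto simp: U_def covered_def)
            then show ?thesis by (auto simp: tile_image_def split_beta)
          qed
        qed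
      qed
      also have "\<dots> \<le> (\<Sum>(c,E)\<in>P. h E) + (\<Sum>(c,E)\<in>U \<times> {{\<one>}}. h E)"
      proof -
        have "0 \<le> (\<Sum>(c,E)\<in>P \<inter> U \<times> {{\<one>}}. h E)" using C by (intro sum_nonneg) (auto simp: C_def)
        then show ?thesis
          using sum.union_inter[of P "U \<times> {{\<one>}}" "\<lambda>(c,E). h E"] finP finU by simp
      qed
      also have "(\<Sum>(c,E)\<in>U \<times> {{\<one>}}. h E) = C * real (card U)"
        by (simp add: C_def flip: sum.cartesian_product)
      also have "(\<Sum>(c,E)\<in>P. h E) \<le> (\<Sum>p\<in>P. (a / (1 - \<epsilon>)) * real (card (snd p)))"
        using hp by (simp add: split_beta sum_mono)
      also have "\<dots> = (a / (1 - \<epsilon>)) * real (card (covered (\<otimes>) P))"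
      proof -
        have "finite F" if "F \<in> \<F>" for F using \<F>(2) that by (auto simp: fin_subsets_def)
        then show ?thesis using card_covered[OF P] by (simp add: sum_distrib_left)
      qed
      also have "\<dots> \<le> (a + \<zeta>/2) * real (card V)"
      proof (rule mult_mono)
        show "a / (1 - \<epsilon>) \<le> a + \<zeta>/2" by (rule \<epsilon>\<zeta>)
        show "real (card (covered (\<otimes>) P)) \<le> real (card V)"
          using tiling_covered_subset[OF P] finV by (simp add: card_mono)
      qed (use a \<zeta> in auto)
      also have "C * real (card U) \<le> \<zeta>/2 * real (card V)"
      proof -
        have "C * real (card U) \<le> C * (\<eta> * real (card V))"
          using unc C unfolding U_def by (intro mult_left_mono) auto
        also have "\<dots> = (C / (C + 1)) * (\<zeta>/2 * real (card V))" by (simp add: \<eta>_def)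
        also have "\<dots> \<le> 1 * (\<zeta>/2 * real (card V))" using C \<zeta> by (intro mult_right_mono) auto
        finally show ?thesis by simp
      qed
      finally show "h V \<le> (a + \<zeta>) * real (card V)" by (simp add: algebra_simps)
    qed
  qed
  define S where "S = {a. 0 \<le> a \<and> frequently_invariant (\<lambda>F. h F \<le> a * real (card F))}"
  have "C \<in> S"
  proof -
    have "eventually (\<lambda>F. h F \<le> C * real (card F)) (invariance_filter G)"
      by (rule eventually_invariance_filterI[of "{}" 1]) (use hC in auto)
    then show ?thesis using C frequently_invariantI[OF nb] by (simp add: S_def)
  qed
  define L where "L = Inf S"
  have bdd: "bdd_below S" by (rule bdd_belowI[of _ 0]) (simp add: S_def)
  have L: "0 \<le> L" unfolding L_def using \<open>C \<in> S\<close> by (intro cInf_greatest) (auto simp: S_def)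
  have card_pos: "0 < real (card F)" if "F \<in> fin_subsets G" for F
    using that by (simp add: fin_subsets_def card_gt_0_iff)
  have fin: "eventually (\<lambda>F. F \<in> fin_subsets G) (invariance_filter G)"
    by (rule eventually_invariance_filterI[of "{}" 1]) auto
  have "((\<lambda>F. h F / real (card F)) \<longlongrightarrow> L) (invariance_filter G)"
  proof (rule order_tendstoI)
    fix a assume a: "a < L"
    show "eventually (\<lambda>F. a < h F / real (card F)) (invariance_filter G)"
    proof (cases "0 \<le> a")
      case True
      have "a \<notin> S" using a bdd cInf_lower unfolding L_def by fastforce
      then have "\<not> frequently_invariant (\<lambda>F. h F \<le> a * real (card F))" using True by (simp add: S_def)
      from not_frequently_invariant[OF this] show ?thesis
        by (rule eventually_mono) (use card_pos in \<open>auto simp: pos_less_divide_eq\<close>)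
    next
      case False
      show ?thesis using fin
      proof (rule eventually_mono)
        fix F assume "F \<in> fin_subsets G"
        then have "0 \<le> h F / real (card F)" using nonneg by simp
        then show "a < h F / real (card F)" using False by linarith
      qed
    qed
  next
    fix a assume a: "L < a"
    then obtain s where s: "s \<in> S" "s < a" using \<open>C \<in> S\<close> bdd cInf_less_iff unfolding L_def by blast
    then have "eventually (\<lambda>V. h V \<le> (s + (a - s)/2) * real (card V)) (invariance_filter G)"
      by (intro upper) (auto simp: S_def)
    then show "eventually (\<lambda>F. h F / real (card F) < a) (invariance_filter G)"
      using fin
    proof eventually_elim
      case (elim F)
      then have "h F / real (card F) \<le> s + (a - s)/2" using card_pos by (simp add: pos_divide_le_eq)
      also have "\<dots> < a" using s by (simp add: field_simps)
      finally show ?case .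
    qed
  qed
  then show ?thesis using that L by blast
qed

text \<open>The \<open>c i\<close> are chosen one after the other: the next one has to avoid the
  finitely many \<open>inv f \<otimes> a\<close> with \<open>a\<close> in an earlier translate. This
  is where the group has to be infinite.\<close>

lemma disjoint_translates:
  assumes "finite I" and inf: "infinite (carrier G)"
    and E: "\<And>i. i \<in> I \<Longrightarrow> finite (E i) \<and> E i \<subseteq> carrier G"
  shows "\<exists>c. (\<forall>i\<in>I. c i \<in> carrier G) \<and>
     (\<forall>i\<in>I. \<forall>j\<in>I. i \<noteq> j \<longrightarrow> (\<lambda>f. f \<otimes> c i) ` E i \<inter> (\<lambda>f. f \<otimes> c j) ` E j = {})"
  using assms(1) E
proof (induction I rule: finite_induct)
  case (insert i I)
  then obtain c where c: "\<forall>i\<in>I. c i \<in> carrier G"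
    "\<forall>i\<in>I. \<forall>j\<in>I. i \<noteq> j \<longrightarrow> (\<lambda>f. f \<otimes> c i) ` E i \<inter> (\<lambda>f. f \<otimes> c j) ` E j = {}"
    by auto
  define A where "A = (\<Union>j\<in>I. (\<lambda>f. f \<otimes> c j) ` E j)"
  define B where "B = (\<lambda>(f,a). inv f \<otimes> a) ` (E i \<times> A)"
  have "finite B" using insert.hyps insert.prems by (auto simp: A_def B_def)
  then obtain g where g: "g \<in> carrier G" "g \<notin> B" using inf by (meson finite_subset subsetI)
  have "(\<lambda>f. f \<otimes> g) ` E i \<inter> A = {}"
  proof (rule ccontr)
    assume "\<not> ?thesis"
    then obtain f where f: "f \<in> E i" "f \<otimes> g \<in> A" by auto
    then have fc: "f \<in> carrier G" using insert.prems by auto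
    have "g = inv f \<otimes> (f \<otimes> g)" using fc g by (simp add: m_assoc[symmetric])
    then have "g \<in> B" unfolding B_def using f by force
    then show False using g by simp
  qed
  then have "(\<lambda>f. f \<otimes> g) ` E i \<inter> (\<lambda>f. f \<otimes> c j) ` E j = {}" if "j \<in> I" for j
    using that by (auto simp: A_def)
  then show ?case using c g insert.hyps
    by (intro exI[of _ "c(i := g)"]) (auto simp: Int_commute)
qed simp

text \<open>Left and right multiplication commute, so the left boundary of a translate is the
  translate of the left boundary, and a disjoint union is as invariant as its pieces.\<close>

lemma union_translates:
  assumes "finite I" and E: "\<And>i. i \<in> I \<Longrightarrow> finite (E i) \<and> E i \<subseteq> carrier G"
    and c: "\<And>i. i \<in> I \<Longrightarrow> c i \<in> carrier G"
    and disj: "\<And>i j. i \<in> I \<Longrightarrow> j \<in> I \<Longrightarrow> i \<noteq> j \<Longrightarrow> (\<lambda>f. f \<otimes> c i) ` E i \<inter> (\<lambda>f. f \<otimes> c j) ` E j = {}"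
  defines "F \<equiv> (\<Union>i\<in>I. (\<lambda>f. f \<otimes> c i) ` E i)"
  shows "card F = (\<Sum>i\<in>I. card (E i))"
    and "t \<in> carrier G \<Longrightarrow> card (F - (t <# F)) \<le> (\<Sum>i\<in>I. card (E i - (t <# E i)))"
proof -
  have "card F = (\<Sum>i\<in>I. card ((\<lambda>f. f \<otimes> c i) ` E i))"
    unfolding F_def using assms by (intro card_UN_disjoint) auto
  also have "\<dots> = (\<Sum>i\<in>I. card (E i))"
  proof (intro sum.cong refl card_image inj_onI)
    fix i f f' assume "i \<in> I" "f \<in> E i" "f' \<in> E i" "f \<otimes> c i = f' \<otimes> c i"
    then show "f = f'" using E[of i] c[of i] right_cancel by (metis subsetD)
  qed
  finally show "card F = (\<Sum>i\<in>I. card (E i))" .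
  assume t: "t \<in> carrier G"
  have "F - (t <# F) \<subseteq> (\<Union>i\<in>I. (\<lambda>f. f \<otimes> c i) ` (E i - (t <# E i)))"
  proof
    fix v assume v: "v \<in> F - (t <# F)"
    then obtain i f where i: "i \<in> I" "f \<in> E i" "v = f \<otimes> c i" by (auto simp: F_def)
    have "f \<notin> t <# E i"
    proof
      assume "f \<in> t <# E i"
      then obtain f' where f': "f' \<in> E i" "f = t \<otimes> f'" by (auto simp: l_coset_def)
      then have "v = t \<otimes> (f' \<otimes> c i)" using i E c t by (metis m_assoc subsetD)
      moreover have "f' \<otimes> c i \<in> F" using f' i by (auto simp: F_def)
      ultimately show False using v by (auto simp: l_coset_def)
    qed
    then show "v \<in> (\<Union>i\<in>I. (\<lambda>f. f \<otimes> c i) ` (E i - (t <# E i)))" using i by blast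
  qed
  then have "card (F - (t <# F)) \<le> card (\<Union>i\<in>I. (\<lambda>f. f \<otimes> c i) ` (E i - (t <# E i)))"
    using assms by (intro card_mono) auto
  also have "\<dots> \<le> (\<Sum>i\<in>I. card ((\<lambda>f. f \<otimes> c i) ` (E i - (t <# E i))))"
    by (rule card_UN_le[OF assms(1)])
  also have "\<dots> \<le> (\<Sum>i\<in>I. card (E i - (t <# E i)))"
    using E by (intro sum_mono card_image_le) auto
  finally show "card (F - (t <# F)) \<le> (\<Sum>i\<in>I. card (E i - (t <# E i)))" .
qed

end

section \<open>Powers of a system\<close>

context fibred_system
begin

definition rate :: "'a set set \<Rightarrow> real" where
  "rate \<alpha> = Lim (invariance_filter G) (\<lambda>F. dyn_dim \<alpha> F / real (card F))"

lemma rate: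
  assumes "invariance_filter G \<noteq> bot" and "topspace X \<noteq> {}" and "finite_open_cover X \<alpha>"
  shows "((\<lambda>F. dyn_dim \<alpha> F / real (card F)) \<longlongrightarrow> rate \<alpha>) (invariance_filter G)" and "0 \<le> rate \<alpha>"
proof -
  obtain L where L: "0 \<le> L" "((\<lambda>F. dyn_dim \<alpha> F / real (card F)) \<longlongrightarrow> L) (invariance_filter G)"
  proof (rule ornstein_weiss[OF assms(1), of "dyn_dim \<alpha>"])
    show "0 \<le> dyn_dim \<alpha> F" if "F \<in> fin_subsets G" for F
      using dyn_dim_nonneg_eq(2)[OF assms(2) that assms(3)] .
    show "dyn_dim \<alpha> B \<le> (\<Sum>(c,E)\<in>J. dyn_dim \<alpha> E)"
      if "finite J" "J \<subseteq> carrier G \<times> fin_subsets G" "B \<subseteq> (\<Union>(c,E)\<in>J. (\<lambda>f. f \<otimes> c) ` E)" for J B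
      using dyn_dim_le_sum[OF assms(2,3) that] .
  qed
  moreover have "rate \<alpha> = L" unfolding rate_def using tendsto_Lim[OF _ L(2)] assms(1) by simp
  ultimately show "((\<lambda>F. dyn_dim \<alpha> F / real (card F)) \<longlongrightarrow> rate \<alpha>) (invariance_filter G)" "0 \<le> rate \<alpha>"
    by auto
qed

lemma rate_le_dyn_dim:
  assumes "invariance_filter G \<noteq> bot" and "topspace X \<noteq> {}" and "finite_open_cover X \<alpha>" and "0 < \<eta>"
  obtains T b where "finite T" "T \<subseteq> carrier G" "0 < b"
    and "\<And>F. F \<in> fin_subsets G \<Longrightarrow> (\<And>t. t \<in> T \<Longrightarrow> boundary_ratio G t F \<le> b) \<Longrightarrow>
           (rate \<alpha> - \<eta>) * real (card F) \<le> dyn_dim \<alpha> F"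
proof -
  have "eventually (\<lambda>F. rate \<alpha> - \<eta> < dyn_dim \<alpha> F / real (card F)) (invariance_filter G)"
    using rate(1)[OF assms(1-3)] assms(4) by (intro order_tendstoD) auto
  then obtain T b where T: "finite T" "T \<subseteq> carrier G" "0 < b"
    and *: "\<And>F. F \<in> fin_subsets G \<Longrightarrow> (\<And>t. t \<in> T \<Longrightarrow> boundary_ratio G t F \<le> b) \<Longrightarrow>
           rate \<alpha> - \<eta> < dyn_dim \<alpha> F / real (card F)"
    by (rule eventually_invariance_filterE) blast
  have "(rate \<alpha> - \<eta>) * real (card F) \<le> dyn_dim \<alpha> F"
    if "F \<in> fin_subsets G" "\<And>t. t \<in> T \<Longrightarrow> boundary_ratio G t F \<le> b" for F
  proof -
    have "0 < real (card F)" using that(1) by (simp add: fin_subsets_def card_gt_0_iff)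
    then show ?thesis using *[OF that] by (simp add: pos_less_divide_eq)
  qed
  then show ?thesis using that T by blast
qed

lemma frequently_dyn_dim_le_rate:
  assumes "invariance_filter G \<noteq> bot" and "topspace X \<noteq> {}" and "finite_open_cover X \<alpha>" and "0 < \<eta>"
  shows "frequently_invariant (\<lambda>F. dyn_dim \<alpha> F \<le> (rate \<alpha> + \<eta>) * real (card F))"
proof (rule frequently_invariantI[OF assms(1)])
  have "eventually (\<lambda>F. dyn_dim \<alpha> F / real (card F) < rate \<alpha> + \<eta>) (invariance_filter G)"
    using rate(1)[OF assms(1-3)] assms(4) by (intro order_tendstoD) auto
  moreover have "eventually (\<lambda>F. F \<in> fin_subsets G) (invariance_filter G)"
    by (rule eventually_invariance_filterI[of "{}" 1]) auto
  ultimately show "eventually (\<lambda>F. dyn_dim \<alpha> F \<le> (rate \<alpha> + \<eta>) * real (card F)) (invariance_filter G)"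
  proof eventually_elim
    case (elim F)
    then have "0 < real (card F)" by (simp add: fin_subsets_def card_gt_0_iff)
    then show ?case using elim by (simp add: pos_divide_less_eq)
  qed
qed

lemma cond_mdim_eq_SUP_rate:
  assumes "invariance_filter G \<noteq> bot" and "topspace X \<noteq> {}"
  shows "cond_mdim G X \<phi> Y \<pi> = (SUP \<alpha>\<in>{\<alpha>. finite_open_cover X \<alpha>}. ereal (rate \<alpha>))"
  unfolding cond_mdim_def
proof (rule SUP_cong[OF refl])
  fix \<alpha> assume "\<alpha> \<in> {\<alpha>. finite_open_cover X \<alpha>}"
  then have \<alpha>: "finite_open_cover X \<alpha>" by simp
  have "eventually (\<lambda>F. F \<in> fin_subsets G) (invariance_filter G)"
    by (rule eventually_invariance_filterI[of "{}" 1]) auto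
  then have "eventually (\<lambda>F. ereal (dyn_dim \<alpha> F / real (card F)) =
      cond_dim X Y \<pi> (dyn_join X \<phi> F \<alpha>) / ereal (real (card F))) (invariance_filter G)"
    by (rule eventually_mono) (simp add: dyn_dim_nonneg_eq[OF assms(2) _ \<alpha>] fin_subsets_def)
  moreover have "((\<lambda>F. ereal (dyn_dim \<alpha> F / real (card F))) \<longlongrightarrow> ereal (rate \<alpha>)) (invariance_filter G)"
    using rate(1)[OF assms \<alpha>] by (rule tendsto_ereal)
  ultimately have "((\<lambda>F. cond_dim X Y \<pi> (dyn_join X \<phi> F \<alpha>) / ereal (real (card F)))
      \<longlongrightarrow> ereal (rate \<alpha>)) (invariance_filter G)"
    by (rule Lim_transform_eventually[rotated])
  then show "Lim (invariance_filter G)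
      (\<lambda>F. cond_dim X Y \<pi> (dyn_join X \<phi> F \<alpha>) / ereal (real (card F))) = ereal (rate \<alpha>)"
    using assms(1) by (intro tendsto_Lim) auto
qed

lemma cond_mdim_empty:
  assumes "invariance_filter G \<noteq> bot" and "topspace X = {}"
  shows "cond_mdim G X \<phi> Y \<pi> = -\<infinity>"
proof -
  have "Lim (invariance_filter G)
      (\<lambda>F. cond_dim X Y \<pi> (dyn_join X \<phi> F \<alpha>) / ereal (real (card F))) = -\<infinity>" for \<alpha>
  proof (rule tendsto_Lim[OF _ tendsto_eventually])
    have "eventually (\<lambda>F. F \<in> fin_subsets G) (invariance_filter G)"
      by (rule eventually_invariance_filterI[of "{}" 1]) auto
    then show "eventually (\<lambda>F. cond_dim X Y \<pi> (dyn_join X \<phi> F \<alpha>) / ereal (real (card F)) = -\<infinity>)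
        (invariance_filter G)"
      by (rule eventually_mono)
        (simp add: cond_dim_empty[OF assms(2)] fin_subsets_def divide_ereal_def card_gt_0_iff)
  qed (use assms in simp)
  moreover have "{\<alpha>. finite_open_cover X \<alpha>} \<noteq> {}" using finite_open_cover_topspace by blast
  ultimately show ?thesis unfolding cond_mdim_def by simp
qed

end

section \<open>Power spaces, power covers and powers of fibred systems\<close>

lemma topspace_power_space: "topspace (power_space n X) = (\<Pi>\<^sub>E j\<in>{1..n}. topspace X)"
  by (simp add: power_space_def)

lemma power_space_empty_iff: "n \<ge> 1 \<Longrightarrow> topspace (power_space n X) = {} \<longleftrightarrow> topspace X = {}"
  by (auto simp: topspace_power_space PiE_eq_empty_iff)

lemma compact_power_space: "compact_space X \<Longrightarrow> compact_space (power_space n X)"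
  by (simp add: power_space_def compact_space_product_topology)

lemma metrizable_power_space: "metrizable_space X \<Longrightarrow> metrizable_space (power_space n X)"
  by (simp add: power_space_def metrizable_space_product_topology)

lemma continuous_map_power_spaceI:
  assumes "\<And>x. x \<in> topspace Z \<Longrightarrow> f x \<in> extensional {1..n}"
    and "\<And>j. j \<in> {1..n} \<Longrightarrow> continuous_map Z X (\<lambda>x. f x j)"
  shows "continuous_map Z (power_space n X) f"
  unfolding power_space_def continuous_map_componentwise using assms by auto

lemma continuous_map_power_space_proj:
  "j \<in> {1..n} \<Longrightarrow> continuous_map (power_space n X) X (\<lambda>x. x j)"
  unfolding power_space_def by (rule continuous_map_product_projection)

lemma finite_open_cover_power_cover:
  assumes "finite_open_cover X \<alpha>"
  shows "finite_open_cover (power_space n X) (power_cover n \<alpha>)"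
proof -
  have \<alpha>: "finite \<alpha>" "\<And>U. U \<in> \<alpha> \<Longrightarrow> openin X U" "\<Union>\<alpha> = topspace X"
    using assms by (auto simp: finite_open_cover_def)
  have "power_cover n \<alpha> \<subseteq> PiE {1..n} ` (PiE {1..n} (\<lambda>_. \<alpha>))"
  proof
    fix W assume "W \<in> power_cover n \<alpha>"
    then obtain U where U: "W = PiE {1..n} U" "U \<in> {1..n} \<rightarrow> \<alpha>" unfolding power_cover_def by blast
    have "W = PiE {1..n} (restrict U {1..n})" unfolding U(1) by (rule PiE_cong) simp
    moreover have "restrict U {1..n} \<in> PiE {1..n} (\<lambda>_. \<alpha>)" using U by auto
    ultimately show "W \<in> PiE {1..n} ` (PiE {1..n} (\<lambda>_. \<alpha>))" by blast
  qed
  then have "finite (power_cover n \<alpha>)"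
    using \<alpha>(1) by (meson finite_PiE finite_atLeastAtMost finite_imageI finite_subset)
  moreover have op: "openin (power_space n X) W" if W: "W \<in> power_cover n \<alpha>" for W
  proof -
    obtain U where U: "W = PiE {1..n} U" "U \<in> {1..n} \<rightarrow> \<alpha>" using W unfolding power_cover_def by blast
    then have "openin X (U j)" if "j \<in> {1..n}" for j using that \<alpha>(2) by blast
    then show ?thesis unfolding U(1) power_space_def by (simp add: openin_PiE)
  qed
  moreover have "\<Union>(power_cover n \<alpha>) = topspace (power_space n X)"
  proof
    show "\<Union>(power_cover n \<alpha>) \<subseteq> topspace (power_space n X)" using op openin_subset by blast
    show "topspace (power_space n X) \<subseteq> \<Union>(power_cover n \<alpha>)"
    proof
      fix x assume x: "x \<in> topspace (power_space n X)"
      then have "\<exists>U\<in>\<alpha>. x j \<in> U" if "j \<in> {1..n}" for j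
        using that \<alpha>(3) by (metis PiE_mem UnionE topspace_power_space)
      then obtain U where "\<And>j. j \<in> {1..n} \<Longrightarrow> U j \<in> \<alpha> \<and> x j \<in> U j" by metis
      then have "U \<in> {1..n} \<rightarrow> \<alpha>" "x \<in> PiE {1..n} U"
        using x by (simp_all add: topspace_power_space PiE_iff)
      moreover from this(1) have "PiE {1..n} U \<in> power_cover n \<alpha>" unfolding power_cover_def by blast
      ultimately have "x \<in> PiE {1..n} U" "PiE {1..n} U \<in> power_cover n \<alpha>" by auto
      then show "x \<in> \<Union>(power_cover n \<alpha>)" by blast
    qed
  qed
  ultimately show ?thesis by (simp add: finite_open_cover_def)
qed

text \<open>A Lebesgue number argument in the maximum metric. It allows arbitrary covers of the
  power to be replaced by power covers.\<close>

lemma power_cover_refines: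
  assumes "compact_space X" and "metrizable_space X" and ne: "topspace X \<noteq> {}"
    and \<beta>: "finite_open_cover (power_space n X) \<beta>"
  obtains \<alpha> where "finite_open_cover X \<alpha>" and "\<And>U. U \<in> {1..n} \<rightarrow> \<alpha> \<Longrightarrow> \<exists>W\<in>\<beta>. PiE {1..n} U \<subseteq> W"
proof -
  obtain M d where Md: "Metric_space M d" and X: "X = Metric_space.mtopology M d"
    using assms(2) by (auto simp: metrizable_space_def)
  interpret Metric_space M d by fact
  have top: "topspace X = M" by (simp add: X)
  let ?Xn = "power_space n X"
  have topn: "topspace ?Xn = (\<Pi>\<^sub>E j\<in>{1..n}. M)" by (simp add: topspace_power_space top)
  have nen: "topspace ?Xn \<noteq> {}" using ne top by (auto simp: topn PiE_eq_empty_iff)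
  have "\<exists>r>0. \<exists>W\<in>\<beta>. (\<Pi>\<^sub>E j\<in>{1..n}. mball (x j) (2 * r)) \<subseteq> W" if x: "x \<in> topspace ?Xn" for x
  proof -
    obtain W where W: "W \<in> \<beta>" "x \<in> W" "openin ?Xn W" using \<beta> x unfolding finite_open_cover_def by blast
    obtain U where U0: "\<forall>j\<in>{1..n}. openin X (U j)" "x \<in> PiE {1..n} U" "PiE {1..n} U \<subseteq> W"
      using bspec[OF iffD1[OF openin_product_topology_alt W(3)[unfolded power_space_def]] W(2)]
      by (elim exE conjE) (rule that)
    then have U: "\<And>j. j \<in> {1..n} \<Longrightarrow> openin X (U j)" "x \<in> PiE {1..n} U" "PiE {1..n} U \<subseteq> W"
      by auto
    have "\<exists>r>0. mball (x j) r \<subseteq> U j" if "j \<in> {1..n}" for j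
      using U(1)[OF that] PiE_mem[OF U(2) that] unfolding X openin_mtopology by blast
    then obtain r where r: "\<And>j. j \<in> {1..n} \<Longrightarrow> 0 < r j \<and> mball (x j) (r j) \<subseteq> U j" by metis
    define s where "s = Min (insert 1 (r ` {1..n})) / 2"
    have "Min (insert 1 (r ` {1..n})) \<le> r j" if "j \<in> {1..n}" for j
      using that by (intro Min_le) auto
    moreover have "0 < Min (insert 1 (r ` {1..n}))" using r by (subst Min_gr_iff) auto
    ultimately have s: "0 < s" "\<And>j. j \<in> {1..n} \<Longrightarrow> 2 * s \<le> r j" by (auto simp: s_def)
    have "mball (x j) (2 * s) \<subseteq> U j" if "j \<in> {1..n}" for j
      using r[OF that] mball_subset_concentric[OF s(2)[OF that]] by blast
    then have "(\<Pi>\<^sub>E j\<in>{1..n}. mball (x j) (2 * s)) \<subseteq> PiE {1..n} U" by (rule PiE_mono)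
    with U(3) have "(\<Pi>\<^sub>E j\<in>{1..n}. mball (x j) (2 * s)) \<subseteq> W" by simp
    then show ?thesis using s W(1) by blast
  qed
  then obtain r where r: "\<And>x. x \<in> topspace ?Xn \<Longrightarrow>
      0 < r x \<and> (\<exists>W\<in>\<beta>. (\<Pi>\<^sub>E j\<in>{1..n}. mball (x j) (2 * r x)) \<subseteq> W)" by metis
  define B where "B x = (\<Pi>\<^sub>E j\<in>{1..n}. mball (x j) (r x))" for x
  have opB: "openin ?Xn (B x)" if "x \<in> topspace ?Xn" for x
    unfolding B_def power_space_def X by (simp add: openin_PiE)
  have inB: "x \<in> B x" if "x \<in> topspace ?Xn" for x
    using that r[OF that] by (auto simp: B_def topn PiE_iff)
  have "compact_space ?Xn" by (rule compact_power_space[OF assms(1)])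
  then have "\<exists>\<C>. finite \<C> \<and> \<C> \<subseteq> B ` topspace ?Xn \<and> topspace ?Xn \<subseteq> \<Union>\<C>"
    unfolding compact_space_alt by (rule allE[of _ "B ` topspace ?Xn"]) (use opB inB in blast)
  then obtain D where D: "finite D" "D \<subseteq> topspace ?Xn" "topspace ?Xn \<subseteq> (\<Union>x\<in>D. B x)"
    by (metis finite_subset_image)
  have "D \<noteq> {}" using D(3) nen by auto
  \<comment> \<open>Two points of a ball of radius \<open>\<rho>/2\<close> are less than
    \<open>\<rho> \<le> r x\<close> apart. So if one of them is within \<open>r x\<close> of
    \<open>x j\<close>, the other is within \<open>2 * r x\<close>.\<close>
  define \<rho> where "\<rho> = Min (r ` D)"
  have \<rho>: "0 < \<rho>" "\<And>x. x \<in> D \<Longrightarrow> \<rho> \<le> r x"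
    using D r \<open>D \<noteq> {}\<close> by (auto simp: \<rho>_def)
  have "\<exists>\<C>. finite \<C> \<and> \<C> \<subseteq> (\<lambda>y. mball y (\<rho>/2)) ` M \<and> topspace X \<subseteq> \<Union>\<C>"
    using assms(1) unfolding compact_space_alt
    by (rule allE[of _ "(\<lambda>y. mball y (\<rho>/2)) ` M"]) (use \<rho>(1) top in \<open>force simp: X\<close>)
  then obtain \<alpha> where \<alpha>: "finite \<alpha>" "\<alpha> \<subseteq> (\<lambda>y. mball y (\<rho>/2)) ` M" "topspace X \<subseteq> \<Union>\<alpha>" by blast
  have "\<forall>U\<in>\<alpha>. openin X U" using \<alpha>(2) X by auto
  moreover from this have "\<Union>\<alpha> \<subseteq> topspace X" using openin_subset by blast
  ultimately have cov: "finite_open_cover X \<alpha>"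
    using \<alpha>(1,3) by (simp add: finite_open_cover_def subset_antisym)
  have "\<exists>W\<in>\<beta>. PiE {1..n} U \<subseteq> W" if U: "U \<in> {1..n} \<rightarrow> \<alpha>" for U
  proof (cases "PiE {1..n} U = {}")
    case True
    have "\<beta> \<noteq> {}" using \<beta> nen unfolding finite_open_cover_def by blast
    then show ?thesis using True by auto
  next
    case False
    then obtain p where p: "p \<in> PiE {1..n} U" by auto
    have "U j \<subseteq> M" if "j \<in> {1..n}" for j using U that \<open>\<Union>\<alpha> \<subseteq> topspace X\<close> top by blast
    then have "p \<in> topspace ?Xn" using p PiE_mono[of "{1..n}" U "\<lambda>_. M"] unfolding topn by blast
    then obtain x where x: "x \<in> D" "p \<in> B x" using D(3) by blast
    then obtain W where W: "W \<in> \<beta>" "(\<Pi>\<^sub>E j\<in>{1..n}. mball (x j) (2 * r x)) \<subseteq> W" using r D(2) by blast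
    have "q \<in> W" if q: "q \<in> PiE {1..n} U" for q
    proof -
      have "q j \<in> mball (x j) (2 * r x)" if j: "j \<in> {1..n}" for j
      proof -
        have "U j \<in> \<alpha>" using U j by blast
        then obtain y where y: "y \<in> M" "U j = mball y (\<rho>/2)" using \<alpha>(2) by auto
        have pq: "p j \<in> mball y (\<rho>/2)" "q j \<in> mball y (\<rho>/2)"
          using PiE_mem[OF p j] PiE_mem[OF q j] y(2) by auto
        have px: "p j \<in> mball (x j) (r x)" using x(2) j by (auto simp: B_def PiE_iff)
        have "d (x j) (q j) \<le> d (x j) (p j) + d (p j) (q j)" using pq px by (intro triangle) auto
        also have "d (p j) (q j) \<le> d (p j) y + d y (q j)" using pq by (intro triangle) auto
        finally have "d (x j) (q j) < 2 * r x"
          using pq px \<rho>(2)[OF x(1)] commute[of "p j" y] by auto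
        then show ?thesis using pq px by simp
      qed
      moreover have "q \<in> extensional {1..n}" using q by (simp add: PiE_iff)
      ultimately have "q \<in> (\<Pi>\<^sub>E j\<in>{1..n}. mball (x j) (2 * r x))" by (simp only: PiE_iff) simp
      then show ?thesis using W(2) by blast
    qed
    then show ?thesis using W(1) by blast
  qed
  then show ?thesis using that cov by blast
qed

lemma diagonal_action_apply:
  "x \<in> topspace (power_space n X) \<Longrightarrow> diagonal_action n X \<phi> g x = (\<lambda>j\<in>{1..n}. \<phi> g (x j))"
  by (simp add: diagonal_action_def compose_def)

lemma fibred_system_power:
  assumes "fibred_system G X \<phi> Y \<pi>"
  shows "fibred_system G (power_space n X) (diagonal_action n X \<phi>) (power_space n Y) (compose {1..n} \<pi>)"
proof -
  interpret fibred_system G X \<phi> Y \<pi> by fact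
  let ?Xn = "power_space n X" and ?D = "diagonal_action n X \<phi>"
  have coord: "x j \<in> topspace X" if "x \<in> topspace ?Xn" "j \<in> {1..n}" for x j
    using that by (auto simp: topspace_power_space)
  have cont: "continuous_map ?Xn ?Xn (?D g)" if g: "g \<in> carrier G" for g
  proof -
    have "continuous_map ?Xn ?Xn (\<lambda>x. \<lambda>j\<in>{1..n}. \<phi> g (x j))"
    proof (rule continuous_map_power_spaceI)
      fix j assume j: "j \<in> {1..n}"
      have "continuous_map ?Xn X (\<phi> g \<circ> (\<lambda>x. x j))"
        by (rule continuous_map_compose[OF continuous_map_power_space_proj[OF j] continuous_action[OF g]])
      then show "continuous_map ?Xn X (\<lambda>x. (\<lambda>j\<in>{1..n}. \<phi> g (x j)) j)" using j by (simp add: o_def)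
    qed simp
    then show ?thesis by (rule continuous_map_eq) (simp add: diagonal_action_apply)
  qed
  show ?thesis
  proof unfold_locales
    show "compact_space ?Xn" by (rule compact_power_space[OF compact])
    show "metrizable_space ?Xn" by (rule metrizable_power_space[OF metrizable])
    show "continuous_map ?Xn ?Xn (?D g)" if "g \<in> carrier G" for g by (rule cont[OF that])
    show "?D (g \<otimes>\<^bsub>G\<^esub> h) x = ?D g (?D h x)"
      if "g \<in> carrier G" "h \<in> carrier G" "x \<in> topspace ?Xn" for g h x
      using that continuous_map_in[OF cont[OF that(2)] that(3)] coord[OF that(3)]
      by (auto simp: diagonal_action_apply action_mult intro!: restrict_ext)
    show "compose {1..n} \<pi> (?D g x) = compose {1..n} \<pi> (?D g x')"
      if g: "g \<in> carrier G" and x: "x \<in> topspace ?Xn" "x' \<in> topspace ?Xn"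
        and eq: "compose {1..n} \<pi> x = compose {1..n} \<pi> x'" for g x x'
    proof -
      have "\<pi> (x j) = \<pi> (x' j)" if "j \<in> {1..n}" for j
        using fun_cong[OF eq, of j] that by (simp add: compose_def)
      then show ?thesis
        using x by (auto simp: compose_def diagonal_action_apply intro!: restrict_ext
            fiber_equivariant[OF g] coord)
    qed
    show "compose {1..n} \<pi> ` topspace ?Xn \<subseteq> topspace (power_space n Y)"
      using image_subset by (auto simp: topspace_power_space compose_def PiE_iff)
  qed
qed

section \<open>Mean dimension of the power of a system\<close>

context fibred_system
begin

lemma rate_power_cover_ge:
  assumes nb: "invariance_filter G \<noteq> bot" and ne: "topspace X \<noteq> {}" and \<alpha>: "finite_open_cover X \<alpha>"
    and n: "n \<ge> 1" and inf: "infinite (carrier G)"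
  shows "real n * rate \<alpha> \<le>
    fibred_system.rate G (power_space n X) (diagonal_action n X \<phi>) (power_space n Y) (compose {1..n} \<pi>)
      (power_cover n \<alpha>)"
proof -
  interpret P: fibred_system G "power_space n X" "diagonal_action n X \<phi>" "power_space n Y" "compose {1..n} \<pi>"
    by (rule fibred_system_power[OF fibred_system_axioms])
  have neP: "topspace (power_space n X) \<noteq> {}" using power_space_empty_iff[OF n] ne by blast
  note \<alpha>n = finite_open_cover_power_cover[OF \<alpha>, of n]
  have step: "(rate \<alpha> - \<eta>) * real n \<le> P.rate (power_cover n \<alpha>) + \<eta>" if \<eta>: "0 < \<eta>" for \<eta>
  proof -
    obtain T b where T: "finite T" "T \<subseteq> carrier G" "0 < b"
      and low: "\<And>F. F \<in> fin_subsets G \<Longrightarrow> (\<And>t. t \<in> T \<Longrightarrow> boundary_ratio G t F \<le> b) \<Longrightarrow>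
           (rate \<alpha> - \<eta>) * real (card F) \<le> dyn_dim \<alpha> F"
      by (rule rate_le_dyn_dim[OF nb ne \<alpha> \<eta>]) blast
    \<comment> \<open>One \<open>F\<close> suits both sides: the upper bound for the power holds for
      arbitrarily invariant sets, and \<open>low\<close> will be applied not to \<open>F\<close> but
      to the union \<open>F'\<close> of its translates, whose boundary ratios are no larger.\<close>
    obtain F where F: "F \<in> fin_subsets G" "\<And>t. t \<in> T \<Longrightarrow> boundary_ratio G t F \<le> b"
      and up: "P.dyn_dim (power_cover n \<alpha>) F \<le> (P.rate (power_cover n \<alpha>) + \<eta>) * real (card F)"
      using P.frequently_dyn_dim_le_rate[OF nb neP \<alpha>n \<eta>] T unfolding frequently_invariant_def by metis
    have finF: "finite F" "F \<noteq> {}" "F \<subseteq> carrier G" using F by (auto simp: fin_subsets_def)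
    have "\<exists>c. (\<forall>i\<in>{1..n}. c i \<in> carrier G) \<and> (\<forall>i\<in>{1..n}. \<forall>j\<in>{1..n}. i \<noteq> j \<longrightarrow>
        (\<lambda>f. f \<otimes> c i) ` F \<inter> (\<lambda>f. f \<otimes> c j) ` F = {})"
      using inf finF by (intro disjoint_translates) auto
    then obtain c where c0: "\<forall>i\<in>{1..n}. c i \<in> carrier G"
      and disj0: "\<forall>i\<in>{1..n}. \<forall>j\<in>{1..n}. i \<noteq> j \<longrightarrow>
        (\<lambda>f. f \<otimes> c i) ` F \<inter> (\<lambda>f. f \<otimes> c j) ` F = {}"
      by (elim exE conjE) (rule that)
    note c = bspec[OF c0]
    have disj: "(\<lambda>f. f \<otimes> c i) ` F \<inter> (\<lambda>f. f \<otimes> c j) ` F = {}"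
      if "i \<in> {1..n}" "j \<in> {1..n}" "i \<noteq> j" for i j
      using disj0[rule_format, OF that] .
    define F' where "F' = (\<Union>j\<in>{1..n}. (\<lambda>f. f \<otimes> c j) ` F)"
    have cardF': "card F' = n * card F"
      unfolding F'_def using union_translates(1)[of "{1..n}" "\<lambda>_. F" c] finF c disj by simp
    have "card (F' - (t <# F')) \<le> n * card (F - (t <# F))" if "t \<in> T" for t
      unfolding F'_def using union_translates(2)[of "{1..n}" "\<lambda>_. F" c t] finF c disj that T by auto
    moreover have F': "F' \<in> fin_subsets G"
      using finF c n by (auto simp: fin_subsets_def F'_def subset_iff)
    ultimately have "boundary_ratio G t F' \<le> b" if "t \<in> T" for t
    proof -
      have "real (card (F' - (t <# F'))) \<le> real n * real (card (F - (t <# F)))"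
        using \<open>\<And>t. t \<in> T \<Longrightarrow> card (F' - (t <# F')) \<le> n * card (F - (t <# F))\<close>[OF that]
        by (simp only: of_nat_le_iff flip: of_nat_mult)
      also have "\<dots> \<le> real n * (b * real (card F))"
        using F(2)[OF that] boundary_ratio_le_iff[OF F(1)] by (intro mult_left_mono) auto
      finally show ?thesis using cardF' boundary_ratio_le_iff[OF F'] by (simp add: mult_ac)
    qed
    from low[OF F' this] have "(rate \<alpha> - \<eta>) * (real n * real (card F)) \<le> dyn_dim \<alpha> F'"
      by (simp add: cardF')
    also have "dyn_dim \<alpha> F' \<le> P.dyn_dim (power_cover n \<alpha>) F"
    proof -
      have "cond_dim X Y \<pi> (dyn_join X \<phi> F' \<alpha>) \<le> (\<Sum>j\<in>{()}. cond_dim (power_space n X) (power_space n Y)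
          (compose {1..n} \<pi>) (dyn_join (power_space n X) (diagonal_action n X \<phi>) F (power_cover n \<alpha>)))"
      proof (rule cond_dim_le_sum[OF metrizable ne, where \<theta> = "\<lambda>_ x. \<lambda>j\<in>{1..n}. \<phi> (c j) x"])
        show cont\<theta>: "continuous_map X (power_space n X) (\<lambda>x. \<lambda>j\<in>{1..n}. \<phi> (c j) x)" for u :: unit
          by (rule continuous_map_power_spaceI) (use continuous_action c in auto)
        show "compose {1..n} \<pi> (\<lambda>j\<in>{1..n}. \<phi> (c j) x) = compose {1..n} \<pi> (\<lambda>j\<in>{1..n}. \<phi> (c j) x')"
          if "x \<in> topspace X" "x' \<in> topspace X" "\<pi> x = \<pi> x'" for u :: unit and x x'
          using fiber_equivariant[OF c that] by (auto simp: compose_def intro!: restrict_ext)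
        show "compose {1..n} \<pi> ` topspace (power_space n X) \<subseteq> topspace (power_space n Y)"
          by (rule P.image_subset)
        show "finite_open_cover (power_space n X)
            (dyn_join (power_space n X) (diagonal_action n X \<phi>) F (power_cover n \<alpha>))" for u :: unit
          by (rule P.finite_open_cover_dyn_join[OF F(1) \<alpha>n])
        fix U assume U: "U \<in> {()} \<rightarrow> dyn_join (power_space n X) (diagonal_action n X \<phi>) F (power_cover n \<alpha>)"
        then obtain V where V: "V \<in> F \<rightarrow> power_cover n \<alpha>"
          "U () = (\<Inter>s\<in>F. {x\<in>topspace (power_space n X). diagonal_action n X \<phi> s x \<in> V s})"
          by (auto simp: dyn_join_def)
        have "\<exists>A. A \<in> {1..n} \<rightarrow> \<alpha> \<and> V s = PiE {1..n} A" if "s \<in> F" for s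
          using funcset_mem[OF V(1) that] unfolding power_cover_def by blast
        then obtain A where A: "\<And>s. s \<in> F \<Longrightarrow> A s \<in> {1..n} \<rightarrow> \<alpha> \<and> V s = PiE {1..n} (A s)" by metis
        have "\<exists>f j. f \<in> F \<and> j \<in> {1..n} \<and> b = f \<otimes> c j" if "b \<in> F'" for b
          using that unfolding F'_def by blast
        then obtain f j where fj: "\<And>b. b \<in> F' \<Longrightarrow> f b \<in> F \<and> j b \<in> {1..n} \<and> b = f b \<otimes> c (j b)"
          by metis
        let ?W = "\<Inter>b\<in>F'. {x\<in>topspace X. \<phi> b x \<in> A (f b) (j b)}"
        have "A (f b) (j b) \<in> \<alpha>" if "b \<in> F'" for b using A fj[OF that] by blast
        then have "?W \<in> dyn_join X \<phi> F' \<alpha>"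
          unfolding dyn_join_def by (intro CollectI exI[of _ "\<lambda>b. A (f b) (j b)"]) auto
        moreover have "x \<in> ?W" if x: "x \<in> topspace X" and xU: "(\<lambda>j\<in>{1..n}. \<phi> (c j) x) \<in> U ()" for x
        proof -
          have "\<phi> b x \<in> A (f b) (j b)" if b: "b \<in> F'" for b
          proof -
            let ?x = "\<lambda>j\<in>{1..n}. \<phi> (c j) x"
            have fb: "f b \<in> F" "j b \<in> {1..n}" "b = f b \<otimes> c (j b)" using fj[OF b] by auto
            have "diagonal_action n X \<phi> (f b) ?x \<in> PiE {1..n} (A (f b))"
              using xU A[OF fb(1)] fb(1) unfolding V(2) by auto
            then have "(\<lambda>j\<in>{1..n}. \<phi> (f b) (?x j)) \<in> PiE {1..n} (A (f b))"
              using continuous_map_in[OF cont\<theta> x] by (simp add: diagonal_action_apply)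
            then have "\<phi> (f b) (\<phi> (c (j b)) x) \<in> A (f b) (j b)" using fb(2) by (auto simp: PiE_iff)
            moreover have "\<phi> b x = \<phi> (f b) (\<phi> (c (j b)) x)"
              using action_mult[of "f b" "c (j b)" x] fb c finF x by (metis subsetD)
            ultimately show ?thesis by simp
          qed
          then show ?thesis using x by auto
        qed
        ultimately show "\<exists>W\<in>dyn_join X \<phi> F' \<alpha>. {x\<in>topspace X. \<forall>u\<in>{()}. (\<lambda>j\<in>{1..n}. \<phi> (c j) x) \<in> U u} \<subseteq> W"
          by (intro bexI[of _ ?W]) auto
      qed simp
      then show ?thesis
        using dyn_dim_nonneg_eq(1)[OF ne F' \<alpha>] P.dyn_dim_nonneg_eq(1)[OF neP F(1) \<alpha>n] by simp
    qed
    also note up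
    finally have "((rate \<alpha> - \<eta>) * real n) * real (card F) \<le> (P.rate (power_cover n \<alpha>) + \<eta>) * real (card F)"
      by (simp add: mult_ac)
    moreover have "0 < real (card F)" using finF by (simp add: card_gt_0_iff)
    ultimately show ?thesis by (simp only: mult_le_cancel_right_pos)
  qed
  show ?thesis
  proof (rule field_le_epsilon)
    \<comment> \<open>\<open>step\<close> loses \<open>\<eta>\<close> once for each of the
      \<open>n\<close> coordinates and once more for the power, hence the denominator.\<close>
    fix e :: real assume e: "0 < e"
    have "(rate \<alpha> - e / (real n + 1)) * real n \<le> P.rate (power_cover n \<alpha>) + e / (real n + 1)"
      using e by (intro step) (simp add: add_nonneg_pos)
    moreover have "e / (real n + 1) * real n + e / (real n + 1) = e / (real n + 1) * (real n + 1)"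
      by (simp only: distrib_left mult_1_right)
    moreover have "e / (real n + 1) * (real n + 1) = e" by simp
    ultimately show "real n * rate \<alpha> \<le> P.rate (power_cover n \<alpha>) + e"
      by (simp only: left_diff_distrib mult.commute[of "real n"])
  qed
qed

text \<open>After passing to a refining power cover, the join on the power is refined by pullbacks
  of joins on \<open>X\<close> under the \<open>n\<close> coordinate projections, to which
  \<open>cond_dim_le_sum\<close> applies.\<close>

lemma rate_power_le:
  assumes nb: "invariance_filter G \<noteq> bot" and ne: "topspace X \<noteq> {}" and n: "n \<ge> 1"
    and \<beta>: "finite_open_cover (power_space n X) \<beta>"
  obtains \<alpha> where "finite_open_cover X \<alpha>"
    and "fibred_system.rate G (power_space n X) (diagonal_action n X \<phi>) (power_space n Y) (compose {1..n} \<pi>) \<beta>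
      \<le> real n * rate \<alpha>"
proof -
  interpret P: fibred_system G "power_space n X" "diagonal_action n X \<phi>" "power_space n Y" "compose {1..n} \<pi>"
    by (rule fibred_system_power[OF fibred_system_axioms])
  have neP: "topspace (power_space n X) \<noteq> {}" using power_space_empty_iff[OF n] ne by blast
  obtain \<alpha> where \<alpha>: "finite_open_cover X \<alpha>" and ref: "\<And>U. U \<in> {1..n} \<rightarrow> \<alpha> \<Longrightarrow> \<exists>W\<in>\<beta>. PiE {1..n} U \<subseteq> W"
    by (rule power_cover_refines[OF compact metrizable ne \<beta>]) blast
  have le: "P.dyn_dim \<beta> F \<le> real n * dyn_dim \<alpha> F" if F: "F \<in> fin_subsets G" for F
  proof -
    have finF: "finite F" "F \<noteq> {}" "F \<subseteq> carrier G" using F by (auto simp: fin_subsets_def)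
    have "cond_dim (power_space n X) (power_space n Y) (compose {1..n} \<pi>)
        (dyn_join (power_space n X) (diagonal_action n X \<phi>) F \<beta>) \<le> (\<Sum>j\<in>{1..n}. cond_dim X Y \<pi> (dyn_join X \<phi> F \<alpha>))"
    proof (rule cond_dim_le_sum[OF P.metrizable neP, where \<theta> = "\<lambda>j x. x j"])
      show "\<pi> (x j) = \<pi> (x' j)" if "j \<in> {1..n}" "compose {1..n} \<pi> x = compose {1..n} \<pi> x'" for j x x'
        using fun_cong[OF that(2), of j] that(1) by (simp add: compose_def)
      show "finite_open_cover X (dyn_join X \<phi> F \<alpha>)" for j :: nat
        by (rule finite_open_cover_dyn_join[OF F \<alpha>])
      fix U assume U: "U \<in> {1..n} \<rightarrow> dyn_join X \<phi> F \<alpha>"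
      define Q where "Q j A \<longleftrightarrow> A \<in> F \<rightarrow> \<alpha> \<and> U j = (\<Inter>s\<in>F. {x\<in>topspace X. \<phi> s x \<in> A s})" for j A
      have "\<exists>A. Q j A" if "j \<in> {1..n}" for j
        using funcset_mem[OF U that] by (simp add: dyn_join_def Q_def conj_commute)
      then obtain A where "\<And>j. j \<in> {1..n} \<Longrightarrow> Q j (A j)" by metis
      then have A: "A j \<in> F \<rightarrow> \<alpha>" "U j = (\<Inter>s\<in>F. {x\<in>topspace X. \<phi> s x \<in> A j s})"
        if "j \<in> {1..n}" for j using that by (simp_all add: Q_def)
      have "\<exists>W\<in>\<beta>. PiE {1..n} (\<lambda>j. A j s) \<subseteq> W" if "s \<in> F" for s
        using funcset_mem[OF A(1) that] by (intro ref) auto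
      then obtain W where W: "\<And>s. s \<in> F \<Longrightarrow> W s \<in> \<beta> \<and> PiE {1..n} (\<lambda>j. A j s) \<subseteq> W s" by metis
      let ?V = "\<Inter>s\<in>F. {x\<in>topspace (power_space n X). diagonal_action n X \<phi> s x \<in> W s}"
      have "?V \<in> dyn_join (power_space n X) (diagonal_action n X \<phi>) F \<beta>"
        unfolding dyn_join_def using W by (intro CollectI exI[of _ W]) auto
      moreover have "x \<in> ?V" if x: "x \<in> topspace (power_space n X)" and xU: "\<And>j. j \<in> {1..n} \<Longrightarrow> x j \<in> U j" for x
      proof -
        have "diagonal_action n X \<phi> s x \<in> W s" if s: "s \<in> F" for s
        proof -
          have "\<phi> s (x j) \<in> A j s" if "j \<in> {1..n}" for j using A[OF that] xU[OF that] s by auto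
          then have "(\<lambda>j\<in>{1..n}. \<phi> s (x j)) \<in> PiE {1..n} (\<lambda>j. A j s)" by auto
          then show ?thesis using subsetD[OF conjunct2[OF W[OF s]]] diagonal_action_apply[OF x] by metis
        qed
        then show ?thesis using x by auto
      qed
      ultimately show "\<exists>W\<in>dyn_join (power_space n X) (diagonal_action n X \<phi>) F \<beta>.
          {x\<in>topspace (power_space n X). \<forall>j\<in>{1..n}. x j \<in> U j} \<subseteq> W"
        by (intro bexI[of _ ?V]) auto
    next
      show "continuous_map (power_space n X) X (\<lambda>x. x j)" if "j \<in> {1..n}" for j
        by (rule continuous_map_power_space_proj[OF that])
    qed (use image_subset in auto)
    also have "\<dots> = ereal (real n * dyn_dim \<alpha> F)"
      using dyn_dim_nonneg_eq(1)[OF ne F \<alpha>] by (simp add: sum_ereal)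
    finally show ?thesis using P.dyn_dim_nonneg_eq(1)[OF neP F \<beta>] by simp
  qed
  have "P.rate \<beta> \<le> real n * rate \<alpha>"
  proof (rule tendsto_le[OF nb])
    show "((\<lambda>F. P.dyn_dim \<beta> F / real (card F)) \<longlongrightarrow> P.rate \<beta>) (invariance_filter G)"
      by (rule P.rate(1)[OF nb neP \<beta>])
    show "((\<lambda>F. real n * (dyn_dim \<alpha> F / real (card F))) \<longlongrightarrow> real n * rate \<alpha>) (invariance_filter G)"
      by (intro tendsto_intros rate(1)[OF nb ne \<alpha>])
    show "eventually (\<lambda>F. P.dyn_dim \<beta> F / real (card F) \<le> real n * (dyn_dim \<alpha> F / real (card F)))
        (invariance_filter G)"
      by (rule eventually_invariance_filterI[of "{}" 1]) (use le in \<open>auto simp: divide_right_mono\<close>)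
  qed
  then show ?thesis using that \<alpha> by blast
qed

theorem cond_mdim_power:
  assumes nb: "invariance_filter G \<noteq> bot" and n: "n \<ge> 1" and inf: "infinite (carrier G)"
  shows "cond_mdim G X \<phi> Y \<pi> = ereal (1 / real n) *
    cond_mdim G (power_space n X) (diagonal_action n X \<phi>) (power_space n Y) (compose {1..n} \<pi>)"
proof -
  interpret P: fibred_system G "power_space n X" "diagonal_action n X \<phi>" "power_space n Y" "compose {1..n} \<pi>"
    by (rule fibred_system_power[OF fibred_system_axioms])
  show ?thesis
  proof (cases "topspace X = {}")
    case True
    then have "topspace (power_space n X) = {}" using power_space_empty_iff[OF n] by blast
    then show ?thesis using cond_mdim_empty[OF nb True] P.cond_mdim_empty[OF nb] n by simp
  next
    case ne: False
    then have neP: "topspace (power_space n X) \<noteq> {}" using power_space_empty_iff[OF n] by blast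
    have n0: "0 < real n" using n by simp
    have "cond_mdim G X \<phi> Y \<pi> = (SUP \<beta>\<in>{\<beta>. finite_open_cover (power_space n X) \<beta>}. ereal (P.rate \<beta> / real n))"
      unfolding cond_mdim_eq_SUP_rate[OF nb ne]
    proof (rule antisym)
      show "(SUP \<alpha>\<in>{\<alpha>. finite_open_cover X \<alpha>}. ereal (rate \<alpha>))
          \<le> (SUP \<beta>\<in>{\<beta>. finite_open_cover (power_space n X) \<beta>}. ereal (P.rate \<beta> / real n))"
      proof (rule SUP_mono)
        fix \<alpha> assume "\<alpha> \<in> {\<alpha>. finite_open_cover X \<alpha>}"
        then have \<alpha>: "finite_open_cover X \<alpha>" by simp
        show "\<exists>\<beta>\<in>{\<beta>. finite_open_cover (power_space n X) \<beta>}. ereal (rate \<alpha>) \<le> ereal (P.rate \<beta> / real n)"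
          using rate_power_cover_ge[OF nb ne \<alpha> n inf] finite_open_cover_power_cover[OF \<alpha>, of n] n0
          by (intro bexI[of _ "power_cover n \<alpha>"]) (auto simp: pos_le_divide_eq mult.commute)
      qed
      show "(SUP \<beta>\<in>{\<beta>. finite_open_cover (power_space n X) \<beta>}. ereal (P.rate \<beta> / real n))
          \<le> (SUP \<alpha>\<in>{\<alpha>. finite_open_cover X \<alpha>}. ereal (rate \<alpha>))"
      proof (rule SUP_mono)
        fix \<beta> assume "\<beta> \<in> {\<beta>. finite_open_cover (power_space n X) \<beta>}"
        then have "finite_open_cover (power_space n X) \<beta>" by simp
        then obtain \<alpha> where "finite_open_cover X \<alpha>" "P.rate \<beta> \<le> real n * rate \<alpha>"
          by (rule rate_power_le[OF nb ne n])
        then show "\<exists>\<alpha>\<in>{\<alpha>. finite_open_cover X \<alpha>}. ereal (P.rate \<beta> / real n) \<le> ereal (rate \<alpha>)"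
          using n0 by (auto simp: pos_divide_le_eq mult.commute)
      qed
    qed
    also have "\<dots> = (SUP \<beta>\<in>{\<beta>. finite_open_cover (power_space n X) \<beta>}. ereal (1 / real n) * ereal (P.rate \<beta>))"
      by simp
    also have "\<dots> = ereal (1 / real n) * (SUP \<beta>\<in>{\<beta>. finite_open_cover (power_space n X) \<beta>}. ereal (P.rate \<beta>))"
      using n0 finite_open_cover_topspace by (intro Sup_ereal_mult_left'[symmetric]) auto
    finally show ?thesis unfolding P.cond_mdim_eq_SUP_rate[OF nb neP] .
  qed
qed

end

section \<open>Microstates along tiles\<close>

text \<open>A union bound over finitely many defects, each of density tending to 0. Staying in
  \<open>{1..d i}\<close> comes from the maps being permutations.\<close>

lemma (in group) sofic_good_points:
  assumes sof: "sofic_approximation G d \<sigma>" and T: "finite T" "T \<subseteq> carrier G" and \<delta>: "0 < \<delta>"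
  shows "eventually (\<lambda>i. real (card ({1..d i} - good_points (\<sigma> i) T {1..d i})) \<le> \<delta> * real (d i)) sequentially"
proof -
  \<comment> \<open>The unit is added because goodness asks for
    \<open>\<sigma> i \<one> v = v\<close>. This follows from multiplicativity at the pair of units,
    by injectivity of \<open>\<sigma> i \<one>\<close>.\<close>
  define T' where "T' = insert \<one> T"
  have T': "finite T'" "T' \<subseteq> carrier G" "\<one> \<in> T'" using T by (auto simp: T'_def)
  have perm: "\<sigma> i s permutes {1..d i}" if "s \<in> carrier G" for i s
    using sof that by (simp add: sofic_approximation_def)
  define M where "M s t i = {v\<in>{1..d i}. \<sigma> i s (\<sigma> i t v) \<noteq> \<sigma> i (s \<otimes> t) v}" for s t i
  define C where "C s t i = {v\<in>{1..d i}. \<sigma> i s v = \<sigma> i t v}" for s t i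
  have dpos: "eventually (\<lambda>i. 1 \<le> d i) sequentially"
    using sof by (simp add: sofic_approximation_def filterlim_at_top)
  have M0: "(\<lambda>i. real (card (M s t i)) / real (d i)) \<longlonglongrightarrow> 0" if st: "s \<in> T'" "t \<in> T'" for s t
  proof -
    have "(\<lambda>i. real (card {v\<in>{1..d i}. \<sigma> i s (\<sigma> i t v) = \<sigma> i (s \<otimes> t) v}) / real (d i)) \<longlonglongrightarrow> 1"
    proof -
      have "s \<in> carrier G" "t \<in> carrier G" using st T'(2) by auto
      then show ?thesis using sof unfolding sofic_approximation_def by blast
    qed
    then have "(\<lambda>i. 1 - real (card {v\<in>{1..d i}. \<sigma> i s (\<sigma> i t v) = \<sigma> i (s \<otimes> t) v}) / real (d i)) \<longlonglongrightarrow> 1 - 1"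
      by (intro tendsto_diff tendsto_const)
    moreover have "eventually (\<lambda>i. 1 - real (card {v\<in>{1..d i}. \<sigma> i s (\<sigma> i t v) = \<sigma> i (s \<otimes> t) v}) / real (d i)
        = real (card (M s t i)) / real (d i)) sequentially"
      using dpos
    proof eventually_elim
      case (elim i)
      have "card {1..d i} = card (M s t i \<union> {v\<in>{1..d i}. \<sigma> i s (\<sigma> i t v) = \<sigma> i (s \<otimes> t) v})"
        by (rule arg_cong[where f = card]) (auto simp: M_def)
      also have "\<dots> = card (M s t i) + card {v\<in>{1..d i}. \<sigma> i s (\<sigma> i t v) = \<sigma> i (s \<otimes> t) v}"
        by (rule card_Un_disjoint) (auto simp: M_def)
      finally have "real (card (M s t i)) = real (d i) - real (card {v\<in>{1..d i}. \<sigma> i s (\<sigma> i t v) = \<sigma> i (s \<otimes> t) v})"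
        by simp
      then show ?case using elim by (simp add: diff_divide_distrib)
    qed
    ultimately have "(\<lambda>i. real (card (M s t i)) / real (d i)) \<longlonglongrightarrow> 1 - 1"
      by (rule Lim_transform_eventually)
    then show ?thesis by simp
  qed
  have C0: "(\<lambda>i. real (card (C s t i)) / real (d i)) \<longlonglongrightarrow> 0" if "s \<in> T'" "t \<in> T'" "s \<noteq> t" for s t
  proof -
    have "s \<in> carrier G" "t \<in> carrier G" using that T' by auto
    then show ?thesis using sof that(3) unfolding sofic_approximation_def C_def by blast
  qed
  define I where "I = {(s,t). s \<in> T' \<and> t \<in> T' \<and> s \<noteq> t}"
  have finI: "finite I" by (rule finite_subset[of _ "T' \<times> T'"]) (use T' in \<open>auto simp: I_def\<close>)
  define N where "N i = (\<Sum>p\<in>T' \<times> T'. real (card (M (fst p) (snd p) i)) / real (d i)) +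
      (\<Sum>p\<in>I. real (card (C (fst p) (snd p) i)) / real (d i))" for i
  have "N \<longlonglongrightarrow> 0 + 0"
    unfolding N_def by (intro tendsto_add tendsto_null_sum) (use M0 C0 in \<open>auto simp: I_def\<close>)
  then have "eventually (\<lambda>i. N i < \<delta>) sequentially" using \<delta> by (intro order_tendstoD(2)[where y = 0]) auto
  then show ?thesis using dpos
  proof eventually_elim
    case (elim i)
    let ?V = "{1..d i}"
    have "?V - good_points (\<sigma> i) T ?V \<subseteq> (\<Union>p\<in>T' \<times> T'. M (fst p) (snd p) i) \<union> (\<Union>p\<in>I. C (fst p) (snd p) i)"
    proof (rule ccontr)
      assume "\<not> ?thesis"
      then obtain v where v: "v \<in> ?V" "v \<notin> good_points (\<sigma> i) T ?V"
        and vM: "\<And>s t. s \<in> T' \<Longrightarrow> t \<in> T' \<Longrightarrow> v \<notin> M s t i" and vC: "\<And>s t. (s,t) \<in> I \<Longrightarrow> v \<notin> C s t i"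
        by force
      have mult: "\<sigma> i s (\<sigma> i t v) = \<sigma> i (s \<otimes> t) v" if "s \<in> T'" "t \<in> T'" for s t
        using vM[OF that] v(1) by (simp add: M_def)
      have "\<sigma> i \<one> (\<sigma> i \<one> v) = \<sigma> i \<one> v" using mult[OF T'(3,3)] by simp
      then have one: "\<sigma> i \<one> v = v" using permutes_inj[OF perm[of \<one> i]] by (auto dest: injD)
      have "\<sigma> i s v \<noteq> \<sigma> i t v" if "s \<in> T'" "t \<in> T'" "s \<noteq> t" for s t
        using vC[of s t] that v(1) by (auto simp: I_def C_def)
      moreover have "\<sigma> i t v \<in> ?V" if "t \<in> T'" for t
        using permutes_in_image[OF perm[of t i]] v(1) that T'(2) by blast
      ultimately have "v \<in> good_points (\<sigma> i) T ?V"
        using v(1) mult one unfolding good_points_def T'_def by simp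
      then show False using v(2) by simp
    qed
    then have "card (?V - good_points (\<sigma> i) T ?V) \<le>
        card ((\<Union>p\<in>T' \<times> T'. M (fst p) (snd p) i) \<union> (\<Union>p\<in>I. C (fst p) (snd p) i))"
      using T'(1) finI by (intro card_mono) (auto simp: M_def C_def)
    also have "\<dots> \<le> card (\<Union>p\<in>T' \<times> T'. M (fst p) (snd p) i) + card (\<Union>p\<in>I. C (fst p) (snd p) i)"
      by (rule card_Un_le)
    also have "\<dots> \<le> (\<Sum>p\<in>T' \<times> T'. card (M (fst p) (snd p) i)) + (\<Sum>p\<in>I. card (C (fst p) (snd p) i))"
      using T'(1) finI by (intro add_mono card_UN_le) auto
    finally have "real (card (?V - good_points (\<sigma> i) T ?V)) \<le>
        (\<Sum>p\<in>T' \<times> T'. real (card (M (fst p) (snd p) i))) + (\<Sum>p\<in>I. real (card (C (fst p) (snd p) i)))"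
      by (simp only: of_nat_le_iff flip: of_nat_sum of_nat_add)
    also have "\<dots> = N i * real (d i)"
      using elim by (simp add: N_def distrib_right sum_distrib_right)
    also have "\<dots> \<le> \<delta> * real (d i)" using elim by (intro mult_right_mono) auto
    finally show ?case .
  qed
qed

text \<open>Trimming \<open>F\<close> to \<open>E\<close> enlarges the boundary only by elements of
  the translate of \<open>F - E\<close>.\<close>

lemma (in group) card_diff_translate_subset:
  assumes "finite F" and "E \<subseteq> F"
  shows "card (E - (t <# E)) \<le> card (F - (t <# F)) + card (F - E)"
proof -
  have "E - (t <# E) \<subseteq> (F - (t <# F)) \<union> (\<lambda>f. t \<otimes> f) ` (F - E)"
    using assms(2) by (auto simp: l_coset_def)
  then have "card (E - (t <# E)) \<le> card ((F - (t <# F)) \<union> (\<lambda>f. t \<otimes> f) ` (F - E))"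
    using assms(1) by (intro card_mono) auto
  also have "\<dots> \<le> card (F - (t <# F)) + card ((\<lambda>f. t \<otimes> f) ` (F - E))" by (rule card_Un_le)
  also have "\<dots> \<le> card (F - (t <# F)) + card (F - E)"
    using assms(1) by (simp add: card_image_le)
  finally show ?thesis .
qed

text \<open>Tiles are disjoint and injectively parametrized, so each covered point has a unique tile
  and a unique element leading to it; a function can therefore be prescribed tile by tile.\<close>

lemma (in group) tiling_lift:
  assumes "tiling \<sigma> K \<F> \<epsilon> V P"
  obtains g where "\<And>p f. p \<in> P \<Longrightarrow> f \<in> snd p \<Longrightarrow> g (\<sigma> f (fst p)) = w p f"
    and "\<And>v. v \<notin> covered \<sigma> P \<Longrightarrow> g v = z"
proof -
  define g where "g v = (if v \<in> covered \<sigma> P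
      then (SOME u. \<exists>p\<in>P. \<exists>f\<in>snd p. v = \<sigma> f (fst p) \<and> u = w p f) else z)" for v
  have "g (\<sigma> f (fst p)) = w p f" if p: "p \<in> P" and f: "f \<in> snd p" for p f
  proof -
    have "\<sigma> f (fst p) \<in> covered \<sigma> P" using p f by (auto simp: covered_def tile_image_def)
    moreover have "(SOME u. \<exists>p'\<in>P. \<exists>f'\<in>snd p'. \<sigma> f (fst p) = \<sigma> f' (fst p') \<and> u = w p' f') = w p f"
    proof (rule some_equality)
      fix u assume "\<exists>p'\<in>P. \<exists>f'\<in>snd p'. \<sigma> f (fst p) = \<sigma> f' (fst p') \<and> u = w p' f'"
      then obtain p' f' where p': "p' \<in> P" "f' \<in> snd p'" "\<sigma> f (fst p) = \<sigma> f' (fst p')" "u = w p' f'"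
        by blast
      have "tile_image \<sigma> p \<inter> tile_image \<sigma> p' \<noteq> {}" using f p' by (auto simp: tile_image_def)
      then have "p = p'" using assms p p'(1) unfolding tiling_def by blast
      moreover have "inj_on (\<lambda>f. \<sigma> f (fst p)) (snd p)" using assms p unfolding tiling_def by blast
      ultimately show "u = w p f" using f p' by (auto dest: inj_onD)
    qed (use p f in blast)
    ultimately show ?thesis by (simp add: g_def)
  qed
  then show ?thesis using that[of g] by (simp add: g_def)
qed

text \<open>Two fibred systems at once: \<open>X\<close> over \<open>Y\<close>, and \<open>Y\<close>
  over a point. The second carries the absolute mean dimension of \<open>Y\<close>, with which the
  sofic quantity is compared.\<close>

locale factor_system = group G for G :: "('g, 'm) monoid_scheme" (structure) +
  fixes X :: "'a topology" and \<phi> :: "'g \<Rightarrow> 'a \<Rightarrow> 'a" and Y :: "'b topology" and \<psi> :: "'g \<Rightarrow> 'b \<Rightarrow> 'b"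
    and \<pi> :: "'a \<Rightarrow> 'b"
  assumes base: "fibred_system G Y \<psi> (discrete_topology {()}) (\<lambda>_. ())"
    and total: "fibred_system G X \<phi> Y \<pi>"
    and continuous_factor: "continuous_map X Y \<pi>"
    and surj: "\<pi> ` topspace X = topspace Y"
    and equivariant: "\<And>g x. g \<in> carrier G \<Longrightarrow> x \<in> topspace X \<Longrightarrow> \<pi> (\<phi> g x) = \<psi> g (\<pi> x)"
begin

sublocale total: fibred_system G X \<phi> Y \<pi> by (rule total)
sublocale base: fibred_system G Y \<psi> "discrete_topology {()}" "\<lambda>_. ()" by (rule base)

text \<open>Giving the tiles disjoint translates makes the union \<open>F'\<close> have as many
  elements as there are covered points. The lower bound of the rate then applies to the single set
  \<open>F'\<close>, whatever the individual tiles look like.\<close>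

lemma sofic_lower:
  assumes nb: "invariance_filter G \<noteq> bot" and inf: "infinite (carrier G)"
    and sof: "sofic_approximation G d \<sigma>" and \<rho>: "compatible_metric X \<rho>"
    and ne: "topspace Y \<noteq> {}" and \<alpha>: "finite_open_cover Y \<alpha>"
    and F0: "F0 \<in> fin_subsets G" and \<delta>0: "0 < \<delta>0" and \<eta>: "0 < \<eta>"
  shows "eventually (\<lambda>i. ereal (base.rate \<alpha> - \<eta>) \<le> cover_dim_on (power_space (d i) Y)
      (compose {1..d i} \<pi> ` sofic_Map X \<phi> \<rho> F0 \<delta>0 (d i) (\<sigma> i)) (power_cover (d i) \<alpha>) / ereal (real (d i)))
      sequentially"
proof -
  have F0c: "finite F0" "F0 \<subseteq> carrier G" using F0 by (auto simp: fin_subsets_def)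
  let ?L = "base.rate \<alpha>"
  have L: "0 \<le> ?L" by (rule base.rate(2)[OF nb ne \<alpha>])
  interpret M: Metric_space "topspace X" \<rho> using \<rho> by (simp add: compatible_metric_def)
  have topX: "M.mtopology = X" using \<rho> by (simp add: compatible_metric_def)
  have "compactin M.mtopology (topspace X)" using total.compact by (simp add: topX compact_space_def)
  then obtain D where D: "0 < D" "\<And>x y. x \<in> topspace X \<Longrightarrow> y \<in> topspace X \<Longrightarrow> \<rho> x y \<le> D"
    using M.compactin_imp_mbounded M.mbounded_alt_pos by meson
  obtain T1 b1 where T1: "finite T1" "T1 \<subseteq> carrier G" and b1: "0 < b1"
    and low: "\<And>F. F \<in> fin_subsets G \<Longrightarrow> (\<And>t. t \<in> T1 \<Longrightarrow> boundary_ratio G t F \<le> b1) \<Longrightarrow>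
           (?L - \<eta>/2) * real (card F) \<le> base.dyn_dim \<alpha> F"
    using base.rate_le_dyn_dim[OF nb ne \<alpha>, of "\<eta>/2"] \<eta> by (metis half_gt_zero)
  \<comment> \<open>Trimmed tiles will have boundary ratio at most \<open>4 * \<epsilon>\<close>.
    The entry \<open>b1 / 4\<close> makes \<open>F'\<close> invariant enough for \<open>low\<close>,
    the last entry keeps \<open>D\<^sup>2 * (4 * \<epsilon>)\<close> within half of
    \<open>\<delta>0\<^sup>2\<close>, and \<open>1/2\<close> ensures that trimming at most halves a
    shape.\<close>
  define \<epsilon> where "\<epsilon> = Min {1/2, b1 / 4, \<delta>0\<^sup>2 / (8 * D\<^sup>2)}"
  have \<epsilon>: "0 < \<epsilon>" "\<epsilon> \<le> 1/2" "4 * \<epsilon> \<le> b1" "\<epsilon> \<le> \<delta>0\<^sup>2 / (8 * D\<^sup>2)"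
  proof -
    have "\<epsilon> \<le> x" if "x \<in> {1/2, b1 / 4, \<delta>0\<^sup>2 / (8 * D\<^sup>2)}" for x
      unfolding \<epsilon>_def by (rule Min_le) (use that in auto)
    from this[of "1/2"] this[of "b1 / 4"] this[of "\<delta>0\<^sup>2 / (8 * D\<^sup>2)"]
    show "\<epsilon> \<le> 1/2" "4 * \<epsilon> \<le> b1" "\<epsilon> \<le> \<delta>0\<^sup>2 / (8 * D\<^sup>2)" by simp_all
    show "0 < \<epsilon>" unfolding \<epsilon>_def using b1 \<delta>0 D by (subst Min_gr_iff) auto
  qed
  \<comment> \<open>\<open>\<eta>'\<close> bounds the uncovered proportion. The second entry limits
    the resulting loss of dimension to \<open>\<eta>/2\<close>, and the third keeps
    \<open>D\<^sup>2 * \<eta>'\<close> within the other half of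
    \<open>\<delta>0\<^sup>2\<close>.\<close>
  define \<eta>' where "\<eta>' = Min {1/2, \<eta> / (2 * (?L + 1)), \<delta>0\<^sup>2 / (2 * D\<^sup>2)}"
  have \<eta>': "0 < \<eta>'" "\<eta>' \<le> 1/2" "\<eta>' \<le> \<eta> / (2 * (?L + 1))" "\<eta>' \<le> \<delta>0\<^sup>2 / (2 * D\<^sup>2)"
  proof -
    have "\<eta>' \<le> x" if "x \<in> {1/2, \<eta> / (2 * (?L + 1)), \<delta>0\<^sup>2 / (2 * D\<^sup>2)}" for x
      unfolding \<eta>'_def by (rule Min_le) (use that in auto)
    from this[of "1/2"] this[of "\<eta> / (2 * (?L + 1))"] this[of "\<delta>0\<^sup>2 / (2 * D\<^sup>2)"]
    show "\<eta>' \<le> 1/2" "\<eta>' \<le> \<eta> / (2 * (?L + 1))" "\<eta>' \<le> \<delta>0\<^sup>2 / (2 * D\<^sup>2)" by simp_all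
    show "0 < \<eta>'" unfolding \<eta>'_def using \<eta> L \<delta>0 D by (subst Min_gr_iff) auto
  qed
  have L\<eta>': "?L * \<eta>' \<le> \<eta> / 2"
  proof -
    have "?L * \<eta>' \<le> (?L + 1) * (\<eta> / (2 * (?L + 1)))" using L \<eta>' by (intro mult_mono) auto
    also have "\<dots> = \<eta> / 2"
      using L by (simp add: nonzero_divide_mult_cancel_left nonzero_eq_divide_eq del: distrib_left_numeral)
    finally show ?thesis .
  qed
  have small: "D\<^sup>2 * (\<eta>' + 4 * \<epsilon>) \<le> \<delta>0\<^sup>2"
  proof -
    have "D\<^sup>2 * (\<eta>' + 4 * \<epsilon>) \<le> D\<^sup>2 * (\<delta>0\<^sup>2 / (2 * D\<^sup>2) + 4 * (\<delta>0\<^sup>2 / (8 * D\<^sup>2)))"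
      using \<epsilon>(4) \<eta>'(4) by (intro mult_left_mono add_mono) auto
    also have "\<dots> = \<delta>0\<^sup>2" using D by (simp add: field_simps)
    finally show ?thesis .
  qed
  \<comment> \<open>\<open>T1\<close> is for the invariance of \<open>F'\<close>. The inverses are
    for the equivariance of microstates: \<open>s \<otimes> f\<close> leaves the tile of
    \<open>f\<close> exactly when \<open>f\<close> is outside \<open>inv s <# snd p\<close>.\<close>
  define K0 where "K0 = T1 \<union> m_inv G ` F0"
  have K0: "finite K0" "K0 \<subseteq> carrier G" using T1 F0c by (auto simp: K0_def)
  have freq: "frequently_invariant (\<lambda>F. \<forall>t\<in>K0. boundary_ratio G t F \<le> \<epsilon>)"
    by (rule frequently_invariantI[OF nb], rule eventually_invariance_filterI[OF K0 \<epsilon>(1)]) blast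
  obtain \<F> T \<delta> where \<F>: "finite \<F>" "\<F> \<subseteq> fin_subsets G"
      "\<And>F. F \<in> \<F> \<Longrightarrow> \<forall>t\<in>K0. boundary_ratio G t F \<le> \<epsilon>"
    and T: "finite T" "T \<subseteq> carrier G" and \<delta>: "0 < \<delta>"
    and til: "\<And>(V::nat set) \<sigma>. finite V \<Longrightarrow> real (card (V - good_points \<sigma> T V)) \<le> \<delta> * real (card V) \<Longrightarrow>
        \<exists>P. tiling \<sigma> F0 \<F> \<epsilon> V P \<and> real (card (V - covered \<sigma> P)) \<le> \<eta>' * real (card V)"
    by (rule quasi_tiling[OF freq F0c \<epsilon>(1,2) \<eta>'(1), where ?'v = nat]) blast
  have dpos: "eventually (\<lambda>i. 1 \<le> d i) sequentially"
    using sof by (simp add: sofic_approximation_def filterlim_at_top)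
  show ?thesis
    using sofic_good_points[OF sof T \<delta>] dpos
  proof eventually_elim
    case (elim i)
    let ?V = "{1..d i}" and ?s = "\<sigma> i"
    have d: "0 < real (d i)" using elim by simp
    obtain P where P: "tiling ?s F0 \<F> \<epsilon> ?V P" and unc: "real (card (?V - covered ?s P)) \<le> \<eta>' * real (d i)"
      using til[of ?V ?s] elim by auto
    have finP: "finite P" using P by (simp add: tiling_def)
    have fin\<F>: "finite F" if "F \<in> \<F>" for F using \<F>(2) that by (auto simp: fin_subsets_def)
    have Pp: "snd p \<noteq> {}" "\<exists>F\<in>\<F>. snd p \<subseteq> F \<and> (1 - \<epsilon>) * real (card F) \<le> real (card (snd p))"
      "\<And>s f. s \<in> F0 \<Longrightarrow> f \<in> snd p \<Longrightarrow> ?s s (?s f (fst p)) = ?s (s \<otimes> f) (fst p)" if "p \<in> P" for p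
      using P that by (auto simp: tiling_def)
    have Pfin: "finite (snd p) \<and> snd p \<subseteq> carrier G" if p: "p \<in> P" for p
    proof -
      obtain F where "F \<in> \<F>" "snd p \<subseteq> F" using Pp(2)[OF p] by blast
      then show ?thesis using \<F>(2) by (auto simp: fin_subsets_def intro: finite_subset)
    qed
    \<comment> \<open>The boundary of the shape and the trimming contribute
      \<open>\<epsilon> * card F\<close> each, and \<open>card F\<close> is at most twice the size
      of the tile.\<close>
    have bdry: "real (card (snd p - (t <# snd p))) \<le> 4 * \<epsilon> * real (card (snd p))" if p: "p \<in> P" and t: "t \<in> K0" for p t
    proof -
      obtain F where F: "F \<in> \<F>" "snd p \<subseteq> F" "(1 - \<epsilon>) * real (card F) \<le> real (card (snd p))"
        using Pp(2)[OF p] by blast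
      have "real (card (F - snd p)) = real (card F) - real (card (snd p))"
        using F fin\<F> by (simp add: card_Diff_subset finite_subset card_mono of_nat_diff)
      also have "\<dots> \<le> \<epsilon> * real (card F)" using F(3) by (simp add: algebra_simps)
      finally have 1: "real (card (F - snd p)) \<le> \<epsilon> * real (card F)" .
      have 2: "real (card (F - (t <# F))) \<le> \<epsilon> * real (card F)"
        using \<F>(3)[OF F(1)] t boundary_ratio_le_iff[of F t \<epsilon>] F(1) \<F>(2) by blast
      have "real (card (snd p - (t <# snd p))) \<le> real (card (F - (t <# F))) + real (card (F - snd p))"
        using card_diff_translate_subset[OF fin\<F>[OF F(1)] F(2), of t]
        by (simp only: of_nat_le_iff flip: of_nat_add)
      also have "\<dots> \<le> 2 * \<epsilon> * real (card F)" using 1 2 by simp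
      also have "\<dots> \<le> 2 * \<epsilon> * (2 * real (card (snd p)))"
      proof (rule mult_left_mono)
        have "1/2 * real (card F) \<le> (1 - \<epsilon>) * real (card F)" using \<epsilon> by (intro mult_right_mono) auto
        then show "real (card F) \<le> 2 * real (card (snd p))" using F(3) by simp
      qed (use \<epsilon> in simp)
      finally show ?thesis by simp
    qed
    have cov: "covered ?s P \<subseteq> ?V" by (rule tiling_covered_subset[OF P])
    have cardcov: "card (covered ?s P) = (\<Sum>p\<in>P. card (snd p))" by (rule card_covered[OF P fin\<F>])
    have "card (?V - covered ?s P) = card ?V - card (covered ?s P)"
      using cov by (intro card_Diff_subset) (auto intro: finite_subset)
    moreover have cardle: "card (covered ?s P) \<le> card ?V" using cov by (intro card_mono) auto
    ultimately have big: "(1 - \<eta>') * real (d i) \<le> real (card (covered ?s P))"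
      using unc by (simp add: of_nat_diff algebra_simps)
    have "\<exists>c. (\<forall>p\<in>P. c p \<in> carrier G) \<and>
        (\<forall>p\<in>P. \<forall>q\<in>P. p \<noteq> q \<longrightarrow> (\<lambda>f. f \<otimes> c p) ` snd p \<inter> (\<lambda>f. f \<otimes> c q) ` snd q = {})"
      by (rule disjoint_translates[OF finP inf]) (rule Pfin)
    then obtain c where c0: "\<forall>p\<in>P. c p \<in> carrier G"
      and disj0: "\<forall>p\<in>P. \<forall>q\<in>P. p \<noteq> q \<longrightarrow> (\<lambda>f. f \<otimes> c p) ` snd p \<inter> (\<lambda>f. f \<otimes> c q) ` snd q = {}"
      by (elim exE conjE) (rule that)
    define F' where "F' = (\<Union>p\<in>P. (\<lambda>f. f \<otimes> c p) ` snd p)"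
    have cardF': "card F' = (\<Sum>p\<in>P. card (snd p))"
      unfolding F'_def
      by (rule union_translates(1)[OF finP]) (rule Pfin bspec[OF c0] disj0[rule_format]; assumption)+
    have F'b: "card (F' - (t <# F')) \<le> (\<Sum>p\<in>P. card (snd p - (t <# snd p)))" if "t \<in> carrier G" for t
      unfolding F'_def
      by (rule union_translates(2)[OF finP _ _ _ that]) (rule Pfin bspec[OF c0] disj0[rule_format]; assumption)+
    have F'c: "F' \<subseteq> carrier G" using Pfin c0 by (auto simp: F'_def subset_iff)
    have "0 < (1 - \<eta>') * real (d i)" using \<eta>' d by simp
    then have "0 < card F'" using big cardcov cardF' by (metis of_nat_0_less_iff order_less_le_trans)
    then have F': "F' \<in> fin_subsets G" using F'c by (auto simp: fin_subsets_def card_gt_0_iff)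
    have "boundary_ratio G t F' \<le> b1" if t: "t \<in> T1" for t
    proof -
      have tK: "t \<in> K0" "t \<in> carrier G" using t T1 by (auto simp: K0_def)
      have "real (card (F' - (t <# F'))) \<le> (\<Sum>p\<in>P. real (card (snd p - (t <# snd p))))"
        using F'b[OF tK(2)] by (simp only: of_nat_le_iff flip: of_nat_sum)
      also have "\<dots> \<le> (\<Sum>p\<in>P. 4 * \<epsilon> * real (card (snd p)))" using bdry tK(1) by (intro sum_mono) auto
      also have "\<dots> = 4 * \<epsilon> * real (card F')" by (simp add: cardF' sum_distrib_left)
      also have "\<dots> \<le> b1 * real (card F')" using \<epsilon>(3) by (intro mult_right_mono) auto
      finally show ?thesis using boundary_ratio_le_iff[OF F'] by simp
    qed
    from low[OF F' this] have low': "(?L - \<eta>/2) * real (card F') \<le> base.dyn_dim \<alpha> F'" .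
    have "(?L - \<eta>) * real (d i) \<le> base.dyn_dim \<alpha> F'"
    proof (cases "0 \<le> ?L - \<eta>/2")
      case True
      have "(?L - \<eta>) * real (d i) \<le> ((?L - \<eta>/2) * (1 - \<eta>')) * real (d i)"
      proof (rule mult_right_mono)
        have "0 \<le> \<eta>/2 * \<eta>'" using \<eta> \<eta>' by simp
        moreover have "(?L - \<eta>/2) * (1 - \<eta>') = ?L - \<eta>/2 - ?L * \<eta>' + \<eta>/2 * \<eta>'"
          by (simp add: left_diff_distrib right_diff_distrib)
        ultimately show "?L - \<eta> \<le> (?L - \<eta>/2) * (1 - \<eta>')" using L\<eta>' by linarith
      qed simp
      also have "\<dots> = (?L - \<eta>/2) * ((1 - \<eta>') * real (d i))" by simp
      also have "\<dots> \<le> (?L - \<eta>/2) * real (card F')"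
        using big True by (intro mult_left_mono) (simp_all add: cardcov cardF')
      finally show ?thesis using low' by simp
    next
      case False
      have "(?L - \<eta>) * real (d i) \<le> 0" using False \<eta> by (intro mult_nonpos_nonneg) auto
      then show ?thesis using base.dyn_dim_nonneg_eq(2)[OF ne F' \<alpha>] by linarith
    qed
    moreover
    let ?S = "compose ?V \<pi> ` sofic_Map X \<phi> \<rho> F0 \<delta>0 (d i) ?s"
    have "ereal (base.dyn_dim \<alpha> F') \<le> cover_dim_on (power_space (d i) Y) ?S (power_cover (d i) \<alpha>)"
    proof -
      \<comment> \<open>The microstate of a point \<open>y\<close> is \<open>\<psi> (g v) y\<close>
        at \<open>v\<close>. On the tiles \<open>g\<close> runs through \<open>F'\<close>; uncovered
        points receive the unit as a default.\<close>
      obtain g where g: "\<And>p f. p \<in> P \<Longrightarrow> f \<in> snd p \<Longrightarrow> g (?s f (fst p)) = f \<otimes> c p"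
        and g1: "\<And>v. v \<notin> covered ?s P \<Longrightarrow> g v = \<one>"
        by (rule tiling_lift[OF P, of "\<lambda>p f. f \<otimes> c p" \<one>]) blast
      have gc: "g v \<in> carrier G" for v
      proof (cases "v \<in> covered ?s P")
        case True
        then obtain p f where "p \<in> P" "f \<in> snd p" "v = ?s f (fst p)"
          by (auto simp: covered_def tile_image_def)
        then show ?thesis using g Pfin c0 by (metis m_closed subsetD)
      qed (simp add: g1)
      have in_Map: "(\<lambda>v\<in>?V. \<phi> (g v) x) \<in> sofic_Map X \<phi> \<rho> F0 \<delta>0 (d i) ?s" if x: "x \<in> topspace X" for x
      proof -
        let ?\<xi> = "\<lambda>v\<in>?V. \<phi> (g v) x"
        have \<xi>: "?\<xi> \<in> topspace (power_space (d i) X)"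
          using x total.action_closed[OF gc] by (simp add: topspace_power_space)
        have "sqrt ((\<Sum>a\<in>?V. (\<rho> (?\<xi> (?s s a)) (\<phi> s (?\<xi> a)))\<^sup>2) / real (d i)) \<le> \<delta>0" if s: "s \<in> F0" for s
        proof -
          have sc: "s \<in> carrier G" "inv s \<in> K0" using s F0c by (auto simp: K0_def)
          \<comment> \<open>For \<open>a\<close> outside \<open>B\<close>, the points
            \<open>a\<close> and \<open>?s s a\<close> lie in the same tile and the microstate is
            exactly equivariant there. On \<open>B\<close>, which is sparse, distances are bounded
            by \<open>D\<close>.\<close>
          define B where "B = (?V - covered ?s P) \<union>
            (\<Union>p\<in>P. (\<lambda>f. ?s f (fst p)) ` (snd p - (inv s <# snd p)))"
          have B: "B \<subseteq> ?V"
            using cov by (auto simp: B_def covered_def tile_image_def)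
          have eq: "?\<xi> (?s s a) = \<phi> s (?\<xi> a)" if a: "a \<in> ?V" "a \<notin> B" for a
          proof -
            have "a \<in> covered ?s P" using a by (auto simp: B_def)
            then obtain p f where pf: "p \<in> P" "f \<in> snd p" "a = ?s f (fst p)"
              by (auto simp: covered_def tile_image_def)
            then have "f \<in> inv s <# snd p" using a(2) by (auto simp: B_def)
            then obtain f' where f': "f' \<in> snd p" "f = inv s \<otimes> f'" by (auto simp: l_coset_def)
            have fc: "f \<in> carrier G" "f' \<in> carrier G" using Pfin[OF pf(1)] pf(2) f'(1) by auto
            have sf: "s \<otimes> f = f'" using f'(2) fc sc by (simp add: m_assoc[symmetric])
            have sa: "?s s a = ?s f' (fst p)" using Pp(3)[OF pf(1) s pf(2)] pf(3) sf by simp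
            have "?s s a \<in> covered ?s P" using sa pf(1) f'(1) by (auto simp: covered_def tile_image_def)
            then have "?\<xi> (?s s a) = \<phi> (f' \<otimes> c p) x" using sa g[OF pf(1) f'(1)] cov by auto
            also have "f' \<otimes> c p = s \<otimes> (f \<otimes> c p)" using sf fc sc c0 pf(1) by (metis m_assoc)
            also have "\<phi> (s \<otimes> (f \<otimes> c p)) x = \<phi> s (\<phi> (f \<otimes> c p) x)"
              using sc fc c0 pf(1) x by (intro total.action_mult) auto
            also have "\<dots> = \<phi> s (?\<xi> a)" using a(1) g[OF pf(1,2)] pf(3) by simp
            finally show ?thesis .
          qed
          have cardB: "real (card B) \<le> (\<eta>' + 4 * \<epsilon>) * real (d i)"
          proof -
            have "card B \<le> card (?V - covered ?s P) +
                card (\<Union>p\<in>P. (\<lambda>f. ?s f (fst p)) ` (snd p - (inv s <# snd p)))"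
              unfolding B_def by (rule card_Un_le)
            also have "card (\<Union>p\<in>P. (\<lambda>f. ?s f (fst p)) ` (snd p - (inv s <# snd p))) \<le>
                (\<Sum>p\<in>P. card ((\<lambda>f. ?s f (fst p)) ` (snd p - (inv s <# snd p))))"
              by (rule card_UN_le[OF finP])
            also have "\<dots> \<le> (\<Sum>p\<in>P. card (snd p - (inv s <# snd p)))"
              using Pfin by (intro sum_mono card_image_le) auto
            finally have "real (card B) \<le> real (card (?V - covered ?s P)) +
                (\<Sum>p\<in>P. real (card (snd p - (inv s <# snd p))))"
              by (simp only: of_nat_le_iff flip: of_nat_sum of_nat_add)
            also have "\<dots> \<le> \<eta>' * real (d i) + (\<Sum>p\<in>P. 4 * \<epsilon> * real (card (snd p)))"
              using unc bdry sc(2) by (intro add_mono sum_mono) auto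
            also have "(\<Sum>p\<in>P. 4 * \<epsilon> * real (card (snd p))) = 4 * \<epsilon> * real (card (covered ?s P))"
              by (simp add: cardcov sum_distrib_left)
            also have "\<dots> \<le> 4 * \<epsilon> * real (d i)" using cardle \<epsilon>(1) by (intro mult_left_mono) auto
            finally show ?thesis by (simp add: algebra_simps)
          qed
          have "(\<Sum>a\<in>?V. (\<rho> (?\<xi> (?s s a)) (\<phi> s (?\<xi> a)))\<^sup>2) \<le> (\<Sum>a\<in>?V. if a \<in> B then D\<^sup>2 else 0)"
          proof (rule sum_mono)
            fix a assume a: "a \<in> ?V"
            have "?s s permutes ?V" using sof sc by (simp add: sofic_approximation_def)
            then have sa: "?s s a \<in> ?V" using a permutes_in_image by metis
            have X1: "?\<xi> (?s s a) \<in> topspace X" "\<phi> s (?\<xi> a) \<in> topspace X"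
              using sa a x by (auto intro!: total.action_closed sc gc)
            show "(\<rho> (?\<xi> (?s s a)) (\<phi> s (?\<xi> a)))\<^sup>2 \<le> (if a \<in> B then D\<^sup>2 else 0)"
            proof (cases "a \<in> B")
              case True
              then show ?thesis using D(2)[OF X1] by (simp add: power_mono)
            next
              case False
              then show ?thesis using eq[OF a] X1 by simp
            qed
          qed
          also have "\<dots> = D\<^sup>2 * real (card B)" using B by (simp add: sum.If_cases Int_absorb1)
          also have "\<dots> \<le> D\<^sup>2 * ((\<eta>' + 4 * \<epsilon>) * real (d i))" using cardB by (intro mult_left_mono) auto
          also have "\<dots> \<le> \<delta>0\<^sup>2 * real (d i)" using small by (simp add: mult_right_mono flip: mult.assoc)
          finally have "(\<Sum>a\<in>?V. (\<rho> (?\<xi> (?s s a)) (\<phi> s (?\<xi> a)))\<^sup>2) / real (d i) \<le> \<delta>0\<^sup>2"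
            using d by (simp add: pos_divide_le_eq)
          then show ?thesis using \<delta>0 by (intro real_le_lsqrt) (auto intro: sum_nonneg)
        qed
        then show ?thesis using \<xi> by (simp add: sofic_Map_def)
      qed
      let ?K = "subtopology (power_space (d i) Y) ?S"
      let ?\<gamma> = "(\<lambda>U. U \<inter> ?S) ` power_cover (d i) \<alpha>"
      have SY: "?S \<subseteq> topspace (power_space (d i) Y)"
        using surj by (auto simp: sofic_Map_def topspace_power_space compose_def PiE_iff)
      have cov\<gamma>: "finite_open_cover ?K ?\<gamma>"
        using finite_open_cover_power_cover[OF \<alpha>, of "d i"] SY
        by (auto simp: finite_open_cover_def openin_subtopology)
      have "cond_dim Y (discrete_topology {()}) (\<lambda>_. ()) (dyn_join Y \<psi> F' \<alpha>) \<le>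
          (\<Sum>u\<in>{()}. cond_dim ?K (discrete_topology {()}) (\<lambda>_. ()) ?\<gamma>)"
      proof (rule cond_dim_le_sum[OF base.metrizable ne, where \<theta> = "\<lambda>_ y. \<lambda>v\<in>?V. \<psi> (g v) y"])
        show "continuous_map Y ?K (\<lambda>y. \<lambda>v\<in>?V. \<psi> (g v) y)" for u :: unit
        proof (rule continuous_map_into_subtopology)
          show "continuous_map Y (power_space (d i) Y) (\<lambda>y. \<lambda>v\<in>?V. \<psi> (g v) y)"
            by (rule continuous_map_power_spaceI) (use base.continuous_action gc in auto)
          show "(\<lambda>y. \<lambda>v\<in>?V. \<psi> (g v) y) \<in> topspace Y \<rightarrow> ?S"
          proof
            fix y assume "y \<in> topspace Y"
            then obtain x where x: "x \<in> topspace X" "y = \<pi> x" using surj by blast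
            have "(\<lambda>v\<in>?V. \<psi> (g v) y) = compose ?V \<pi> (\<lambda>v\<in>?V. \<phi> (g v) x)"
              using equivariant[OF gc x(1)] x(2) by (auto simp: compose_def intro!: restrict_ext)
            then show "(\<lambda>v\<in>?V. \<psi> (g v) y) \<in> ?S" using in_Map[OF x(1)] by blast
          qed
        qed
      next
        fix U assume U: "U \<in> {()} \<rightarrow> ?\<gamma>"
        then obtain A where A: "A \<in> ?V \<rightarrow> \<alpha>" "U () = PiE ?V A \<inter> ?S"
          by (auto simp: power_cover_def)
        \<comment> \<open>Every element of \<open>F'\<close> is read off at some coordinate, so a
          choice of members of \<open>\<alpha>\<close> at all coordinates determines one along
          \<open>F'\<close>.\<close>
        have "\<exists>v\<in>?V. g v = b" if "b \<in> F'" for b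
        proof -
          obtain p f where pf: "p \<in> P" "f \<in> snd p" "b = f \<otimes> c p" using \<open>b \<in> F'\<close> by (auto simp: F'_def)
          then have "?s f (fst p) \<in> ?V" using cov by (force simp: covered_def tile_image_def)
          then show ?thesis using g[OF pf(1,2)] pf(3) by blast
        qed
        then obtain v where v: "\<And>b. b \<in> F' \<Longrightarrow> v b \<in> ?V \<and> g (v b) = b" by metis
        let ?W = "\<Inter>b\<in>F'. {y\<in>topspace Y. \<psi> b y \<in> A (v b)}"
        have "?W \<in> dyn_join Y \<psi> F' \<alpha>"
          unfolding dyn_join_def using v A(1) by (intro CollectI exI[of _ "\<lambda>b. A (v b)"]) auto
        moreover have "y \<in> ?W" if y: "y \<in> topspace Y" and yU: "(\<lambda>v\<in>?V. \<psi> (g v) y) \<in> U ()" for y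
        proof -
          have "\<psi> b y \<in> A (v b)" if "b \<in> F'" for b
          proof -
            have "(\<lambda>v\<in>?V. \<psi> (g v) y) (v b) \<in> A (v b)"
              using yU v[OF that] unfolding A(2) by (blast dest: PiE_mem)
            then show ?thesis using v[OF that] by simp
          qed
          then show ?thesis using y by auto
        qed
        ultimately show "\<exists>W\<in>dyn_join Y \<psi> F' \<alpha>. {y\<in>topspace Y. \<forall>u\<in>{()}. (\<lambda>v\<in>?V. \<psi> (g v) y) \<in> U u} \<subseteq> W"
          by (intro bexI[of _ ?W]) auto
      qed (use cov\<gamma> in auto)
      also have "\<dots> = cover_dim ?K ?\<gamma>"
        by (simp add: cond_dim_singleton[of "discrete_topology {()}" "()"])
      finally show ?thesis using base.dyn_dim_nonneg_eq(1)[OF ne F' \<alpha>] by (simp add: cover_dim_on_def)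
    qed
    ultimately have "ereal ((?L - \<eta>) * real (d i)) \<le>
        cover_dim_on (power_space (d i) Y) ?S (power_cover (d i) \<alpha>)"
      by (meson ereal_less_eq(3) order_trans)
    then have "ereal ((?L - \<eta>) * real (d i)) / ereal (real (d i)) \<le>
        cover_dim_on (power_space (d i) Y) ?S (power_cover (d i) \<alpha>) / ereal (real (d i))"
      using d by (intro ereal_divide_right_mono) auto
    then show ?case using d by simp
  qed
qed

end

section \<open>Covers of microstate spaces\<close>

lemma compatible_metric_uniformly_continuous:
  assumes "compact_space X" and "compatible_metric X \<rho>" and "compatible_metric Y \<rho>'"
    and "continuous_map X Y f" and "0 < \<kappa>"
  obtains \<delta> where "0 < \<delta>"
    and "\<And>x x'. x \<in> topspace X \<Longrightarrow> x' \<in> topspace X \<Longrightarrow> \<rho> x x' < \<delta> \<Longrightarrow> \<rho>' (f x) (f x') < \<kappa>"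
proof -
  interpret M: Metric_space "topspace X" \<rho> using assms by (simp add: compatible_metric_def)
  interpret M': Metric_space "topspace Y" \<rho>' using assms by (simp add: compatible_metric_def)
  have "M.mtopology = X" "M'.mtopology = Y" using assms by (simp_all add: compatible_metric_def)
  then have "uniformly_continuous_map (metric (topspace X, \<rho>)) (metric (topspace Y, \<rho>')) f"
    using assms by (intro continuous_imp_uniformly_continuous_map) simp
  then obtain \<delta> where "0 < \<delta>"
    "\<forall>x\<in>topspace X. \<forall>y\<in>topspace X. \<rho> y x < \<delta> \<longrightarrow> \<rho>' (f y) (f x) < \<kappa>"
    using assms(5) by (auto simp: uniformly_continuous_map_def)
  then show ?thesis using that by blast
qed

text \<open>\<open>\<kappa>\<close> is a third of a Lebesgue number: a point within
  \<open>2 * \<kappa>\<close> of a ball of radius \<open>\<kappa>\<close> is within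
  \<open>3 * \<kappa>\<close> of its centre. Later a predicted value will lie in a member of
  \<open>\<alpha>0\<close> and the true value nearby, hence in a member of
  \<open>\<alpha>\<close>.\<close>

lemma finite_open_cover_thickening:
  assumes "compact_space Y" and "compatible_metric Y \<rho>" and \<alpha>: "finite_open_cover Y \<alpha>"
  obtains \<alpha>0 \<kappa> where "finite_open_cover Y \<alpha>0" and "0 < \<kappa>"
    and "\<And>A. A \<in> \<alpha>0 \<Longrightarrow> \<exists>U\<in>\<alpha>. \<forall>u\<in>A. \<forall>w\<in>topspace Y. \<rho> w u < 2 * \<kappa> \<longrightarrow> w \<in> U"
proof -
  interpret M: Metric_space "topspace Y" \<rho> using assms by (simp add: compatible_metric_def)
  have Y: "M.mtopology = Y" using assms by (simp add: compatible_metric_def)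
  have "compactin M.mtopology (topspace Y)" using assms(1) by (simp add: Y compact_space_def)
  moreover have "topspace Y \<subseteq> \<Union>\<alpha>" "\<And>U. U \<in> \<alpha> \<Longrightarrow> openin M.mtopology U"
    using \<alpha> by (auto simp: finite_open_cover_def Y)
  ultimately obtain \<epsilon> where \<epsilon>: "0 < \<epsilon>" "\<And>y. y \<in> topspace Y \<Longrightarrow> \<exists>U\<in>\<alpha>. M.mball y \<epsilon> \<subseteq> U"
    using M.lebesgue_number by metis
  define \<kappa> where "\<kappa> = \<epsilon> / 3"
  have \<kappa>: "0 < \<kappa>" using \<epsilon> by (simp add: \<kappa>_def)
  have "\<exists>\<C>. finite \<C> \<and> \<C> \<subseteq> (\<lambda>y. M.mball y \<kappa>) ` topspace Y \<and> topspace Y \<subseteq> \<Union>\<C>"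
    using assms(1) unfolding compact_space_alt
    by (rule allE[of _ "(\<lambda>y. M.mball y \<kappa>) ` topspace Y"]) (use \<kappa> M.openin_mball Y in auto)
  then obtain \<alpha>0 where \<alpha>0: "finite \<alpha>0" "\<alpha>0 \<subseteq> (\<lambda>y. M.mball y \<kappa>) ` topspace Y" "topspace Y \<subseteq> \<Union>\<alpha>0"
    by blast
  have op: "openin Y A" if "A \<in> \<alpha>0" for A using \<alpha>0(2) that M.openin_mball Y by auto
  then have "\<Union>\<alpha>0 \<subseteq> topspace Y" using openin_subset by blast
  then have "finite_open_cover Y \<alpha>0" using \<alpha>0 op by (simp add: finite_open_cover_def subset_antisym)
  moreover have "\<exists>U\<in>\<alpha>. \<forall>u\<in>A. \<forall>w\<in>topspace Y. \<rho> w u < 2 * \<kappa> \<longrightarrow> w \<in> U" if A: "A \<in> \<alpha>0" for A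
  proof -
    obtain y where y: "y \<in> topspace Y" "A = M.mball y \<kappa>" using \<alpha>0(2) A by blast
    obtain U where U: "U \<in> \<alpha>" "M.mball y \<epsilon> \<subseteq> U" using \<epsilon>(2)[OF y(1)] by blast
    have "w \<in> U" if u: "u \<in> A" and w: "w \<in> topspace Y" "\<rho> w u < 2 * \<kappa>" for u w
    proof -
      have "\<rho> y w \<le> \<rho> y u + \<rho> u w" using u w y by (intro M.triangle) auto
      also have "\<dots> < \<epsilon>" using u w y by (simp add: \<kappa>_def M.commute[of u w])
      finally show ?thesis using U(2) y w by auto
    qed
    then show ?thesis using U(1) by blast
  qed
  ultimately show ?thesis using that \<kappa> by blast
qed

context factor_system
begin

text \<open>Markov's inequality for the squared distances, with \<open>\<kappa>'\<close> from the
  uniform continuity of \<open>\<pi>\<close> and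
  \<open>\<delta>\<^sup>2 = \<theta> * \<kappa>'\<^sup>2\<close>. The conclusion is about
  \<open>Y\<close> alone, so \<open>X\<close> leaves the upper bound here.\<close>

lemma sofic_Map_image_close:
  assumes \<rho>: "compatible_metric X \<rho>" and \<rho>': "compatible_metric Y \<rho>'" and "0 < \<kappa>" and "0 < \<theta>"
  obtains \<delta> where "0 < \<delta>"
    and "\<And>F D (s :: 'g \<Rightarrow> nat \<Rightarrow> nat) \<zeta> f. \<zeta> \<in> compose {1..D} \<pi> ` sofic_Map X \<phi> \<rho> F \<delta> D s \<Longrightarrow>
       f \<in> F \<Longrightarrow> f \<in> carrier G \<Longrightarrow> s f permutes {1..D} \<Longrightarrow>
       real (card {a\<in>{1..D}. \<kappa> \<le> \<rho>' (\<zeta> (s f a)) (\<psi> f (\<zeta> a))}) \<le> \<theta> * real D"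
proof -
  obtain \<kappa>' where \<kappa>': "0 < \<kappa>'"
    "\<And>x x'. x \<in> topspace X \<Longrightarrow> x' \<in> topspace X \<Longrightarrow> \<rho> x x' < \<kappa>' \<Longrightarrow> \<rho>' (\<pi> x) (\<pi> x') < \<kappa>"
    by (rule compatible_metric_uniformly_continuous[OF total.compact \<rho> \<rho>' continuous_factor \<open>0 < \<kappa>\<close>]) blast
  define \<delta> where "\<delta> = \<kappa>' * sqrt \<theta>"
  have \<delta>: "0 < \<delta>" using \<kappa>' assms by (simp add: \<delta>_def)
  have bound: "real (card {a\<in>{1..D}. \<kappa> \<le> \<rho>' (\<zeta> (s f a)) (\<psi> f (\<zeta> a))}) \<le> \<theta> * real D"
    if \<zeta>: "\<zeta> \<in> compose {1..D} \<pi> ` sofic_Map X \<phi> \<rho> F \<delta> D s" and f: "f \<in> F" "f \<in> carrier G"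
      and perm: "s f permutes {1..D}" for F D and s :: "'g \<Rightarrow> nat \<Rightarrow> nat" and \<zeta> f
  proof (cases "D = 0")
    case False
    let ?V = "{1..D}"
    obtain \<xi> where \<xi>: "\<xi> \<in> topspace (power_space D X)" "\<zeta> = compose ?V \<pi> \<xi>"
      and le: "sqrt ((\<Sum>a\<in>?V. (\<rho> (\<xi> (s f a)) (\<phi> f (\<xi> a)))\<^sup>2) / real D) \<le> \<delta>"
      using \<zeta> f(1) by (auto simp: sofic_Map_def)
    let ?B = "{a\<in>?V. \<kappa> \<le> \<rho>' (\<zeta> (s f a)) (\<psi> f (\<zeta> a))}"
    have big: "\<kappa>' \<le> \<rho> (\<xi> (s f a)) (\<phi> f (\<xi> a))" if a: "a \<in> ?B" for a
    proof (rule ccontr)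
      assume "\<not> ?thesis"
      then have lt: "\<rho> (\<xi> (s f a)) (\<phi> f (\<xi> a)) < \<kappa>'" by simp
      have aV: "a \<in> ?V" and sa: "s f a \<in> ?V" using a permutes_in_image[OF perm, of a] by auto
      have \<xi>X: "\<xi> a \<in> topspace X" "\<xi> (s f a) \<in> topspace X"
        using PiE_mem[OF \<xi>(1)[unfolded topspace_power_space] aV]
          PiE_mem[OF \<xi>(1)[unfolded topspace_power_space] sa] by auto
      have "\<rho>' (\<pi> (\<xi> (s f a))) (\<pi> (\<phi> f (\<xi> a))) < \<kappa>"
        using \<kappa>'(2)[OF \<xi>X(2) total.action_closed[OF f(2) \<xi>X(1)] lt] .
      then have "\<rho>' (\<zeta> (s f a)) (\<psi> f (\<zeta> a)) < \<kappa>"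
        using aV sa equivariant[OF f(2) \<xi>X(1)] by (simp add: \<xi>(2) compose_def)
      then show False using a by simp
    qed
    have "real (card ?B) * \<kappa>'\<^sup>2 = (\<Sum>a\<in>?B. \<kappa>'\<^sup>2)" by simp
    also have "\<dots> \<le> (\<Sum>a\<in>?B. (\<rho> (\<xi> (s f a)) (\<phi> f (\<xi> a)))\<^sup>2)"
      using big \<kappa>'(1) by (intro sum_mono power_mono) auto
    also have "\<dots> \<le> (\<Sum>a\<in>?V. (\<rho> (\<xi> (s f a)) (\<phi> f (\<xi> a)))\<^sup>2)"
      by (intro sum_mono2) auto
    also have "\<dots> \<le> \<delta>\<^sup>2 * real D"
      using sqrt_le_D[OF le] False by (simp add: pos_divide_le_eq)
    also have "\<dots> = (\<theta> * real D) * \<kappa>'\<^sup>2" using assms(4) by (simp add: \<delta>_def power_mult_distrib)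
    finally show ?thesis using \<kappa>'(1) by (simp only: mult_le_cancel_right_pos zero_less_power)
  qed simp
  show ?thesis by (rule that[OF \<delta>], rule bound)
qed

text \<open>The power cover is refined by joining covers that control \<open>\<zeta>\<close> at the centres of the tiles with
  covers that see \<open>\<zeta> v\<close> only where it deviates from the value predicted by its tile. The multiplicity
  of the join is additive at each point, so the latter contribute just at the few deviating \<open>v\<close>, although
  these depend on \<open>\<zeta>\<close>.\<close>

lemma cover_dim_on_le_tiling:
  assumes ne: "topspace Y \<noteq> {}" and \<rho>': "compatible_metric Y \<rho>'"
    and \<alpha>: "finite_open_cover Y \<alpha>" and \<alpha>0: "finite_open_cover Y \<alpha>0"
    and thick: "\<And>A. A \<in> \<alpha>0 \<Longrightarrow> \<exists>U\<in>\<alpha>. \<forall>u\<in>A. \<forall>w\<in>topspace Y. \<rho>' w u < 2 * \<kappa> \<longrightarrow> w \<in> U"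
    and \<kappa>: "0 < \<kappa>"
    and P: "tiling s {} \<F> \<epsilon> {1..D} P" and \<F>: "\<F> \<subseteq> fin_subsets G"
    and w: "\<And>F. F \<in> \<F> \<Longrightarrow> base.dyn_dim \<alpha>0 F \<le> a * real (card F)" and a: "0 \<le> a" and \<epsilon>: "\<epsilon> < 1"
    and unc: "real (card ({1..D} - covered s P)) \<le> u"
    and S: "S \<subseteq> topspace (power_space D Y)" and N: "finite N" "\<Union>\<F> \<subseteq> N"
    and close: "\<And>\<zeta> f. \<zeta> \<in> S \<Longrightarrow> f \<in> N \<Longrightarrow>
        real (card {v\<in>{1..D}. \<kappa> \<le> \<rho>' (\<zeta> (s f v)) (\<psi> f (\<zeta> v))}) \<le> \<theta>"
  shows "cover_dim_on (power_space D Y) S (power_cover D \<alpha>) \<le>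
    ereal (a / (1 - \<epsilon>) * real D + real (card \<alpha>) * (u + real (card N) * \<theta>))"
proof (cases "S = {}")
  case True
  have "cover_dim_on (power_space D Y) S (power_cover D \<alpha>) = -\<infinity>"
    using cond_dim_empty[of "subtopology (power_space D Y) S" "discrete_topology {()}" "\<lambda>_. ()"] True
    by (simp add: cover_dim_on_def cond_dim_singleton[of "discrete_topology {()}" "()"])
  then show ?thesis by simp
next
  case False
  let ?V = "{1..D}" and ?K = "subtopology (power_space D Y) S"
  interpret M: Metric_space "topspace Y" \<rho>' using \<rho>' by (simp add: compatible_metric_def)
  have topY: "M.mtopology = Y" using \<rho>' by (simp add: compatible_metric_def)
  have finP: "finite P" using P by (simp add: tiling_def)
  have fin\<F>: "finite F" if "F \<in> \<F>" for F using \<F> that by (auto simp: fin_subsets_def)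
  have topK: "topspace ?K = S" using S by (auto simp: topspace_subtopology)
  have neK: "topspace ?K \<noteq> {}" using topK False by simp
  have metK: "metrizable_space ?K"
    by (rule metrizable_space_subtopology[OF metrizable_power_space[OF base.metrizable]])
  have proj: "continuous_map ?K Y (\<lambda>\<zeta>. \<zeta> v)" if "v \<in> ?V" for v
    by (rule continuous_map_from_subtopology[OF continuous_map_power_space_proj[OF that]])
  have coord: "\<zeta> v \<in> topspace Y" if "\<zeta> \<in> S" "v \<in> ?V" for \<zeta> v
    using continuous_map_in[OF proj[OF that(2)], unfolded topK, OF that(1)] .
  have \<alpha>f: "finite \<alpha>" "\<Union>\<alpha> = topspace Y" "\<And>U. U \<in> \<alpha> \<Longrightarrow> openin Y U"
    using \<alpha> by (auto simp: finite_open_cover_def)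
  have PV: "fst p \<in> ?V" "\<exists>F\<in>\<F>. snd p \<subseteq> F \<and> (1 - \<epsilon>) * real (card F) \<le> real (card (snd p))"
    if "p \<in> P" for p using P that by (auto simp: tiling_def)
  define Q where "Q p F \<beta> k \<longleftrightarrow> F \<in> \<F> \<and> snd p \<subseteq> F \<and> (1 - \<epsilon>) * real (card F) \<le> real (card (snd p)) \<and>
      finite_open_cover Y \<beta> \<and> real k \<le> a * real (card F) \<and>
      (\<forall>B\<in>\<beta>. \<exists>U\<in>dyn_join Y \<psi> F \<alpha>0. B \<subseteq> U) \<and> (\<forall>y\<in>topspace Y. card {B\<in>\<beta>. y \<in> B} \<le> k + 1)"
    for p :: "nat \<times> 'g set" and F \<beta> k
  have "\<exists>F \<beta> k. Q p F \<beta> k" if p: "p \<in> P" for p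
  proof -
    obtain F where F: "F \<in> \<F>" "snd p \<subseteq> F" "(1 - \<epsilon>) * real (card F) \<le> real (card (snd p))"
      using PV(2)[OF p] by blast
    have FG: "F \<in> fin_subsets G" using F \<F> by blast
    obtain \<beta> k where \<beta>: "finite_open_cover Y \<beta>"
      and k: "cond_dim Y (discrete_topology {()}) (\<lambda>_. ()) (dyn_join Y \<psi> F \<alpha>0) = ereal (real k)"
      and ref: "\<And>B y. B \<in> \<beta> \<Longrightarrow> y \<in> topspace (discrete_topology {()}) \<Longrightarrow>
          \<exists>U\<in>dyn_join Y \<psi> F \<alpha>0. {x\<in>topspace Y. () = y} \<inter> B \<subseteq> U"
      and card: "\<And>y. y \<in> topspace Y \<Longrightarrow> card {B\<in>\<beta>. y \<in> B} \<le> k + 1"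
      by (rule cond_dim_attained[OF base.finite_open_cover_dyn_join[OF FG \<alpha>0] ne,
            of "discrete_topology {()}" "\<lambda>_. ()"]) blast
    have ref': "\<exists>U\<in>dyn_join Y \<psi> F \<alpha>0. B \<subseteq> U" if B: "B \<in> \<beta>" for B
    proof -
      have "B \<subseteq> topspace Y" using \<beta> B by (auto simp: finite_open_cover_def)
      then have "{x\<in>topspace Y. () = ()} \<inter> B = B" by blast
      then show ?thesis using ref[OF B, of "()"] by simp
    qed
    have "real k = base.dyn_dim \<alpha>0 F"
      using k base.dyn_dim_nonneg_eq(1)[OF ne FG \<alpha>0] by simp
    then have "real k \<le> a * real (card F)" using w[OF F(1)] by simp
    then have "Q p F \<beta> k" unfolding Q_def using F \<beta> by (intro conjI ballI ref' card)
    then show ?thesis by blast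
  qed
  then obtain F \<beta> k where Qp: "\<And>p. p \<in> P \<Longrightarrow> Q p (F p) (\<beta> p) (k p)" by metis
  \<comment> \<open>\<open>R v\<close> names a tile through \<open>v\<close> and the element leading
    from its centre to \<open>v\<close>. The function \<open>tgt v\<close> below predicts the value
    at \<open>v\<close> from the one at the centre, by equivariance along that tile.\<close>
  define R where "R v = (SOME pf. fst pf \<in> P \<and> snd pf \<in> snd (fst pf) \<and> v = s (snd pf) (fst (fst pf)))" for v
  have R: "fst (R v) \<in> P" "snd (R v) \<in> snd (fst (R v))" "v = s (snd (R v)) (fst (fst (R v)))"
    if v: "v \<in> covered s P" for v
  proof -
    have "\<exists>pf. fst pf \<in> P \<and> snd pf \<in> snd (fst pf) \<and> v = s (snd pf) (fst (fst pf))"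
    proof -
      obtain p f where "p \<in> P" "f \<in> snd p" "v = s f (fst p)"
        using v by (auto simp: covered_def tile_image_def)
      then show ?thesis by (intro exI[of _ "(p,f)"]) simp
    qed
    from someI_ex[OF this]
    show "fst (R v) \<in> P" "snd (R v) \<in> snd (fst (R v))" "v = s (snd (R v)) (fst (fst (R v)))"
      unfolding R_def by blast+
  qed
  define tgt where "tgt v \<zeta> = \<psi> (snd (R v)) (\<zeta> (fst (fst (R v))))" for v and \<zeta> :: "nat \<Rightarrow> 'b"
  have RG: "snd (R v) \<in> carrier G" "snd (R v) \<in> N" "snd (R v) \<in> F (fst (R v))" if v: "v \<in> covered s P" for v
  proof -
    have "F (fst (R v)) \<in> \<F>" "snd (R v) \<in> F (fst (R v))" using Qp[OF R(1)[OF v]] R(2)[OF v] by (auto simp: Q_def)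
    then show "snd (R v) \<in> carrier G" "snd (R v) \<in> N" "snd (R v) \<in> F (fst (R v))"
      using \<F> N(2) by (auto simp: fin_subsets_def)
  qed
  have cont_tgt: "continuous_map ?K Y (tgt v)" if v: "v \<in> covered s P" for v
    using continuous_map_compose[OF proj[OF PV(1)[OF R(1)[OF v]]] base.continuous_action[OF RG(1)[OF v]]]
    by (simp add: tgt_def[abs_def] o_def)
  define dev where "dev v \<zeta> = \<rho>' (\<zeta> v) (tgt v \<zeta>)" for v \<zeta>
  have covV: "covered s P \<subseteq> ?V" by (rule tiling_covered_subset[OF P])
  have cont_dev: "continuous_map ?K euclideanreal (dev v)" if v: "v \<in> covered s P" for v
    unfolding dev_def
    using continuous_map_mdist[of ?K "metric (topspace Y, \<rho>')" "\<lambda>\<zeta>. \<zeta> v" "tgt v"]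
      proj[OF subsetD[OF covV v]] cont_tgt[OF v] by (simp add: topY)
  \<comment> \<open>The overlap, where the deviation is between \<open>\<kappa>\<close> and
    \<open>2 * \<kappa>\<close>, lets two open sets cover \<open>S\<close>. An uncovered
    \<open>v\<close> has no predicted value and counts as deviating for every microstate.\<close>
  define near where "near v = (if v \<in> covered s P then {\<zeta>\<in>S. dev v \<zeta> < 2 * \<kappa>} else {})" for v
  define far where "far v = (if v \<in> covered s P then {\<zeta>\<in>S. \<kappa> < dev v \<zeta>} else S)" for v
  have opn: "openin ?K (near v)" "openin ?K (far v)" for v
  proof -
    have "openin ?K {\<zeta>\<in>topspace ?K. dev v \<zeta> \<in> {..<2 * \<kappa>}}" "openin ?K {\<zeta>\<in>topspace ?K. dev v \<zeta> \<in> {\<kappa><..}}"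
      if "v \<in> covered s P" by (rule openin_continuous_map_preimage[OF cont_dev[OF that]]; simp)+
    then show "openin ?K (near v)" "openin ?K (far v)"
      using openin_topspace[of ?K] unfolding near_def far_def topK by auto
  qed
  \<comment> \<open>At a microstate outside \<open>far v\<close> the cover
    \<open>\<gamma> (Inr v)\<close> has multiplicity at most one, which the term
    \<open>card J\<close> in \<open>cover_common_refinement\<close> cancels.\<close>
  define \<gamma> where "\<gamma> j = (case j of Inl p \<Rightarrow> (\<lambda>B. {\<zeta>\<in>S. \<zeta> (fst p) \<in> B}) ` \<beta> p
    | Inr v \<Rightarrow> insert (near v) ((\<lambda>U. far v \<inter> {\<zeta>\<in>S. \<zeta> v \<in> U}) ` \<alpha>))" for j :: "(nat \<times> 'g set) + nat"
  define J where "J = P <+> ?V"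
  have finJ: "finite J" using finP by (simp add: J_def)
  have cov\<gamma>: "finite_open_cover ?K (\<gamma> j)" if "j \<in> J" for j
  proof (cases j)
    case (Inl p)
    then have p: "p \<in> P" using that by (auto simp: J_def)
    have "finite_open_cover ?K ((\<lambda>B. {\<zeta>\<in>topspace ?K. \<zeta> (fst p) \<in> B}) ` \<beta> p)"
      using Qp[OF p] by (intro finite_open_cover_preimage[OF proj[OF PV(1)[OF p]]]) (simp add: Q_def)
    then show ?thesis unfolding topK by (simp add: Inl \<gamma>_def)
  next
    case (Inr v)
    then have v: "v \<in> ?V" using that by (auto simp: J_def)
    have op: "openin ?K {\<zeta>\<in>S. \<zeta> v \<in> U}" if "U \<in> \<alpha>" for U
      using openin_continuous_map_preimage[OF proj[OF v] \<alpha>f(3)[OF that]] unfolding topK .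
    have "\<exists>U\<in>\<alpha>. \<zeta> v \<in> U" if "\<zeta> \<in> S" for \<zeta>
      using coord[OF that v] \<alpha>f(2) by blast
    moreover have "S \<subseteq> near v \<union> far v" using \<kappa> by (auto simp: near_def far_def)
    ultimately have "S \<subseteq> \<Union>(\<gamma> j)" by (simp add: Inr \<gamma>_def) blast
    moreover have op\<gamma>: "openin ?K W" if "W \<in> \<gamma> j" for W
      using that opn op by (auto simp: Inr \<gamma>_def)
    moreover have "\<Union>(\<gamma> j) \<subseteq> S" using op\<gamma> openin_subset topK by blast
    moreover have "finite (\<gamma> j)" using \<alpha>f(1) by (simp add: Inr \<gamma>_def)
    ultimately show ?thesis unfolding finite_open_cover_def topK by (simp add: subset_antisym)
  qed
  obtain \<delta> where \<delta>: "finite_open_cover ?K \<delta>"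
    and \<delta>ref: "\<And>W. W \<in> \<delta> \<Longrightarrow> \<exists>U\<in>Pi J \<gamma>. \<forall>j\<in>J. W \<subseteq> U j"
    and card\<delta>: "\<And>\<zeta>. \<zeta> \<in> topspace ?K \<Longrightarrow>
      card {W\<in>\<delta>. \<zeta> \<in> W} + card J \<le> 1 + (\<Sum>j\<in>J. card {U\<in>\<gamma> j. \<zeta> \<in> U})"
    by (rule cover_common_refinement[OF metK finJ cov\<gamma>]) blast+
  define b where "b = a / (1 - \<epsilon>) * real D + real (card \<alpha>) * (u + real (card N) * \<theta>)"
  have cardb: "real (card {W\<in>\<delta>. \<zeta> \<in> W}) \<le> 1 + b" if \<zeta>: "\<zeta> \<in> S" for \<zeta>
  proof -
    define E where "E = {v\<in>covered s P. \<kappa> < dev v \<zeta>}"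
    \<comment> \<open>The hypothesis \<open>close\<close> counts positions for a fixed
      \<open>f\<close>, whereas deviating points come with the various elements of their tiles. Each
      is the image under some \<open>s f\<close>, \<open>f \<in> N\<close>, of a centre counted for
      that \<open>f\<close>.\<close>
    have "E \<subseteq> (\<Union>f\<in>N. s f ` {v\<in>?V. \<kappa> \<le> \<rho>' (\<zeta> (s f v)) (\<psi> f (\<zeta> v))})"
    proof
      fix v assume v: "v \<in> E"
      then have vc: "v \<in> covered s P" by (simp add: E_def)
      let ?f = "snd (R v)" and ?c = "fst (fst (R v))"
      have "\<kappa> \<le> \<rho>' (\<zeta> (s ?f ?c)) (\<psi> ?f (\<zeta> ?c))"
        using v R(3)[OF vc] by (simp add: E_def dev_def tgt_def)
      then have "v \<in> s ?f ` {v\<in>?V. \<kappa> \<le> \<rho>' (\<zeta> (s ?f v)) (\<psi> ?f (\<zeta> v))}"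
        using R(3)[OF vc] PV(1)[OF R(1)[OF vc]] by blast
      then show "v \<in> (\<Union>f\<in>N. s f ` {v\<in>?V. \<kappa> \<le> \<rho>' (\<zeta> (s f v)) (\<psi> f (\<zeta> v))})"
        using RG(2)[OF vc] by blast
    qed
    then have "card E \<le> card (\<Union>f\<in>N. s f ` {v\<in>?V. \<kappa> \<le> \<rho>' (\<zeta> (s f v)) (\<psi> f (\<zeta> v))})"
      using N(1) by (intro card_mono) auto
    also have "\<dots> \<le> (\<Sum>f\<in>N. card (s f ` {v\<in>?V. \<kappa> \<le> \<rho>' (\<zeta> (s f v)) (\<psi> f (\<zeta> v))}))"
      by (rule card_UN_le[OF N(1)])
    also have "\<dots> \<le> (\<Sum>f\<in>N. card {v\<in>?V. \<kappa> \<le> \<rho>' (\<zeta> (s f v)) (\<psi> f (\<zeta> v))})"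
      by (intro sum_mono card_image_le) auto
    finally have "real (card E) \<le> (\<Sum>f\<in>N. real (card {v\<in>?V. \<kappa> \<le> \<rho>' (\<zeta> (s f v)) (\<psi> f (\<zeta> v))}))"
      by (simp only: of_nat_le_iff flip: of_nat_sum)
    also have "\<dots> \<le> (\<Sum>f\<in>N. \<theta>)" by (intro sum_mono close[OF \<zeta>])
    finally have cardE: "real (card E) \<le> real (card N) * \<theta>" by simp
    define H where "H = (?V - covered s P) \<union> E"
    have HV: "H \<subseteq> ?V" using covV by (auto simp: H_def E_def)
    have "card H \<le> card (?V - covered s P) + card E" unfolding H_def by (rule card_Un_le)
    then have cardH: "real (card H) \<le> u + real (card N) * \<theta>" using unc cardE by linarith
    have cl: "card {U\<in>\<gamma> (Inl p). \<zeta> \<in> U} \<le> k p + 1" if p: "p \<in> P" for p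
    proof -
      have fy: "\<zeta> (fst p) \<in> topspace Y" using coord[OF \<zeta> PV(1)[OF p]] .
      have "card {U\<in>\<gamma> (Inl p). \<zeta> \<in> U} \<le> card {B\<in>\<beta> p. \<zeta> (fst p) \<in> B}"
        using Qp[OF p] by (simp only: \<gamma>_def sum.case, intro card_preimage_family_le)
          (auto simp: Q_def finite_open_cover_def)
      also have "\<dots> \<le> k p + 1" using Qp[OF p] fy by (simp add: Q_def)
      finally show ?thesis .
    qed
    have cr: "card {U\<in>\<gamma> (Inr v). \<zeta> \<in> U} \<le> 1 + (if v \<in> H then card \<alpha> else 0)" if v: "v \<in> ?V" for v
    proof (cases "v \<in> H")
      case True
      have "card {U\<in>\<gamma> (Inr v). \<zeta> \<in> U} \<le> card (\<gamma> (Inr v))"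
        using \<alpha>f(1) by (intro card_mono) (auto simp: \<gamma>_def)
      also have "\<dots> \<le> Suc (card ((\<lambda>U. far v \<inter> {\<zeta>\<in>S. \<zeta> v \<in> U}) ` \<alpha>))"
        by (simp add: \<gamma>_def card_insert_le_m1 \<alpha>f(1) card_insert_if)
      also have "\<dots> \<le> Suc (card \<alpha>)" using card_image_le[OF \<alpha>f(1)] by simp
      finally show ?thesis using True by simp
    next
      case False
      then have "\<zeta> \<notin> far v" using v by (auto simp: H_def E_def far_def)
      then have "{U\<in>\<gamma> (Inr v). \<zeta> \<in> U} \<subseteq> {near v}" by (auto simp: \<gamma>_def)
      then have "card {U\<in>\<gamma> (Inr v). \<zeta> \<in> U} \<le> card {near v}" by (intro card_mono) auto
      then show ?thesis by simp
    qed
    have "(\<Sum>j\<in>J. card {U\<in>\<gamma> j. \<zeta> \<in> U}) =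
        (\<Sum>p\<in>P. card {U\<in>\<gamma> (Inl p). \<zeta> \<in> U}) + (\<Sum>v\<in>?V. card {U\<in>\<gamma> (Inr v). \<zeta> \<in> U})"
      unfolding J_def using finP by (simp add: sum.Plus)
    also have "\<dots> \<le> (\<Sum>p\<in>P. k p + 1) + (\<Sum>v\<in>?V. 1 + (if v \<in> H then card \<alpha> else 0))"
      using cl cr by (intro add_mono sum_mono) auto
    also have "\<dots> = (\<Sum>p\<in>P. k p) + card P + (D + card \<alpha> * card H)"
      using HV by (simp only: sum.distrib) (simp add: sum.If_cases Int_absorb1)
    finally have "card {W\<in>\<delta>. \<zeta> \<in> W} + card J \<le> 1 + ((\<Sum>p\<in>P. k p) + card P + (D + card \<alpha> * card H))"
      using card\<delta>[unfolded topK, OF \<zeta>] by linarith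
    moreover have "card J = card P + D" unfolding J_def using finP by (simp add: card_Plus)
    ultimately have "card {W\<in>\<delta>. \<zeta> \<in> W} \<le> 1 + (\<Sum>p\<in>P. k p) + card \<alpha> * card H" by simp
    then have "real (card {W\<in>\<delta>. \<zeta> \<in> W}) \<le> 1 + (\<Sum>p\<in>P. real (k p)) + real (card \<alpha>) * real (card H)"
      unfolding of_nat_sum[symmetric] of_nat_mult[symmetric] by linarith
    also have "(\<Sum>p\<in>P. real (k p)) \<le> (\<Sum>p\<in>P. a / (1 - \<epsilon>) * real (card (snd p)))"
    proof (rule sum_mono)
      fix p assume p: "p \<in> P"
      have "real (card (F p)) \<le> real (card (snd p)) / (1 - \<epsilon>)"
        using Qp[OF p] \<epsilon> by (simp add: Q_def pos_le_divide_eq mult.commute)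
      then have "a * real (card (F p)) \<le> a * (real (card (snd p)) / (1 - \<epsilon>))"
        using a by (rule mult_left_mono)
      then show "real (k p) \<le> a / (1 - \<epsilon>) * real (card (snd p))" using Qp[OF p] by (simp add: Q_def)
    qed
    also have "\<dots> = a / (1 - \<epsilon>) * real (card (covered s P))"
      using card_covered[OF P fin\<F>] by (simp add: sum_distrib_left)
    also have "\<dots> \<le> a / (1 - \<epsilon>) * real D"
    proof (rule mult_left_mono)
      have "card (covered s P) \<le> card ?V" using covV by (intro card_mono) auto
      then show "real (card (covered s P)) \<le> real D" by simp
    qed (use a \<epsilon> in simp)
    also have "real (card \<alpha>) * real (card H) \<le> real (card \<alpha>) * (u + real (card N) * \<theta>)"
      using cardH by (intro mult_left_mono) auto
    finally show ?thesis by (simp add: b_def)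
  qed
  \<comment> \<open>Orders are integers, so the real bound \<open>b\<close> may be rounded down.
    That \<open>b\<close> is nonnegative, as \<open>nat\<close> requires, follows from
    \<open>cardb\<close>, because some member of \<open>\<delta>\<close> contains a given point of
    \<open>S\<close>.\<close>
  have "cond_dim ?K (discrete_topology {()}) (\<lambda>_. ()) ((\<lambda>U. U \<inter> S) ` power_cover D \<alpha>) \<le> ereal (real (nat \<lfloor>b\<rfloor>))"
  proof (rule cond_dim_le[OF \<delta> neK])
    fix \<zeta> assume "\<zeta> \<in> topspace ?K"
    then have "real (card {W\<in>\<delta>. \<zeta> \<in> W}) \<le> 1 + b" unfolding topK by (rule cardb)
    then have "int (card {W\<in>\<delta>. \<zeta> \<in> W}) \<le> \<lfloor>1 + b\<rfloor>" by (subst le_floor_iff) simp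
    then show "card {U\<in>\<delta>. \<zeta> \<in> U} \<le> nat \<lfloor>b\<rfloor> + 1" by linarith
  next
    fix W and y :: unit
    assume W: "W \<in> \<delta>"
    obtain U where U: "U \<in> Pi J \<gamma>" "\<And>j. j \<in> J \<Longrightarrow> W \<subseteq> U j" using \<delta>ref[OF W] by blast
    have WS: "W \<subseteq> S" using \<delta> W unfolding finite_open_cover_def topK by blast
    have "\<exists>A\<in>\<alpha>. \<forall>\<zeta>\<in>W. \<zeta> v \<in> A" if v: "v \<in> ?V" for v
    proof (cases "W = {}")
      case True
      have "\<alpha> \<noteq> {}" using \<alpha>f(2) ne by blast
      then show ?thesis using True by auto
    next
      case Wne: False
      have vJ: "Inr v \<in> J" unfolding J_def by (rule InrI[OF v])
      have "U (Inr v) \<in> \<gamma> (Inr v)" using U(1) vJ by blast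
      then consider "U (Inr v) = near v" | A where "A \<in> \<alpha>" "U (Inr v) = far v \<inter> {\<zeta>\<in>S. \<zeta> v \<in> A}"
        by (auto simp: \<gamma>_def)
      then show ?thesis
      proof cases
        case 2
        then show ?thesis using U(2)[OF vJ] by blast
      next
        case 1
        \<comment> \<open>The cover attached to the tile confines the predicted value to one member
          of \<open>\<alpha>0\<close>, and \<open>near v\<close> confines the true value to within
          \<open>2 * \<kappa>\<close> of it; \<open>thick\<close> then gives one member of
          \<open>\<alpha>\<close> for all of \<open>W\<close>.\<close>
        then have Wnear: "W \<subseteq> near v" using U(2)[OF vJ] by simp
        then have vc: "v \<in> covered s P" using Wne by (auto simp: near_def split: if_splits)
        let ?p = "fst (R v)" and ?f = "snd (R v)"
        have pJ: "Inl ?p \<in> J" unfolding J_def by (rule InlI[OF R(1)[OF vc]])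
        have "U (Inl ?p) \<in> \<gamma> (Inl ?p)" using U(1) pJ by blast
        then obtain B where B: "B \<in> \<beta> ?p" "U (Inl ?p) = {\<zeta>\<in>S. \<zeta> (fst ?p) \<in> B}"
          by (auto simp: \<gamma>_def)
        obtain C where C: "C \<in> dyn_join Y \<psi> (F ?p) \<alpha>0" "B \<subseteq> C"
          using Qp[OF R(1)[OF vc]] B(1) unfolding Q_def by blast
        obtain A0 where A0: "A0 \<in> F ?p \<rightarrow> \<alpha>0" "C = (\<Inter>s\<in>F ?p. {x\<in>topspace Y. \<psi> s x \<in> A0 s})"
          using C(1) unfolding dyn_join_def by blast
        have fF: "?f \<in> F ?p" by (rule RG(3)[OF vc])
        then have "A0 ?f \<in> \<alpha>0" using A0(1) by blast
        then obtain A where A: "A \<in> \<alpha>" "\<And>x w. x \<in> A0 ?f \<Longrightarrow> w \<in> topspace Y \<Longrightarrow> \<rho>' w x < 2 * \<kappa> \<Longrightarrow> w \<in> A"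
          using thick by blast
        have "\<zeta> v \<in> A" if \<zeta>: "\<zeta> \<in> W" for \<zeta>
        proof (rule A(2))
          have "\<zeta> (fst ?p) \<in> C" using U(2)[OF pJ] \<zeta> B(2) C(2) by blast
          then show "tgt v \<zeta> \<in> A0 ?f" using A0(2) fF by (auto simp: tgt_def)
          show "\<zeta> v \<in> topspace Y" using coord[OF _ v] \<zeta> WS by blast
          show "\<rho>' (\<zeta> v) (tgt v \<zeta>) < 2 * \<kappa>" using Wnear \<zeta> vc by (auto simp: near_def dev_def)
        qed
        then show ?thesis using A(1) by blast
      qed
    qed
    then obtain A where A: "\<And>v. v \<in> ?V \<Longrightarrow> A v \<in> \<alpha> \<and> (\<forall>\<zeta>\<in>W. \<zeta> v \<in> A v)" by metis
    have "W \<subseteq> PiE ?V A \<inter> S"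
    proof
      fix \<zeta> assume \<zeta>: "\<zeta> \<in> W"
      then have "\<zeta> \<in> extensional ?V" using WS S by (auto simp: topspace_power_space PiE_iff)
      then show "\<zeta> \<in> PiE ?V A \<inter> S" using A \<zeta> WS by (auto simp: PiE_iff)
    qed
    moreover have "PiE ?V A \<in> power_cover D \<alpha>" unfolding power_cover_def using A by blast
    ultimately show "\<exists>C\<in>(\<lambda>U. U \<inter> S) ` power_cover D \<alpha>. {\<zeta>\<in>topspace ?K. () = y} \<inter> W \<subseteq> C" by blast
  qed
  moreover have "real (nat \<lfloor>b\<rfloor>) \<le> b"
  proof -
    obtain \<zeta> where \<zeta>: "\<zeta> \<in> S" using False by blast
    then obtain W where W: "W \<in> \<delta>" "\<zeta> \<in> W" using \<delta> unfolding finite_open_cover_def topK by blast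
    have "finite \<delta>" using \<delta> by (simp add: finite_open_cover_def)
    then have "0 < card {W\<in>\<delta>. \<zeta> \<in> W}" using W by (auto simp: card_gt_0_iff)
    then have "0 \<le> b" using cardb[OF \<zeta>] by linarith
    then show ?thesis by simp
  qed
  ultimately show ?thesis
    unfolding cover_dim_on_def b_def[symmetric]
    by (simp add: cond_dim_singleton[of "discrete_topology {()}" "()"] order_trans[of _ "ereal (real (nat \<lfloor>b\<rfloor>))"])
qed

text \<open>The cover \<open>\<alpha>0\<close> is found before \<open>\<eta>\<close>, so
  \<open>\<eta>\<close> can tend to 0 with the rate of \<open>\<alpha>0\<close> as the
  bound.\<close>

lemma sofic_upper:
  assumes nb: "invariance_filter G \<noteq> bot"
    and sof: "sofic_approximation G d \<sigma>" and \<rho>: "compatible_metric X \<rho>"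
    and ne: "topspace Y \<noteq> {}" and \<alpha>: "finite_open_cover Y \<alpha>"
  obtains \<alpha>0 where "finite_open_cover Y \<alpha>0"
    and "\<And>\<eta>. 0 < \<eta> \<Longrightarrow> \<exists>F\<in>fin_subsets G. \<exists>\<delta>>0. eventually (\<lambda>i.
      cover_dim_on (power_space (d i) Y) (compose {1..d i} \<pi> ` sofic_Map X \<phi> \<rho> F \<delta> (d i) (\<sigma> i))
        (power_cover (d i) \<alpha>) / ereal (real (d i)) \<le> ereal (base.rate \<alpha>0 + \<eta>)) sequentially"
proof -
  obtain \<rho>' where \<rho>': "compatible_metric Y \<rho>'"
    using base.metrizable by (auto simp: metrizable_space_def compatible_metric_def Metric_space.topspace_mtopology)
  obtain \<alpha>0 \<kappa> where \<alpha>0: "finite_open_cover Y \<alpha>0" and \<kappa>: "0 < \<kappa>"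
    and thick: "\<And>A. A \<in> \<alpha>0 \<Longrightarrow> \<exists>U\<in>\<alpha>. \<forall>u\<in>A. \<forall>w\<in>topspace Y. \<rho>' w u < 2 * \<kappa> \<longrightarrow> w \<in> U"
    by (rule finite_open_cover_thickening[OF base.compact \<rho>' \<alpha>]) blast
  let ?L = "base.rate \<alpha>0"
  have L: "0 \<le> ?L" by (rule base.rate(2)[OF nb ne \<alpha>0])
  have bound: "\<exists>F\<in>fin_subsets G. \<exists>\<delta>>0. eventually (\<lambda>i.
      cover_dim_on (power_space (d i) Y) (compose {1..d i} \<pi> ` sofic_Map X \<phi> \<rho> F \<delta> (d i) (\<sigma> i))
        (power_cover (d i) \<alpha>) / ereal (real (d i)) \<le> ereal (?L + \<eta>)) sequentially" if \<eta>: "0 < \<eta>" for \<eta>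
  proof -
    have \<eta>4: "0 < \<eta> / 4" using \<eta> by simp
    have a: "0 \<le> ?L + \<eta>/4" using L \<eta> by simp
    obtain \<epsilon> where \<epsilon>: "0 < \<epsilon>" "\<epsilon> \<le> 1/2" "(?L + \<eta>/4) / (1 - \<epsilon>) \<le> ?L + \<eta>/4 + \<eta>/4"
      by (rule divide_one_minus_le[OF a \<eta>4])
    \<comment> \<open>The error \<open>\<eta>\<close> is spent in four quarters: on the shapes
      exceeding the rate, on trimming, on uncovered points and on deviating points. A point of the
      last two kinds costs up to \<open>card \<alpha>\<close>; the \<open>+ 1\<close> keeps
      \<open>m\<close> positive.\<close>
    define m where "m = real (card \<alpha>) + 1"
    have m: "0 < m" "real (card \<alpha>) \<le> m" by (auto simp: m_def)
    define \<eta>' where "\<eta>' = \<eta> / (4 * m)"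
    have \<eta>': "0 < \<eta>'" "m * \<eta>' = \<eta> / 4" using \<eta> m by (auto simp: \<eta>'_def)
    have K: "finite {}" "{} \<subseteq> carrier G" by auto
    obtain \<F> T \<delta> where \<F>: "finite \<F>" "\<F> \<subseteq> fin_subsets G"
      "\<And>F. F \<in> \<F> \<Longrightarrow> base.dyn_dim \<alpha>0 F \<le> (?L + \<eta>/4) * real (card F)"
      and T: "finite T" "T \<subseteq> carrier G" and \<delta>: "0 < \<delta>"
      and til: "\<And>(V::nat set) \<sigma>. finite V \<Longrightarrow> real (card (V - good_points \<sigma> T V)) \<le> \<delta> * real (card V) \<Longrightarrow>
        \<exists>P. tiling \<sigma> {} \<F> \<epsilon> V P \<and> real (card (V - covered \<sigma> P)) \<le> \<eta>' * real (card V)"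
      by (rule quasi_tiling[OF base.frequently_dyn_dim_le_rate[OF nb ne \<alpha>0 \<eta>4] K \<epsilon>(1,2) \<eta>'(1),
            where ?'v = nat]) blast
    \<comment> \<open>\<open>N\<close> is the set for which microstates are tested, and it contains
      all elements used by the tiles. The unit keeps it nonempty, as \<open>fin_subsets\<close>
      demands.\<close>
    define N where "N = insert \<one> (\<Union>\<F>)"
    have Nc: "finite N" "N \<subseteq> carrier G" "N \<noteq> {}" using \<F>(1,2) by (auto simp: N_def fin_subsets_def)
    then have N: "N \<in> fin_subsets G" by (simp add: fin_subsets_def)
    have Npos: "0 < real (card N)" using Nc by (simp add: card_gt_0_iff)
    define \<theta> where "\<theta> = \<eta>' / real (card N)"
    have \<theta>: "0 < \<theta>" "real (card N) * \<theta> = \<eta>'" using \<eta>'(1) Npos by (auto simp: \<theta>_def)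
    obtain \<delta>' where \<delta>': "0 < \<delta>'"
      and close: "\<And>F D (s :: 'g \<Rightarrow> nat \<Rightarrow> nat) \<zeta> f. \<zeta> \<in> compose {1..D} \<pi> ` sofic_Map X \<phi> \<rho> F \<delta>' D s \<Longrightarrow>
       f \<in> F \<Longrightarrow> f \<in> carrier G \<Longrightarrow> s f permutes {1..D} \<Longrightarrow>
       real (card {a\<in>{1..D}. \<kappa> \<le> \<rho>' (\<zeta> (s f a)) (\<psi> f (\<zeta> a))}) \<le> \<theta> * real D"
      by (rule sofic_Map_image_close[OF \<rho> \<rho>' \<kappa> \<theta>(1)]) blast
    have dpos: "eventually (\<lambda>i. 1 \<le> d i) sequentially"
      using sof by (simp add: sofic_approximation_def filterlim_at_top)
    have "eventually (\<lambda>i.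
      cover_dim_on (power_space (d i) Y) (compose {1..d i} \<pi> ` sofic_Map X \<phi> \<rho> N \<delta>' (d i) (\<sigma> i))
        (power_cover (d i) \<alpha>) / ereal (real (d i)) \<le> ereal (?L + \<eta>)) sequentially"
      using sofic_good_points[OF sof T \<delta>] dpos
    proof eventually_elim
      case (elim i)
      let ?V = "{1..d i}" and ?S = "compose {1..d i} \<pi> ` sofic_Map X \<phi> \<rho> N \<delta>' (d i) (\<sigma> i)"
      have dp: "0 < real (d i)" using elim by simp
      obtain P where P: "tiling (\<sigma> i) {} \<F> \<epsilon> ?V P"
        and unc: "real (card (?V - covered (\<sigma> i) P)) \<le> \<eta>' * real (d i)"
        using til[of ?V "\<sigma> i"] elim by auto
      have "cover_dim_on (power_space (d i) Y) ?S (power_cover (d i) \<alpha>) \<le>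
        ereal ((?L + \<eta>/4) / (1 - \<epsilon>) * real (d i) +
          real (card \<alpha>) * (\<eta>' * real (d i) + real (card N) * (\<theta> * real (d i))))"
      proof (rule cover_dim_on_le_tiling[OF ne \<rho>' \<alpha> \<alpha>0 thick \<kappa> P \<F>(2,3) a _ unc])
        show "?S \<subseteq> topspace (power_space (d i) Y)"
          using surj by (auto simp: sofic_Map_def topspace_power_space compose_def PiE_iff)
        show "\<Union>\<F> \<subseteq> N" by (auto simp: N_def)
        fix \<zeta> f assume "\<zeta> \<in> ?S" "f \<in> N"
        moreover have "\<sigma> i f permutes ?V" using sof Nc \<open>f \<in> N\<close> by (auto simp: sofic_approximation_def)
        ultimately show "real (card {v\<in>?V. \<kappa> \<le> \<rho>' (\<zeta> (\<sigma> i f v)) (\<psi> f (\<zeta> v))}) \<le> \<theta> * real (d i)"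
          using Nc by (intro close) auto
      qed (use \<epsilon> Nc in auto)
      also have "\<dots> \<le> ereal ((?L + \<eta>) * real (d i))"
      proof -
        have "real (card N) * (\<theta> * real (d i)) = \<eta>' * real (d i)"
          using \<theta>(2) by (simp only: mult.assoc[symmetric])
        then have "real (card \<alpha>) * (\<eta>' * real (d i) + real (card N) * (\<theta> * real (d i))) =
            real (card \<alpha>) * (2 * \<eta>' * real (d i))" by simp
        also have "\<dots> \<le> m * (2 * \<eta>' * real (d i))"
          using m(2) \<eta>'(1) by (intro mult_right_mono) simp_all
        also have "\<dots> = \<eta> / 2 * real (d i)" using \<eta>'(2) by simp
        finally have "real (card \<alpha>) * (\<eta>' * real (d i) + real (card N) * (\<theta> * real (d i))) \<le> \<eta> / 2 * real (d i)" .
        moreover have "(?L + \<eta>/4) / (1 - \<epsilon>) * real (d i) \<le> (?L + \<eta>/2) * real (d i)"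
          using \<epsilon>(3) by (intro mult_right_mono) auto
        ultimately show ?thesis by (simp add: distrib_right)
      qed
      finally have "cover_dim_on (power_space (d i) Y) ?S (power_cover (d i) \<alpha>) / ereal (real (d i)) \<le>
          ereal ((?L + \<eta>) * real (d i)) / ereal (real (d i))"
        using dp by (intro ereal_divide_right_mono) auto
      then show ?case using dp by simp
    qed
    then show ?thesis using N \<delta>' by blast
  qed
  show ?thesis by (rule that[OF \<alpha>0], rule bound)
qed



text \<open>The lower bound compares each cover with itself, the upper bound compares
  \<open>\<alpha>\<close> with another cover \<open>\<alpha>0\<close>; the supremum over covers
  absorbs the change.\<close>

theorem sofic_mdim_eq_mdim:
  assumes nb: "invariance_filter G \<noteq> bot" and inf: "infinite (carrier G)"
    and sof: "sofic_approximation G d \<sigma>" and \<rho>: "compatible_metric X \<rho>"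
  shows "sofic_mdim G d \<sigma> X \<phi> \<rho> Y \<pi> = cond_mdim G Y \<psi> (discrete_topology {()}) (\<lambda>_. ())"
proof -
  let ?D = "\<lambda>\<alpha> F \<delta> i. cover_dim_on (power_space (d i) Y)
      (compose {1..d i} \<pi> ` sofic_Map X \<phi> \<rho> F \<delta> (d i) (\<sigma> i)) (power_cover (d i) \<alpha>) / ereal (real (d i))"
  have dpos: "eventually (\<lambda>i. 1 \<le> d i) sequentially"
    using sof by (simp add: sofic_approximation_def filterlim_at_top)
  show ?thesis
  proof (cases "topspace Y = {}")
    case True
    then have X0: "topspace X = {}" using surj by simp
    have lim: "limsup (?D \<alpha> F \<delta>) = -\<infinity>" for \<alpha> F \<delta>
    proof -
      have "eventually (\<lambda>i. ?D \<alpha> F \<delta> i = -\<infinity>) sequentially"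
        using dpos
      proof eventually_elim
        case (elim i)
        have "sofic_Map X \<phi> \<rho> F \<delta> (d i) (\<sigma> i) = {}"
          using power_space_empty_iff[OF elim, of X] X0 by (auto simp: sofic_Map_def)
        then have "cover_dim_on (power_space (d i) Y)
            (compose {1..d i} \<pi> ` sofic_Map X \<phi> \<rho> F \<delta> (d i) (\<sigma> i)) (power_cover (d i) \<alpha>) = -\<infinity>"
          using cond_dim_empty[of "subtopology (power_space (d i) Y) {}" "discrete_topology {()}" "\<lambda>_. ()"]
          by (simp add: cover_dim_on_def cond_dim_singleton[of "discrete_topology {()}" "()"])
        then show ?case using elim by (simp add: divide_ereal_def)
      qed
      then have "limsup (?D \<alpha> F \<delta>) = limsup (\<lambda>_. -\<infinity>)" by (rule Limsup_eq)
      then show ?thesis by (simp add: Limsup_const)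
    qed
    have "{\<one>} \<in> fin_subsets G" by (simp add: fin_subsets_def)
    then have "fin_subsets G \<noteq> {}" by blast
    moreover have "{0<..} \<noteq> ({} :: real set)" by (metis ex_in_conv greaterThan_iff zero_less_one)
    moreover have "{\<alpha>. finite_open_cover Y \<alpha>} \<noteq> {}" using finite_open_cover_topspace by blast
    ultimately have "sofic_mdim G d \<sigma> X \<phi> \<rho> Y \<pi> = -\<infinity>"
      unfolding sofic_mdim_def lim by simp
    then show ?thesis using base.cond_mdim_empty[OF nb True] by simp
  next
    case ne: False
    show ?thesis
      unfolding sofic_mdim_def base.cond_mdim_eq_SUP_rate[OF nb ne]
    proof (rule antisym)
      show "(SUP \<alpha>\<in>{\<alpha>. finite_open_cover Y \<alpha>}. INF F\<in>fin_subsets G. INF \<delta>\<in>{0<..}. limsup (?D \<alpha> F \<delta>))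
          \<le> (SUP \<alpha>\<in>{\<alpha>. finite_open_cover Y \<alpha>}. ereal (base.rate \<alpha>))"
      proof (rule SUP_mono)
        fix \<alpha> assume "\<alpha> \<in> {\<alpha>. finite_open_cover Y \<alpha>}"
        then have \<alpha>: "finite_open_cover Y \<alpha>" by simp
        obtain \<alpha>0 where \<alpha>0: "finite_open_cover Y \<alpha>0"
          and up: "\<And>\<eta>. 0 < \<eta> \<Longrightarrow> \<exists>F\<in>fin_subsets G. \<exists>\<delta>>0. eventually (\<lambda>i.
            ?D \<alpha> F \<delta> i \<le> ereal (base.rate \<alpha>0 + \<eta>)) sequentially"
          by (rule sofic_upper[OF nb sof \<rho> ne \<alpha>]) blast
        have "(INF F\<in>fin_subsets G. INF \<delta>\<in>{0<..}. limsup (?D \<alpha> F \<delta>)) \<le> ereal (base.rate \<alpha>0)"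
        proof (rule ereal_le_epsilon2)
          fix \<eta> :: real assume "0 < \<eta>"
          then obtain F \<delta> where F: "F \<in> fin_subsets G" "0 < \<delta>"
            and ev: "eventually (\<lambda>i. ?D \<alpha> F \<delta> i \<le> ereal (base.rate \<alpha>0 + \<eta>)) sequentially"
            using up by blast
          have "(INF F\<in>fin_subsets G. INF \<delta>\<in>{0<..}. limsup (?D \<alpha> F \<delta>)) \<le> limsup (?D \<alpha> F \<delta>)"
            using F by (intro INF_lower2[OF F(1)] INF_lower2[of \<delta>]) auto
          also have "\<dots> \<le> ereal (base.rate \<alpha>0 + \<eta>)" by (rule Limsup_bounded[OF ev])
          finally show "(INF F\<in>fin_subsets G. INF \<delta>\<in>{0<..}. limsup (?D \<alpha> F \<delta>)) \<le> ereal (base.rate \<alpha>0) + ereal \<eta>"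
            by simp
        qed
        then show "\<exists>\<alpha>0\<in>{\<alpha>. finite_open_cover Y \<alpha>}.
            (INF F\<in>fin_subsets G. INF \<delta>\<in>{0<..}. limsup (?D \<alpha> F \<delta>)) \<le> ereal (base.rate \<alpha>0)"
          using \<alpha>0 by blast
      qed
      show "(SUP \<alpha>\<in>{\<alpha>. finite_open_cover Y \<alpha>}. ereal (base.rate \<alpha>)) \<le>
          (SUP \<alpha>\<in>{\<alpha>. finite_open_cover Y \<alpha>}. INF F\<in>fin_subsets G. INF \<delta>\<in>{0<..}. limsup (?D \<alpha> F \<delta>))"
      proof (rule SUP_mono)
        fix \<alpha> assume \<alpha>: "\<alpha> \<in> {\<alpha>. finite_open_cover Y \<alpha>}"
        have "ereal (base.rate \<alpha>) \<le> (INF F\<in>fin_subsets G. INF \<delta>\<in>{0<..}. limsup (?D \<alpha> F \<delta>))"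
        proof (intro INF_greatest)
          fix F and \<delta> :: real assume F: "F \<in> fin_subsets G" "\<delta> \<in> {0<..}"
          show "ereal (base.rate \<alpha>) \<le> limsup (?D \<alpha> F \<delta>)"
          proof (rule ereal_le_epsilon2)
            fix \<eta> :: real assume \<eta>: "0 < \<eta>"
            have "ereal (base.rate \<alpha> - \<eta>) \<le> limsup (?D \<alpha> F \<delta>)"
              using \<alpha> F \<eta> by (intro le_Limsup sofic_lower[OF nb inf sof \<rho> ne]) auto
            then have "ereal (base.rate \<alpha> - \<eta>) + ereal \<eta> \<le> limsup (?D \<alpha> F \<delta>) + ereal \<eta>"
              by (rule add_right_mono)
            then show "ereal (base.rate \<alpha>) \<le> limsup (?D \<alpha> F \<delta>) + ereal \<eta>" by simp
          qed
        qed
        then show "\<exists>\<beta>\<in>{\<alpha>. finite_open_cover Y \<alpha>}.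
            ereal (base.rate \<alpha>) \<le> (INF F\<in>fin_subsets G. INF \<delta>\<in>{0<..}. limsup (?D \<beta> F \<delta>))"
          using \<alpha> by blast
      qed
    qed
  qed
qed

end

section \<open>Powers of factor maps and reduction of the sofic identity to the conditional
  one\<close>

lemma factor_system_power:
  assumes "factor_system G X \<phi> Y \<psi> \<pi>"
  shows "factor_system G (power_space n X) (diagonal_action n X \<phi>) (power_space n Y)
    (diagonal_action n Y \<psi>) (compose {1..n} \<pi>)"
proof -
  interpret factor_system G X \<phi> Y \<psi> \<pi> by fact
  \<comment> \<open>The power of the one-point base is a one-point space of another type. From this
    instance only the facts about the action on the power of \<open>Y\<close> are carried
    over.\<close>
  interpret bn: fibred_system G "power_space n Y" "diagonal_action n Y \<psi>"
      "power_space n (discrete_topology {()})" "compose {1..n} (\<lambda>_. ())"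
    by (rule fibred_system_power[OF base])
  interpret tn: fibred_system G "power_space n X" "diagonal_action n X \<phi>" "power_space n Y" "compose {1..n} \<pi>"
    by (rule fibred_system_power[OF total])
  let ?p = "compose {1..n} \<pi>"
  have coord: "x j \<in> topspace X" if "x \<in> topspace (power_space n X)" "j \<in> {1..n}" for x j
    using that by (auto simp: topspace_power_space)
  show ?thesis
  proof unfold_locales
    show "compact_space (power_space n Y)" by (rule bn.compact)
    show "metrizable_space (power_space n Y)" by (rule bn.metrizable)
    show "continuous_map (power_space n Y) (power_space n Y) (diagonal_action n Y \<psi> g)" if "g \<in> carrier G" for g
      by (rule bn.continuous_action[OF that])
    show "diagonal_action n Y \<psi> (g \<otimes>\<^bsub>G\<^esub> h) y = diagonal_action n Y \<psi> g (diagonal_action n Y \<psi> h y)"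
      if "g \<in> carrier G" "h \<in> carrier G" "y \<in> topspace (power_space n Y)" for g h y
      by (rule bn.action_mult[OF that])
    show "continuous_map (power_space n X) (power_space n Y) ?p"
    proof (rule continuous_map_power_spaceI)
      fix j assume j: "j \<in> {1..n}"
      have "continuous_map (power_space n X) Y (\<pi> \<circ> (\<lambda>x. x j))"
        by (rule continuous_map_compose[OF continuous_map_power_space_proj[OF j] continuous_factor])
      then show "continuous_map (power_space n X) Y (\<lambda>x. ?p x j)" using j by (simp add: compose_def o_def)
    qed (simp add: compose_def)
    show "?p ` topspace (power_space n X) = topspace (power_space n Y)"
    proof
      show "?p ` topspace (power_space n X) \<subseteq> topspace (power_space n Y)" by (rule tn.image_subset)
      show "topspace (power_space n Y) \<subseteq> ?p ` topspace (power_space n X)"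
      proof
        fix y assume y: "y \<in> topspace (power_space n Y)"
        then have "\<exists>x\<in>topspace X. \<pi> x = y j" if "j \<in> {1..n}" for j
          using PiE_mem[OF y[unfolded topspace_power_space] that] surj by (metis imageE)
        then obtain x where x: "\<And>j. j \<in> {1..n} \<Longrightarrow> x j \<in> topspace X \<and> \<pi> (x j) = y j" by metis
        have "y = ?p (restrict x {1..n})"
        proof
          fix j show "y j = ?p (restrict x {1..n}) j"
            using x[of j] PiE_arb[OF y[unfolded topspace_power_space], of j] by (auto simp: compose_def)
        qed
        moreover have "restrict x {1..n} \<in> topspace (power_space n X)"
          using x by (simp add: topspace_power_space)
        ultimately show "y \<in> ?p ` topspace (power_space n X)" by blast
      qed
    qed
    show "?p (diagonal_action n X \<phi> g x) = diagonal_action n Y \<psi> g (?p x)"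
      if g: "g \<in> carrier G" and x: "x \<in> topspace (power_space n X)" for g x
    proof -
      have "?p x \<in> topspace (power_space n Y)" using tn.image_subset x by blast
      then show ?thesis
        using equivariant[OF g coord[OF x]] x
        by (auto simp: diagonal_action_apply compose_def intro!: restrict_ext)
    qed
  qed (use tn.fibred_system_axioms bn.fibred_system_axioms in auto)
qed

lemma G_system_action:
  assumes "group G" and "G_system G X \<phi>"
  shows "compact_space X" "metrizable_space X" "g \<in> carrier G \<Longrightarrow> continuous_map X X (\<phi> g)"
    and "g \<in> carrier G \<Longrightarrow> h \<in> carrier G \<Longrightarrow> x \<in> topspace X \<Longrightarrow> \<phi> (g \<otimes>\<^bsub>G\<^esub> h) x = \<phi> g (\<phi> h x)"
  using assms group_action.composition_rule[of G "topspace X" \<phi>]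
  by (auto simp: G_system_def homeomorphic_imp_continuous_map)

lemma factor_systemI:
  assumes G: "group G" and X: "G_system G X \<phi>" and Y: "G_system G Y \<psi>" and \<pi>: "factor_map G X \<phi> Y \<psi> \<pi>"
  shows "factor_system G X \<phi> Y \<psi> \<pi>"
proof -
  have eq: "\<pi> (\<phi> g x) = \<psi> g (\<pi> x)" if "g \<in> carrier G" "x \<in> topspace X" for g x
    using \<pi> that by (simp add: factor_map_def)
  have "fibred_system G Y \<psi> (discrete_topology {()}) (\<lambda>_. ())"
    by (intro fibred_system.intro fibred_system_axioms.intro G) (use G_system_action[OF G Y] in auto)
  moreover have "fibred_system G X \<phi> Y \<pi>"
    by (intro fibred_system.intro fibred_system_axioms.intro G)
      (use G_system_action[OF G X] eq \<pi> in \<open>auto simp: factor_map_def\<close>)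
  ultimately show ?thesis
    by (intro factor_system.intro factor_system_axioms.intro G)
      (use eq \<pi> in \<open>auto simp: factor_map_def\<close>)
qed

theorem corollary8p9:
  fixes G :: "('g, 'm) monoid_scheme"
    and X :: "'a topology" and \<phi> :: "'g \<Rightarrow> 'a \<Rightarrow> 'a"
    and Y :: "'b topology" and \<psi> :: "'g \<Rightarrow> 'b \<Rightarrow> 'b"
    and \<pi> :: "'a \<Rightarrow> 'b" and n :: nat
  assumes "group G" and "countable (carrier G)" and "infinite (carrier G)" and "amenable G"
    and "G_system G X \<phi>" and "G_system G Y \<psi>" and "factor_map G X \<phi> Y \<psi> \<pi>"
    and "n \<ge> 1"
  shows "cond_mdim G X \<phi> Y \<pi> =
           ereal (1 / real n) *
           cond_mdim G (power_space n X) (diagonal_action n X \<phi>) (power_space n Y) (compose {1..n} \<pi>)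
         \<and>
         (\<forall>d \<sigma>. sofic_approximation G d \<sigma> \<longrightarrow>
           (\<forall>\<rho> \<rho>n. compatible_metric X \<rho> \<longrightarrow> compatible_metric (power_space n X) \<rho>n \<longrightarrow>
              sofic_mdim G d \<sigma> X \<phi> \<rho> Y \<pi> =
              ereal (1 / real n) *
              sofic_mdim G d \<sigma> (power_space n X) (diagonal_action n X \<phi>) \<rho>n
                (power_space n Y) (compose {1..n} \<pi>)))"
proof -
  interpret factor_system G X \<phi> Y \<psi> \<pi> by (rule factor_systemI[OF assms(1,5,6,7)])
  interpret power: factor_system G "power_space n X" "diagonal_action n X \<phi>" "power_space n Y"
      "diagonal_action n Y \<psi>" "compose {1..n} \<pi>"
    by (rule factor_system_power[OF factor_system_axioms])
  have nb: "invariance_filter G \<noteq> bot" by (rule invariance_filter_neq_bot[OF assms(4)])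
  let ?pt = "discrete_topology {()}"
  \<comment> \<open>\<open>cond_mdim_power\<close> for \<open>Y\<close> over a point produces the
    power of that point as base. It is again a single point, so the conditional dimensions agree
    with those over \<open>?pt\<close>.\<close>
  have "cond_mdim G (power_space n Y) (diagonal_action n Y \<psi>) (power_space n ?pt) (compose {1..n} (\<lambda>_. ())) =
      cond_mdim G (power_space n Y) (diagonal_action n Y \<psi>) ?pt (\<lambda>_. ())"
  proof -
    have "topspace (power_space n ?pt) = {\<lambda>_. ()}"
      by (auto simp: topspace_power_space PiE_iff extensional_def)
    then have "cond_dim (power_space n Y) (power_space n ?pt) (compose {1..n} (\<lambda>_. ())) =
        cond_dim (power_space n Y) ?pt (\<lambda>_. ())"
      by (intro ext) (simp add: cond_dim_singleton[of _ "\<lambda>_. ()"] cond_dim_singleton[of _ "()"] fun_eq_iff)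
    then show ?thesis by (simp add: cond_mdim_def)
  qed
  then have "cond_mdim G Y \<psi> ?pt (\<lambda>_. ()) =
      ereal (1 / real n) * cond_mdim G (power_space n Y) (diagonal_action n Y \<psi>) ?pt (\<lambda>_. ())"
    using base.cond_mdim_power[OF nb assms(8,3)] by simp
  then show ?thesis
    using total.cond_mdim_power[OF nb assms(8,3)] sofic_mdim_eq_mdim[OF nb assms(3)]
      power.sofic_mdim_eq_mdim[OF nb assms(3)] by simp
qed

end
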